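(* Let $\Omega$ be a bounded domain of $\mathbb{R}^n$, let $2\le p<\infty$, $1<q\le p$ and $\sigma>0$. Let $\bm{a}:\Omega\times\mathbb{R}^n\to\mathbb{R}^n$ be a Carathéodory function (measurable in $x$, continuous in $\xi$) such that there is $\gamma>0$ with $$(\bm{a}(x,\xi)-\bm{a}(x,\eta))\cdot(\xi-\eta)\ge\gamma\,|\xi-\eta|^r$$ for all $x\in\Omega$, $\xi,\eta\in\mathbb{R}^n$ and all $r\in[\max(2,q),p]$. Let $f,g:\Omega\times\mathbb{R}\to\mathbb{R}$ be continuous, with $f(x,t)$ and $g(x,t)$ non-decreasing in $t\in\mathbb{R}$ for every $x\in\Omega$. Suppose that either $u,v\in W^{1,p}_{loc}(\Omega)\cap L^\infty_{loc}(\Omega)$ and one of the following holds: (A$_1$) $0<\sigma\le1$ and $f$ is increasing in $t$; (A$_{2a}$) $1\le\sigma\le\max(q,2)-1$ and $f$ and $g$ are increasing in $t$; (A$_{2b}$) $\max(q,2)-1\le\sigma\le p-1$ and $g$ is increasing in $t$; (A$_3$) $p-1\le\sigma\le p$, $g$ is increasing in $t$, and $\operatorname{ess\,sup}_\Omega(u-v)<\infty$; or $u,v\in W^{1,\infty}_{loc}(\Omega)$ and (A$_4$) $p\le\sigma$ and $g$ is increasing in $t$. If $Q^*u\le Q^*v$ in $\Omega$ and $u\le v$ on $\partial\Omega$, then $u\le v$ in $\Omega$.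
   Context: Here $Q^*u:=-\operatorname{div}(\bm{a}(x,\nabla u))+f(x,u)+g(x,u)|\nabla u|^\sigma$. "Increasing in $t$" means strictly increasing in $t\in\mathbb{R}$ for every $x\in\Omega$. The inequality $Q^*u\le Q^*v$ in $\Omega$ means $$\int_\Omega(\bm{a}(x,\nabla u)-\bm{a}(x,\nabla v))\cdot\nabla\varphi\le\int_\Omega\big(f(x,v)+g(x,v)|\nabla v|^\sigma-f(x,u)-g(x,u)|\nabla u|^\sigma\big)\varphi$$ for all $\varphi\in C^1_c(\Omega)$ with $\varphi\ge0$; whenever this is used it is understood that the consistency conditions $|\bm{a}(x,\nabla u)|,|\bm{a}(x,\nabla v)|,f(x,u),f(x,v)\in L^{p/(p-1)}_{loc}(\Omega)$ hold (or, for $u,v\in W^{1,\infty}_{loc}(\Omega)$, these lie in $L^1_{loc}(\Omega)$), so that the integrals are well defined and the inequality may be used with non-negative test functions $\varphi\in W^{1,p}(\Omega)$ of compact support in $\Omega$. "$u\le v$ in $\Omega$" means a.e.; "$u\le v$ on $\partial\Omega$" means $\limsup_{x\to\partial\Omega}(u(x)-v(x))\le0$. *)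

theory Defs
  imports "HOL-Analysis.Analysis"
begin

definition partial_deriv :: "(real^'n \<Rightarrow> real) \<Rightarrow> 'n \<Rightarrow> real^'n \<Rightarrow> real" where
  "partial_deriv \<phi> i x = frechet_derivative \<phi> (at x) (axis i 1)"

definition grad :: "(real^'n \<Rightarrow> real) \<Rightarrow> real^'n \<Rightarrow> real^'n" where
  "grad \<phi> x = (\<chi> i. partial_deriv \<phi> i x)"

definition test_fun :: "(real^'n) set \<Rightarrow> (real^'n \<Rightarrow> real) \<Rightarrow> bool" where
  "test_fun \<Omega> \<phi> \<longleftrightarrow>
     (\<forall>x. \<phi> differentiable (at x)) \<and>
     (\<forall>i. continuous_on UNIV (partial_deriv \<phi> i)) \<and>
     compact (closure {x. \<phi> x \<noteq> 0}) \<and> closure {x. \<phi> x \<noteq> 0} \<subseteq> \<Omega>"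

definition locLp :: "(real^'n) set \<Rightarrow> real \<Rightarrow> (real^'n \<Rightarrow> real) \<Rightarrow> bool" where
  "locLp \<Omega> p u \<longleftrightarrow> u \<in> borel_measurable (lebesgue_on \<Omega>) \<and>
     (\<forall>K. compact K \<and> K \<subseteq> \<Omega> \<longrightarrow> integrable (lebesgue_on K) (\<lambda>x. \<bar>u x\<bar> powr p))"

definition locLinf :: "(real^'n) set \<Rightarrow> (real^'n \<Rightarrow> real) \<Rightarrow> bool" where
  "locLinf \<Omega> u \<longleftrightarrow> u \<in> borel_measurable (lebesgue_on \<Omega>) \<and>
     (\<forall>K. compact K \<and> K \<subseteq> \<Omega> \<longrightarrow> (\<exists>C. AE x in lebesgue_on K. \<bar>u x\<bar> \<le> C))"

definition weak_grad :: "(real^'n) set \<Rightarrow> (real^'n \<Rightarrow> real) \<Rightarrow> (real^'n \<Rightarrow> real^'n) \<Rightarrow> bool" where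
  "weak_grad \<Omega> u G \<longleftrightarrow> locLp \<Omega> 1 u \<and> (\<forall>i. locLp \<Omega> 1 (\<lambda>x. G x $ i)) \<and>
     (\<forall>\<phi> i. test_fun \<Omega> \<phi> \<longrightarrow>
        (\<integral>x. u x * partial_deriv \<phi> i x \<partial>lebesgue_on \<Omega>) = - (\<integral>x. G x $ i * \<phi> x \<partial>lebesgue_on \<Omega>))"

definition W1p_loc :: "(real^'n) set \<Rightarrow> real \<Rightarrow> (real^'n \<Rightarrow> real) \<Rightarrow> bool" where
  "W1p_loc \<Omega> p u \<longleftrightarrow> locLp \<Omega> p u \<and> (\<exists>G. weak_grad \<Omega> u G \<and> locLp \<Omega> p (\<lambda>x. norm (G x)))"

definition W1inf_loc :: "(real^'n) set \<Rightarrow> (real^'n \<Rightarrow> real) \<Rightarrow> bool" where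
  "W1inf_loc \<Omega> u \<longleftrightarrow> locLinf \<Omega> u \<and> (\<exists>G. weak_grad \<Omega> u G \<and> locLinf \<Omega> (\<lambda>x. norm (G x)))"

definition Qstar_le ::
  "(real^'n) set \<Rightarrow> (real^'n \<Rightarrow> real^'n \<Rightarrow> real^'n) \<Rightarrow> (real^'n \<Rightarrow> real \<Rightarrow> real) \<Rightarrow>
   (real^'n \<Rightarrow> real \<Rightarrow> real) \<Rightarrow> real \<Rightarrow>
   (real^'n \<Rightarrow> real) \<Rightarrow> (real^'n \<Rightarrow> real^'n) \<Rightarrow> (real^'n \<Rightarrow> real) \<Rightarrow> (real^'n \<Rightarrow> real^'n) \<Rightarrow> bool" where
  "Qstar_le \<Omega> a f g \<sigma> u Du v Dv \<longleftrightarrow>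
    (\<forall>\<phi>. test_fun \<Omega> \<phi> \<and> (\<forall>x. 0 \<le> \<phi> x) \<longrightarrow>
      (let L = (\<lambda>x. (a x (Du x) - a x (Dv x)) \<bullet> grad \<phi> x);
           R = (\<lambda>x. (f x (v x) + g x (v x) * norm (Dv x) powr \<sigma>
                      - f x (u x) - g x (u x) * norm (Du x) powr \<sigma>) * \<phi> x)
       in integrable (lebesgue_on \<Omega>) L \<and> integrable (lebesgue_on \<Omega>) R \<and>
          (\<integral>x. L x \<partial>lebesgue_on \<Omega>) \<le> (\<integral>x. R x \<partial>lebesgue_on \<Omega>)))"

text \<open>u <= v on the boundary: limsup_{x -> boundary} (u - v) <= 0, in the essential sense:
  for every eps > 0, u - v <= eps a.e. outside some compact subset of Omega.\<close>
definition bdry_le :: "(real^'n) set \<Rightarrow> (real^'n \<Rightarrow> real) \<Rightarrow> (real^'n \<Rightarrow> real) \<Rightarrow> bool" where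
  "bdry_le \<Omega> u v \<longleftrightarrow> (\<forall>\<epsilon>>0. \<exists>K. compact K \<and> K \<subseteq> \<Omega> \<and>
      (AE x in lebesgue_on (\<Omega> - K). u x - v x \<le> \<epsilon>))"

end

theory Submission
  imports Defs
begin

text \<open>Let \<open>w = u - v\<close>, let \<open>S\<close> be its essential supremum and suppose \<open>S > 0\<close>.  Near the boundary
  \<open>w \<le> S/2\<close>, so for \<open>S/2 \<le> k < S\<close> and \<open>z = (w - k)\<^sup>+\<close> the function \<open>z\<^sup>2\<close> is an admissible test function;
  it is approximated by \<open>C\<^sup>1\<close> functions of mollifications of \<open>w\<close>.  On the compact set where
  \<open>w > S/2\<close> the strict monotonicity of \<open>f\<close> or \<open>g\<close> has a uniform gap, which absorbs the terms in \<open>|Du|\<close>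
  alone, so that in all cases the right hand side is at most \<open>C (|Dw|\<^bsup>r-1\<^esup> + |Dw|\<^bsup>r\<^esup>)\<close> for a suitable
  \<open>r\<close> between \<open>max 2 q\<close> and \<open>p\<close>.  For \<open>k\<close> close to \<open>S\<close> this gives
  \<open>\<integral> |Dw|\<^bsup>r\<^esup> z \<le> C \<integral> z\<^bsup>r+1\<^esup>\<close>, the right hand integral being over \<open>{w < S}\<close> because \<open>Dw = 0\<close> on \<open>{w = S}\<close>.
  A Faber--Krahn inequality for \<open>z\<^bsup>r+1\<^esup>\<close> turns it into \<open>\<integral> z\<^bsup>r+1\<^esup> \<le> C \<rho> \<integral> z\<^bsup>r+1\<^esup>\<close> whenever \<open>{w > k}\<close> is
  small compared with a ball of radius \<open>\<rho>\<close>.  With a large \<open>\<rho>\<close> this shows that \<open>{w = S}\<close> is a null set, so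
  that \<open>{w > k}\<close> becomes small as \<open>k\<close> tends to \<open>S\<close>; then a small \<open>\<rho>\<close> yields \<open>w \<le> k < S\<close>.\<close>

section \<open>Convergence and density in \<open>L\<^sup>1\<close>\<close>

text \<open>The square of the truncation is tested, and not the truncation itself, because test
  functions are C^1 and \<open>max 0 (w - k)\<close> has a kink at \<open>k\<close>. Faber-Krahn is
  applied to the power r + 1 since the gradient (r + 1) z^r |Dw| is at most (r + 1) z (z^r +
  |Dw|^r), and the energy estimate with the weight z controls exactly this quantity. Working in L^1
  keeps the inequality elementary: it follows from translations, holds in every dimension and
  imposes no relation between p and the dimension.

  The obstacle is that {w > k} need not become small as k tends to S while {w = S} may have positive
  measure; one and the same inequality therefore serves at two different radii.

  The exponent r depends on the case: it is \<open>\<sigma> + 1\<close> in the intermediate range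
  max(q,2) - 1 <= \<open>\<sigma>\<close> <= p - 1, where the lower order terms grow exactly like
  |Dw|^(r-1), and p in the other cases. Here the monotonicity of \<open>a\<close> for a whole range
  of exponents enters. The gap of \<open>f\<close> or \<open>g\<close> is uniform only on a compact
  set and for a fixed distance between u and v; both are supplied by the level S/2, so S is fixed
  before any constant is chosen.\<close>

lemma integral_dominated_convergence_varying:
  fixes f :: "'a \<Rightarrow> real"
  assumes [measurable]: "f \<in> borel_measurable M" "\<And>n. F n \<in> borel_measurable M"
    and G: "\<And>n. integrable M (G n)" and g: "integrable M g"
    and lim: "AE x in M. (\<lambda>n. F n x) \<longlonglongrightarrow> f x"
    and bound: "\<And>n. AE x in M. \<bar>F n x\<bar> \<le> G n x"
    and fg: "AE x in M. \<bar>f x\<bar> \<le> g x"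
    and L1: "(\<lambda>n. \<integral>x. \<bar>G n x - g x\<bar> \<partial>M) \<longlonglongrightarrow> 0"
  shows "integrable M f" "\<And>n. integrable M (F n)" "(\<lambda>n. \<integral>x. F n x \<partial>M) \<longlonglongrightarrow> (\<integral>x. f x \<partial>M)"
proof -
  \<comment> \<open>The majorants \<open>G n\<close> change with \<open>n\<close>. Clipping
    \<open>F n\<close> at |g| gives a sequence with one fixed majorant, and the part clipped off is
    at most |G n - g|, which tends to 0 in L^1. In the applications \<open>G n\<close> contains the
    mollification of |Dw|^p.\<close>
  define H where "H n x = max (- \<bar>g x\<bar>) (min \<bar>g x\<bar> (F n x))" for n x
  have [measurable]: "g \<in> borel_measurable M" "\<And>n. G n \<in> borel_measurable M" using g G by auto
  have [measurable]: "\<And>n. H n \<in> borel_measurable M" unfolding H_def by measurable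
  show Fi: "integrable M (F n)" for n
    by (rule Bochner_Integration.integrable_bound[OF G[of n]]) (use bound[of n] in \<open>auto elim: eventually_mono\<close>)
  have Hi: "integrable M (H n)" for n
    by (rule Bochner_Integration.integrable_bound[OF g]) (auto simp: H_def)
  have Hlim: "AE x in M. (\<lambda>n. H n x) \<longlonglongrightarrow> f x"
    using lim fg
  proof eventually_elim
    case (elim x)
    then have "(\<lambda>n. H n x) \<longlonglongrightarrow> max (- \<bar>g x\<bar>) (min \<bar>g x\<bar> (f x))"
      unfolding H_def by (intro tendsto_intros)
    also have "max (- \<bar>g x\<bar>) (min \<bar>g x\<bar> (f x)) = f x" using elim(2) by linarith
    finally show ?case .
  qed
  have dom: "AE x in M. norm (H n x) \<le> norm (g x)" for n by (auto simp: H_def)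
  note dc = integral_dominated_convergence[OF assms(1) _ integrable_norm[OF g] Hlim dom] 
    integrable_dominated_convergence[OF assms(1) _ integrable_norm[OF g] Hlim dom]
  show "integrable M f" by (rule dc(2)) auto
  have 1: "(\<lambda>n. \<integral>x. H n x \<partial>M) \<longlonglongrightarrow> (\<integral>x. f x \<partial>M)" by (rule dc(1)) auto
  have 2: "(\<lambda>n. (\<integral>x. F n x \<partial>M) - (\<integral>x. H n x \<partial>M)) \<longlonglongrightarrow> 0"
  proof (rule Lim_null_comparison[OF _ L1], rule always_eventually, rule allI)
    fix n
    have "norm ((\<integral>x. F n x \<partial>M) - (\<integral>x. H n x \<partial>M)) = norm (\<integral>x. F n x - H n x \<partial>M)"
      using Fi Hi by simp
    also have "\<dots> \<le> (\<integral>x. norm (F n x - H n x) \<partial>M)" by simp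
    also have "\<dots> \<le> (\<integral>x. \<bar>G n x - g x\<bar> \<partial>M)"
    proof (rule integral_mono_AE)
      show "AE x in M. norm (F n x - H n x) \<le> \<bar>G n x - g x\<bar>"
        using bound[of n] fg by eventually_elim (auto simp: H_def)
    qed (use Fi Hi G g in auto)
    finally show "norm ((\<integral>x. F n x \<partial>M) - (\<integral>x. H n x \<partial>M)) \<le> (\<integral>x. \<bar>G n x - g x\<bar> \<partial>M)" .
  qed
  show "(\<lambda>n. \<integral>x. F n x \<partial>M) \<longlonglongrightarrow> (\<integral>x. f x \<partial>M)"
    using tendsto_add[OF 1 2] by simp
qed

lemma nn_integral_lborel_diff:
  fixes x :: "'a::euclidean_space"
  assumes [measurable]: "f \<in> borel_measurable borel"
  shows "(\<integral>\<^sup>+y. f (x - y) \<partial>lborel) = (\<integral>\<^sup>+y. f y \<partial>lborel)"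
proof -
  have "(\<integral>\<^sup>+y. f y \<partial>lborel) =
      (\<integral>\<^sup>+y. f y \<partial>density (distr lborel borel (\<lambda>y. x + (-1) *\<^sub>R y)) (\<lambda>_. ennreal (\<bar>- 1 :: real\<bar> ^ DIM('a))))"
    by (subst lborel_affine[of "-1" x]) auto
  also have "\<dots> = (\<integral>\<^sup>+y. f (x - y) \<partial>lborel)"
    by (simp add: nn_integral_density nn_integral_distr)
  finally show ?thesis by simp
qed

lemma nn_integral_lborel_plus:
  fixes x :: "'a::euclidean_space"
  assumes [measurable]: "f \<in> borel_measurable borel"
  shows "(\<integral>\<^sup>+y. f (x + y) \<partial>lborel) = (\<integral>\<^sup>+y. f y \<partial>lborel)"
  by (subst (2) lborel_distr_plus[of x, symmetric]) (simp add: nn_integral_distr)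

text \<open>Clipping the values with the radial retraction \<open>T m\<close> and multiplying by the
  cutoff \<open>\<theta> m\<close> yields a bounded function \<open>V\<close> of bounded support
  close to \<open>W\<close>. Measurability provides continuous \<open>G j\<close> converging to
  \<open>W\<close> almost everywhere; clipped and cut off in the same way they remain continuous and
  share one integrable bound, so dominated convergence applies.\<close>

lemma integrable_dense_continuous_support:
  fixes W :: "'a::euclidean_space \<Rightarrow> 'b::euclidean_space"
  assumes W: "integrable lborel W" and e: "0 < e"
  shows "\<exists>g R. continuous_on UNIV g \<and> (\<forall>x. R \<le> norm x \<longrightarrow> g x = 0) \<and> integrable lborel g \<and>
     (\<integral>x. norm (W x - g x) \<partial>lborel) < e"
proof -
  have Wm[measurable]: "W \<in> borel_measurable borel" using W by auto
  have "W \<in> borel_measurable lebesgue" by (intro measurable_completion) simp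
  then have "W measurable_on UNIV" by (rule lebesgue_measurable_imp_measurable_on) simp
  then obtain N G where N: "negligible N" and Gc: "\<And>n. continuous_on UNIV (G n)"
    and Glim: "\<And>x. x \<notin> N \<Longrightarrow> (\<lambda>n. G n x) \<longlonglongrightarrow> W x"
    unfolding measurable_on_def by auto
  have "AE x in lebesgue. x \<notin> N" by (rule AE_not_in[OF N[unfolded negligible_iff_null_sets]])
  then have AEN: "AE x in lborel. x \<notin> N" by (simp add: AE_completion_iff)
  define T :: "real \<Rightarrow> 'b \<Rightarrow> 'b" where "T m y = (m / max m (norm y)) *\<^sub>R y" for m y
  define \<theta> :: "real \<Rightarrow> 'a \<Rightarrow> real" where "\<theta> m x = max 0 (min 1 (m + 1 - norm x))" for m x
  have Tcont: "continuous_on UNIV (T m)" if "m > 0" for m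
    unfolding T_def using that by (intro continuous_intros) (auto simp: max_def)
  have [measurable]: "T m \<in> borel_measurable borel" if "m > 0" for m
    by (rule borel_measurable_continuous_onI[OF Tcont[OF that]])
  have \<theta>cont: "continuous_on UNIV (\<theta> m)" for m
    unfolding \<theta>_def by (auto intro!: continuous_intros)
  have [measurable]: "\<theta> m \<in> borel_measurable borel" for m
    by (rule borel_measurable_continuous_onI[OF \<theta>cont])
  have Tnorm: "norm (T m y) \<le> m" if "m > 0" for m y
  proof -
    have "norm (T m y) = m * (norm y / max m (norm y))" using that by (simp add: T_def)
    also have "\<dots> \<le> m * 1" using that by (intro mult_left_mono) (auto simp: max_def)
    finally show ?thesis by simp
  qed
  have "(\<lambda>n. \<integral>x. norm (W x - \<theta> (real (Suc n)) x *\<^sub>R T (real (Suc n)) (W x)) \<partial>lborel) \<longlonglongrightarrow> (\<integral>x. 0 \<partial>(lborel::'a measure))"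
  proof (rule integral_dominated_convergence[where w="\<lambda>x. norm (W x)"])
    show "AE x in lborel. (\<lambda>n. norm (W x - \<theta> (real (Suc n)) x *\<^sub>R T (real (Suc n)) (W x))) \<longlonglongrightarrow> 0"
    proof (rule AE_I2)
      fix x
      obtain k where k: "max (norm x) (norm (W x)) \<le> real k" using real_arch_simple by blast
      have "norm (W x - \<theta> (real (Suc n)) x *\<^sub>R T (real (Suc n)) (W x)) = 0" if "n \<ge> k" for n
      proof -
        have "real k \<le> real n" using that by simp
        then have 1: "norm x \<le> real n" "norm (W x) \<le> real n" using k by auto
        then have "\<theta> (real (Suc n)) x = 1" by (auto simp: \<theta>_def)
        moreover have "max (real (Suc n)) (norm (W x)) = real (Suc n)" using 1 by auto
        then have "T (real (Suc n)) (W x) = W x" by (auto simp: T_def)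
        ultimately show ?thesis by simp
      qed
      then show "(\<lambda>n. norm (W x - \<theta> (real (Suc n)) x *\<^sub>R T (real (Suc n)) (W x))) \<longlonglongrightarrow> 0"
        by (intro tendsto_eventually) (auto simp: eventually_sequentially)
    qed
    show "AE x in lborel. norm (norm (W x - \<theta> (real (Suc n)) x *\<^sub>R T (real (Suc n)) (W x))) \<le> norm (W x)" for n
    proof (rule AE_I2)
      fix x
      define c where "c = \<theta> (real (Suc n)) x * (real (Suc n) / max (real (Suc n)) (norm (W x)))"
      have "0 \<le> \<theta> (real (Suc n)) x" "\<theta> (real (Suc n)) x \<le> 1" by (auto simp: \<theta>_def)
      moreover have "0 \<le> (real (Suc n) / max (real (Suc n)) (norm (W x)))" "(real (Suc n) / max (real (Suc n)) (norm (W x))) \<le> 1"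
        by auto
      ultimately have c: "0 \<le> c" "c \<le> 1" unfolding c_def by (auto simp only: mult_le_one mult_nonneg_nonneg)
      have "W x - \<theta> (real (Suc n)) x *\<^sub>R T (real (Suc n)) (W x) = (1 - c) *\<^sub>R W x"
        by (simp add: c_def T_def scaleR_left_diff_distrib)
      then show "norm (norm (W x - \<theta> (real (Suc n)) x *\<^sub>R T (real (Suc n)) (W x))) \<le> norm (W x)"
        using c by (simp add: mult_left_le_one_le)
    qed
  qed (use W in auto)
  then have "eventually (\<lambda>n. (\<integral>x. norm (W x - \<theta> (real (Suc n)) x *\<^sub>R T (real (Suc n)) (W x)) \<partial>lborel) < e/2) sequentially"
    using e by (intro order_tendstoD) auto
  then obtain n where n: "(\<integral>x. norm (W x - \<theta> (real (Suc n)) x *\<^sub>R T (real (Suc n)) (W x)) \<partial>lborel) < e/2"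
    by (auto simp: eventually_sequentially)
  define m where "m = real (Suc n)"
  have m: "m > 0" by (simp add: m_def)
  define V where "V x = \<theta> m x *\<^sub>R T m (W x)" for x
  define g where "g j x = \<theta> m x *\<^sub>R T m (G j x)" for j x
  have [measurable]: "\<And>j. G j \<in> borel_measurable borel" using Gc borel_measurable_continuous_onI by blast
  have [measurable]: "V \<in> borel_measurable borel" "\<And>j. g j \<in> borel_measurable borel"
    unfolding V_def g_def using m by measurable
  have ind: "integrable lborel (\<lambda>x::'a. m * indicator (cball 0 (m+1)) x :: real)"
    using emeasure_bounded_finite[of "cball (0::'a) (m+1)"] by (intro integrable_mult_right) (simp add: less_top)
  have bd: "norm (\<theta> m x *\<^sub>R T m y) \<le> m * indicator (cball 0 (m+1)) x" for x y
  proof -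
    have "\<theta> m x \<le> indicator (cball 0 (m+1)) x" "0 \<le> \<theta> m x" by (auto simp: \<theta>_def indicator_def)
    then have "\<theta> m x * norm (T m y) \<le> indicator (cball 0 (m+1)) x * m"
      using Tnorm[OF m, of y] by (intro mult_mono) auto
    then show ?thesis using \<open>0 \<le> \<theta> m x\<close> by (simp add: mult.commute)
  qed
  have gi: "integrable lborel (g j)" for j
    by (rule Bochner_Integration.integrable_bound[OF ind]) (simp, auto simp only: g_def real_norm_def intro!: AE_I2 order_trans[OF bd abs_ge_self])
  have Vi: "integrable lborel V"
    by (rule Bochner_Integration.integrable_bound[OF ind]) (simp, auto simp only: V_def real_norm_def intro!: AE_I2 order_trans[OF bd abs_ge_self])
  have "(\<lambda>j. \<integral>x. norm (V x - g j x) \<partial>lborel) \<longlonglongrightarrow> (\<integral>x. 0 \<partial>(lborel::'a measure))"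
  proof (rule integral_dominated_convergence[where w="\<lambda>x. 2 * (m * indicator (cball 0 (m+1)) x)"])
    show "AE x in lborel. (\<lambda>j. norm (V x - g j x)) \<longlonglongrightarrow> 0"
      using AEN
    proof eventually_elim
      case (elim x)
      have "isCont (T m) (W x)" using Tcont[OF m] continuous_on_eq_continuous_at open_UNIV by blast
      then have "(\<lambda>j. T m (G j x)) \<longlonglongrightarrow> T m (W x)" using Glim[OF elim] by (rule isCont_tendsto_compose)
      then have "(\<lambda>j. norm (V x - g j x)) \<longlonglongrightarrow> norm (V x - \<theta> m x *\<^sub>R T m (W x))"
        unfolding g_def by (intro tendsto_intros)
      then show ?case by (simp add: V_def)
    qed
    show "AE x in lborel. norm (norm (V x - g j x)) \<le> 2 * (m * indicator (cball 0 (m+1)) x)" for j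
    proof (rule AE_I2)
      fix x
      have "norm (V x - g j x) \<le> norm (V x) + norm (g j x)" by (rule norm_triangle_ineq4)
      then show "norm (norm (V x - g j x)) \<le> 2 * (m * indicator (cball 0 (m+1)) x)"
        using bd[of x "W x"] bd[of x "G j x"] unfolding V_def g_def real_norm_def abs_norm_cancel by linarith
    qed
  qed (use ind in auto)
  then have "eventually (\<lambda>j. (\<integral>x. norm (V x - g j x) \<partial>lborel) < e/2) sequentially"
    using e by (intro order_tendstoD) auto
  then obtain j where j: "(\<integral>x. norm (V x - g j x) \<partial>lborel) < e/2"
    by (auto simp: eventually_sequentially)
  have "(\<integral>x. norm (W x - g j x) \<partial>lborel) \<le> (\<integral>x. norm (W x - V x) + norm (V x - g j x) \<partial>lborel)"
    using W Vi gi norm_triangle_ineq[of "W x - V x" "V x - g j x" for x] by (intro integral_mono) auto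
  also have "\<dots> = (\<integral>x. norm (W x - V x) \<partial>lborel) + (\<integral>x. norm (V x - g j x) \<partial>lborel)"
    using W Vi gi by (intro Bochner_Integration.integral_add) auto
  also have "\<dots> < e" using n j unfolding V_def m_def by simp
  finally have "(\<integral>x. norm (W x - g j x) \<partial>lborel) < e" .
  moreover have "continuous_on UNIV (g j)" unfolding g_def
    by (intro continuous_on_scaleR \<theta>cont continuous_on_compose2[OF Tcont[OF m] Gc]) auto
  moreover have "\<forall>x. m + 1 \<le> norm x \<longrightarrow> g j x = 0" by (auto simp: g_def \<theta>_def)
  ultimately show ?thesis using gi by blast
qed

section \<open>Mollification\<close>

text \<open>A C^1 kernel is enough because test functions are C^1. The quadratic remainder in
  \<open>taylor\<close> is uniform in the base point, so differentiation under the integral becomes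
  a direct estimate.\<close>

locale mollifier =
  fixes \<eta> :: "'a::euclidean_space \<Rightarrow> real" and D :: "'a \<Rightarrow> 'a" and \<epsilon> C :: real
  assumes eps_pos: "0 < \<epsilon>"
    and nonneg: "\<And>z. 0 \<le> \<eta> z"
    and supp: "\<And>z. \<epsilon> \<le> norm z \<Longrightarrow> \<eta> z = 0"
    and supp_grad: "\<And>z. \<epsilon> \<le> norm z \<Longrightarrow> D z = 0"
    and cont: "continuous_on UNIV \<eta>"
    and cont_grad: "continuous_on UNIV D"
    and integral_one: "(\<integral>\<^sup>+z. ennreal (\<eta> z) \<partial>lborel) = 1"
    and taylor: "\<And>z h. norm h \<le> \<epsilon> \<Longrightarrow> \<bar>\<eta> (z + h) - \<eta> z - D z \<bullet> h\<bar> \<le> C * (norm h)\<^sup>2"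

text \<open>Squaring the truncated paraboloid makes it C^1 across the unit sphere, with a Lipschitz
  gradient.\<close>

definition bump :: "'a::euclidean_space \<Rightarrow> real" where
  "bump z = (max 0 (1 - z \<bullet> z))\<^sup>2"

definition bump_grad :: "'a::euclidean_space \<Rightarrow> 'a" where
  "bump_grad z = (- 4 * max 0 (1 - z \<bullet> z)) *\<^sub>R z"

text \<open>The derivative \<open>2 * max 0 t\<close> is Lipschitz with constant 2, so the Taylor
  remainder is at most half of 2 times the squared increment.\<close>

lemma max0_square_taylor:
  fixes s t :: real
  shows "\<bar>(max 0 s)\<^sup>2 - (max 0 t)\<^sup>2 - 2 * max 0 t * (s - t)\<bar> \<le> (s - t)\<^sup>2"
proof (cases "s \<ge> 0")
  case s: True
  show ?thesis
  proof (cases "t \<ge> 0")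
    case True
    with s have "(max 0 s)\<^sup>2 - (max 0 t)\<^sup>2 - 2 * max 0 t * (s - t) = (s - t)\<^sup>2"
      by (simp add: power2_eq_square algebra_simps)
    then show ?thesis by simp
  next
    case False
    then have "s\<^sup>2 \<le> (s - t)\<^sup>2" using s by (intro power_mono) auto
    with s False show ?thesis by simp
  qed
next
  case s: False
  show ?thesis
  proof (cases "t \<ge> 0")
    case True
    with s have "(max 0 s)\<^sup>2 - (max 0 t)\<^sup>2 - 2 * max 0 t * (s - t) = t\<^sup>2 - 2 * t * s"
      by (simp add: power2_eq_square algebra_simps)
    moreover have "t * s \<le> 0" using s True by (simp add: mult_nonneg_nonpos)
    then have "0 \<le> t\<^sup>2 - 2 * t * s" using zero_le_power2[of t] by linarith
    then have "\<bar>t\<^sup>2 - 2 * t * s\<bar> = t\<^sup>2 - 2 * t * s" by (rule abs_of_nonneg)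
    moreover have "(s - t)\<^sup>2 = s\<^sup>2 + (t\<^sup>2 - 2 * t * s)" by (simp add: power2_eq_square algebra_simps)
    ultimately show ?thesis by simp
  qed (use s in auto)
qed

text \<open>The bump is the squared positive part composed with a quadratic polynomial. If one of z
  and z + h lies in the unit ball, the increment of the polynomial is at most 3|h|, which
  contributes 9|h|^2 through \<open>max0_square_taylor\<close>; the quadratic part of the polynomial
  adds 2|h|^2, whence 11. If neither lies there, everything vanishes.\<close>

lemma bump_taylor:
  fixes z h :: "'a::euclidean_space"
  assumes h: "norm h \<le> 1"
  shows "\<bar>bump (z + h) - bump z - bump_grad z \<bullet> h\<bar> \<le> 11 * (norm h)\<^sup>2"
proof -
  define s where "s = 1 - (z + h) \<bullet> (z + h)"
  define t where "t = 1 - z \<bullet> z"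
  have st: "s - t = - (2 * (z \<bullet> h)) - (norm h)\<^sup>2"
    by (simp add: s_def t_def inner_add_left inner_add_right inner_commute power2_norm_eq_inner)
  have st': "s - t = - (2 * ((z + h) \<bullet> h)) + (norm h)\<^sup>2"
    by (simp add: st inner_add_left power2_norm_eq_inner)
  have hh: "(norm h)\<^sup>2 \<le> norm h" using h by (simp add: power2_eq_square mult_left_le_one_le)
  have E: "bump (z + h) - bump z - bump_grad z \<bullet> h =
     ((max 0 s)\<^sup>2 - (max 0 t)\<^sup>2 - 2 * max 0 t * (s - t)) - 2 * max 0 t * (norm h)\<^sup>2"
    by (simp add: bump_def bump_grad_def st flip: s_def t_def) (simp add: algebra_simps)
  have t1: "max 0 t \<le> 1" by (simp add: t_def)
  have sq: "(s - t)\<^sup>2 \<le> 9 * (norm h)\<^sup>2" if "\<bar>s - t\<bar> \<le> 3 * norm h"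
    using power_mono[OF that, of 2] by (simp add: power_mult_distrib)
  consider "norm z \<le> 1" | "norm z > 1" "norm (z + h) \<le> 1" | "norm z > 1" "norm (z + h) > 1" by linarith
  then show ?thesis
  proof cases
    case 1
    have "\<bar>z \<bullet> h\<bar> \<le> norm z * norm h" by (rule Cauchy_Schwarz_ineq2)
    also have "\<dots> \<le> norm h" using 1 by (simp add: mult_left_le_one_le)
    finally have "\<bar>s - t\<bar> \<le> 3 * norm h" using hh st by (smt (verit) zero_le_power2)
    note a = sq[OF this]
    have "\<bar>2 * max 0 t * (norm h)\<^sup>2\<bar> \<le> 2 * (norm h)\<^sup>2" using t1 by (simp add: mult_right_mono abs_mult)
    then show ?thesis using a max0_square_taylor[of s t] unfolding E by linarith
  next
    case 2
    have "\<bar>(z + h) \<bullet> h\<bar> \<le> norm (z + h) * norm h" by (rule Cauchy_Schwarz_ineq2)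
    also have "\<dots> \<le> norm h" using 2 by (simp add: mult_left_le_one_le)
    finally have "\<bar>s - t\<bar> \<le> 3 * norm h" using hh st' by (smt (verit) zero_le_power2)
    note a = sq[OF this]
    have "\<bar>2 * max 0 t * (norm h)\<^sup>2\<bar> \<le> 2 * (norm h)\<^sup>2" using t1 by (simp add: mult_right_mono abs_mult)
    then show ?thesis using a max0_square_taylor[of s t] unfolding E by linarith
  next
    case 3
    have "1 \<le> z \<bullet> z" "1 \<le> (z + h) \<bullet> (z + h)"
      using 3 by (auto simp flip: power2_norm_eq_inner)
    then have "max 0 t = 0" "max 0 s = 0" by (auto simp: s_def t_def)
    then show ?thesis unfolding E by simp
  qed
qed

lemma bump_zero: "1 \<le> norm z \<Longrightarrow> bump z = 0" "1 \<le> norm z \<Longrightarrow> bump_grad z = 0"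
  using one_le_power[of "norm z" 2] by (auto simp: bump_def bump_grad_def power2_norm_eq_inner)

lemma bump_continuous: "continuous_on UNIV bump" "continuous_on UNIV bump_grad"
  unfolding bump_def bump_grad_def by (auto intro!: continuous_intros)

lemma mollifier_exists:
  fixes \<epsilon> :: real
  assumes e: "0 < \<epsilon>"
  shows "\<exists>(\<eta> :: 'a::euclidean_space \<Rightarrow> real) D C. mollifier \<eta> D \<epsilon> C"
proof -
  define b where "b z = bump (z /\<^sub>R \<epsilon>)" for z :: 'a
  have bcont: "continuous_on UNIV b"
    unfolding b_def by (rule continuous_on_compose2[OF bump_continuous(1)]) (auto intro!: continuous_intros)
  have dcont: "continuous_on UNIV (\<lambda>z::'a. bump_grad (z /\<^sub>R \<epsilon>))"
    by (rule continuous_on_compose2[OF bump_continuous(2)]) (auto intro!: continuous_intros)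
  have [measurable]: "b \<in> borel_measurable borel" by (rule borel_measurable_continuous_onI[OF bcont])
  have b0: "b z = 0" if "\<epsilon> \<le> norm z" for z
    using that e unfolding b_def by (intro bump_zero) (simp add: field_simps)
  have bn: "0 \<le> b z" for z by (simp add: b_def bump_def)
  have bump1: "bump y \<le> 1" for y :: 'a unfolding bump_def by (intro power_le_one) auto
  have b1: "b z \<le> 1" for z unfolding b_def by (rule bump1)
  have bi: "integrable lborel b"
  proof (rule Bochner_Integration.integrable_bound)
    show "integrable lborel (indicator (cball (0::'a) \<epsilon>) :: _ \<Rightarrow> real)"
      using emeasure_bounded_finite[of "cball (0::'a) \<epsilon>"] by (simp add: less_top)
    show "AE z in lborel. norm (b z) \<le> norm (indicator (cball 0 \<epsilon>) z :: real)"
      using b0 bn b1 by (intro AE_I2) (auto simp: indicator_def)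
  qed auto
  define I where "I = (\<integral>z. b z \<partial>lborel)"
  \<comment> \<open>\<open>b\<close> is positive on the ball of radius
    \<open>\<epsilon> / 2\<close>, so a vanishing integral would make that ball a null set.\<close>
  have I: "I > 0"
  proof (rule ccontr)
    assume "\<not> I > 0"
    then have "I = 0" using bn by (simp add: I_def order_antisym[OF _ integral_nonneg_AE])
    then have "AE z in lborel. b z = 0" using integral_nonneg_eq_0_iff_AE[OF bi] bn by (auto simp: I_def)
    then have "AE z in lborel. z \<notin> ball (0::'a) (\<epsilon>/2)"
    proof eventually_elim
      case (elim z)
      have "b z > 0" if "norm z < \<epsilon>/2"
      proof -
        have "norm (z /\<^sub>R \<epsilon>) < 1" using that e by (simp add: field_simps)
        then have "(norm (z /\<^sub>R \<epsilon>))\<^sup>2 < 1" by (simp only: power_less_one_iff norm_ge_zero) simp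
        then show ?thesis unfolding b_def bump_def power2_norm_eq_inner by (intro zero_less_power) linarith
      qed
      with elim show ?case by force
    qed
    then have "emeasure lborel (ball (0::'a) (\<epsilon>/2)) = 0"
      by (subst (asm) AE_iff_measurable[of "ball 0 (\<epsilon>/2)"]) (auto simp: ball_def)
    then show False using e emeasure_lborel_ball_finite 
      by (metis content_ball_pos half_gt_zero measure_def enn2real_0 less_irrefl)
  qed
  \<comment> \<open>Rescaling the argument by \<open>1 / \<epsilon>\<close> multiplies the gradient
    by this factor and the quadratic remainder by its square; dividing by \<open>I\<close>
    normalises the integral.\<close>
  have "mollifier (\<lambda>z. b z / I) (\<lambda>z. (1 / (\<epsilon> * I)) *\<^sub>R bump_grad (z /\<^sub>R \<epsilon>)) \<epsilon> (11 / (\<epsilon>\<^sup>2 * I))"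
  proof
    show "0 < \<epsilon>" "\<And>z. 0 \<le> b z / I" "\<And>z. \<epsilon> \<le> norm z \<Longrightarrow> b z / I = 0"
      using e I bn b0 by auto
    show "(1 / (\<epsilon> * I)) *\<^sub>R bump_grad (z /\<^sub>R \<epsilon>) = 0" if "\<epsilon> \<le> norm z" for z :: 'a
      using bump_zero(2)[of "z /\<^sub>R \<epsilon>"] that e by (simp add: field_simps)
    show "continuous_on UNIV (\<lambda>z. b z / I)" using I by (auto intro!: continuous_intros bcont)
    show "continuous_on UNIV (\<lambda>z::'a. (1 / (\<epsilon> * I)) *\<^sub>R bump_grad (z /\<^sub>R \<epsilon>))"
      by (intro continuous_intros dcont)
    have "(\<integral>\<^sup>+z. ennreal (b z / I) \<partial>lborel) = ennreal (\<integral>z. b z / I \<partial>lborel)"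
      using bi bn I by (intro nn_integral_eq_integral) auto
    also have "(\<integral>z. b z / I \<partial>lborel) = 1" using I by (simp add: I_def)
    finally show "(\<integral>\<^sup>+z. ennreal (b z / I) \<partial>lborel) = 1" by simp
    fix z h :: 'a
    assume "norm h \<le> \<epsilon>"
    then have "norm (h /\<^sub>R \<epsilon>) \<le> 1" using e by (simp add: field_simps)
    from bump_taylor[OF this, of "z /\<^sub>R \<epsilon>"]
    have 1: "\<bar>b (z + h) - b z - (bump_grad (z /\<^sub>R \<epsilon>) \<bullet> h) / \<epsilon>\<bar> \<le> 11 * (norm h)\<^sup>2 / \<epsilon>\<^sup>2"
      using e by (simp add: b_def scaleR_add_right power_divide power_mult_distrib field_simps)
    have "b (z + h) / I - b z / I - ((1 / (\<epsilon> * I)) *\<^sub>R bump_grad (z /\<^sub>R \<epsilon>)) \<bullet> h =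
       (b (z + h) - b z - (bump_grad (z /\<^sub>R \<epsilon>) \<bullet> h) / \<epsilon>) / I"
      using I e by (simp add: diff_divide_distrib)
    then have "\<bar>b (z + h) / I - b z / I - ((1 / (\<epsilon> * I)) *\<^sub>R bump_grad (z /\<^sub>R \<epsilon>)) \<bullet> h\<bar> =
      \<bar>b (z + h) - b z - (bump_grad (z /\<^sub>R \<epsilon>) \<bullet> h) / \<epsilon>\<bar> / I" using I by simp
    also have "\<dots> \<le> (11 * (norm h)\<^sup>2 / \<epsilon>\<^sup>2) / I" using 1 I by (intro divide_right_mono) auto
    finally show "\<bar>b (z + h) / I - b z / I - ((1 / (\<epsilon> * I)) *\<^sub>R bump_grad (z /\<^sub>R \<epsilon>)) \<bullet> h\<bar> \<le> 11 / (\<epsilon>\<^sup>2 * I) * (norm h)\<^sup>2"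
      by simp
  qed
  then show ?thesis by blast
qed

text \<open>Convexity of the power, by the mean value theorem; t = 0 is treated apart because the
  derivative formula is used at positive arguments only. Integrated against a mollifier it becomes
  Jensen's inequality.\<close>

lemma powr_tangent_le:
  fixes s t :: real
  assumes p: "1 \<le> p" and s: "0 < s" and t: "0 \<le> t"
  shows "s powr p + p * s powr (p - 1) * (t - s) \<le> t powr p"
proof -
  have d: "((\<lambda>x. x powr p) has_real_derivative p * x powr (p - 1)) (at x)" if "0 < x" for x :: real
    using that has_real_derivative_powr[of x p] by simp
  show ?thesis
  proof (cases "t = 0")
    case True
    have "s powr p = s powr (p - 1) * s" using s by (simp add: powr_diff)
    then have "s powr p + p * s powr (p - 1) * (t - s) = (1 - p) * s powr p" using True by (simp add: algebra_simps)
    also have "\<dots> \<le> 0" using p by (simp add: mult_nonpos_nonneg)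
    finally show ?thesis using powr_ge_zero[of t p] by linarith
  next
    case False
    then have t: "0 < t" using t by simp
    show ?thesis
    proof (cases "s < t")
      case True
      obtain \<xi> where x: "s < \<xi>" "\<xi> < t" "t powr p - s powr p = (t - s) * (p * \<xi> powr (p - 1))"
        using MVT2[OF True, of "\<lambda>x. x powr p" "\<lambda>x. p * x powr (p - 1)"] d s by auto
      have "s powr (p - 1) \<le> \<xi> powr (p - 1)" using x s p by (intro powr_mono2) auto
      then have "(t - s) * (p * s powr (p - 1)) \<le> (t - s) * (p * \<xi> powr (p - 1))"
        using True p by (intro mult_left_mono) auto
      then show ?thesis using x by (simp add: algebra_simps)
    next
      case f: False
      show ?thesis
      proof (cases "s = t")
        case False
        then have st: "t < s" using f by simp
        obtain \<xi> where x: "t < \<xi>" "\<xi> < s" "s powr p - t powr p = (s - t) * (p * \<xi> powr (p - 1))"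
          using MVT2[OF st, of "\<lambda>x. x powr p" "\<lambda>x. p * x powr (p - 1)"] d t by auto
        have "\<xi> powr (p - 1) \<le> s powr (p - 1)" using x t p by (intro powr_mono2) auto
        then have "(s - t) * (p * \<xi> powr (p - 1)) \<le> (s - t) * (p * s powr (p - 1))"
          using st p by (intro mult_left_mono) auto
        then show ?thesis using x by (simp add: algebra_simps)
      qed simp
    qed
  qed
qed

section \<open>Convolution with a mollifier\<close>

definition convol :: "('a::euclidean_space \<Rightarrow> real) \<Rightarrow> ('a \<Rightarrow> 'b::euclidean_space) \<Rightarrow> 'a \<Rightarrow> 'b" where
  "convol \<eta> W x = (\<integral>y. \<eta> (x - y) *\<^sub>R W y \<partial>lborel)"

context mollifier
begin

lemma borel_measurable_mollifier [measurable]: "\<eta> \<in> borel_measurable borel" "D \<in> borel_measurable borel"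
  using cont cont_grad by (auto intro: borel_measurable_continuous_onI)

lemma mollifier_bounded: "\<exists>B>0. \<forall>z. \<eta> z \<le> B \<and> norm (D z) \<le> B"
proof -
  have "compact (\<eta> ` cball 0 \<epsilon>)" "compact (D ` cball 0 \<epsilon>)"
    by (auto intro!: compact_continuous_image continuous_on_subset[OF cont] continuous_on_subset[OF cont_grad])
  then have "bounded (\<eta> ` cball 0 \<epsilon>)" "bounded (D ` cball 0 \<epsilon>)" by (auto intro: compact_imp_bounded)
  then obtain B1 B2 where B: "\<And>z. z \<in> cball 0 \<epsilon> \<Longrightarrow> norm (\<eta> z) \<le> B1" "\<And>z. z \<in> cball 0 \<epsilon> \<Longrightarrow> norm (D z) \<le> B2"
    "B1 > 0" "B2 > 0"
    unfolding bounded_pos by blast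
  have "\<eta> z \<le> max B1 B2 \<and> norm (D z) \<le> max B1 B2" for z
    using B(1)[of z] B(2)[of z] supp[of z] supp_grad[of z] B(3,4) by (cases "norm z \<le> \<epsilon>") auto
  then show ?thesis using B(3) by (intro exI[of _ "max B1 B2"]) auto
qed

lemma integrable_convol_kernel:
  fixes W :: "'a \<Rightarrow> 'b::euclidean_space"
  assumes "integrable lborel W"
  shows "integrable lborel (\<lambda>y. \<eta> (x - y) *\<^sub>R W y)"
proof -
  obtain B where B: "\<And>z. \<eta> z \<le> B" "B > 0" using mollifier_bounded by blast
  have [measurable]: "W \<in> borel_measurable borel" using assms by auto
  show ?thesis
    by (rule Bochner_Integration.integrable_bound[OF integrable_mult_right[OF integrable_norm[OF assms], of B]])
       (use B nonneg in \<open>auto intro!: mult_right_mono\<close>)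
qed

lemma integrable_convol_grad_kernel:
  fixes W :: "'a \<Rightarrow> real"
  assumes "integrable lborel W"
  shows "integrable lborel (\<lambda>y. W y *\<^sub>R D (x - y))"
proof -
  obtain B where B: "\<And>z. norm (D z) \<le> B" "B > 0" using mollifier_bounded by blast
  have [measurable]: "W \<in> borel_measurable borel" using assms by auto
  have bd: "\<bar>W y\<bar> * norm (D z) \<le> B * \<bar>W y\<bar>" for y z
    using mult_right_mono[OF B(1)[of z], of "\<bar>W y\<bar>"] by (simp add: mult.commute)
  show ?thesis
    by (rule Bochner_Integration.integrable_bound[OF integrable_mult_right[OF integrable_norm[OF assms], of B]])
       (use B bd in auto)
qed

lemma nn_integral_kernel:
  "(\<integral>\<^sup>+y. ennreal (\<eta> (x - y)) \<partial>lborel) = 1" "(\<integral>\<^sup>+x. ennreal (\<eta> (x - y)) \<partial>lborel) = 1"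
proof -
  show "(\<integral>\<^sup>+y. ennreal (\<eta> (x - y)) \<partial>lborel) = 1"
    using nn_integral_lborel_diff[of "\<lambda>z. ennreal (\<eta> z)" x] integral_one by simp
  show "(\<integral>\<^sup>+x. ennreal (\<eta> (x - y)) \<partial>lborel) = 1"
    using nn_integral_lborel_plus[of "\<lambda>z. ennreal (\<eta> z)" "-y"] integral_one by (simp add: add.commute[of "-y"])
qed

lemma integrable_kernel: "integrable lborel (\<lambda>y. \<eta> (x - y))"
  using nn_integral_kernel(1)[of x] nonneg by (intro integrableI_nonneg) auto

lemma integral_kernel: "(\<integral>y. \<eta> (x - y) \<partial>lborel) = 1"
  by (subst integral_eq_nn_integral) (use nn_integral_kernel(1)[of x] nonneg in auto)

text \<open>Integrating the uniform Taylor remainder of the kernel against |W| bounds the error by C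
  |h|^2 times the L^1 norm of \<open>W\<close>. The summand 1 in the choice of \<open>d\<close>
  covers the case that this product is 0.\<close>

lemma convol_has_derivative:
  fixes W :: "'a \<Rightarrow> real"
  assumes W: "integrable lborel W"
  shows "(convol \<eta> W has_derivative (\<lambda>h. (\<integral>y. W y *\<^sub>R D (x - y) \<partial>lborel) \<bullet> h)) (at x)"
  unfolding has_derivative_at_alt
proof (intro conjI allI impI)
  show "bounded_linear ((\<bullet>) (\<integral>y. W y *\<^sub>R D (x - y) \<partial>lborel))" by (rule bounded_linear_inner_right)
  fix e :: real assume e: "0 < e"
  \<comment> \<open>The locale does not state the sign of \<open>C\<close>; \<open>taylor\<close>
    with a nonzero increment gives it.\<close>
  have C: "0 \<le> C" 
  proof -
    obtain b :: 'a where b: "b \<in> Basis" using nonempty_Basis by blast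
    have "0 \<le> C * (norm (\<epsilon> *\<^sub>R b))\<^sup>2"
      using taylor[of "\<epsilon> *\<^sub>R b" 0] b eps_pos by (force intro: order_trans[OF abs_ge_zero])
    then show ?thesis using eps_pos b by (simp add: zero_le_mult_iff)
  qed
  define I where "I = (\<integral>y. \<bar>W y\<bar> \<partial>lborel)"
  have I: "0 \<le> I" unfolding I_def by simp
  define d where "d = min \<epsilon> (e / (C * I + 1))"
  have CI: "0 \<le> C * I" using C I by simp
  have d: "d > 0" using eps_pos e CI unfolding d_def by (auto intro!: divide_pos_pos)
  show "\<exists>d>0. \<forall>y. norm (y - x) < d \<longrightarrow> norm (convol \<eta> W y - convol \<eta> W x - (\<integral>y. W y *\<^sub>R D (x - y) \<partial>lborel) \<bullet> (y - x)) \<le> e * norm (y - x)"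
  proof (intro exI[of _ d] conjI d allI impI)
    fix x' assume x': "norm (x' - x) < d"
    define h where "h = x' - x"
    have h: "norm h \<le> \<epsilon>" "norm h * (C * I + 1) \<le> e" using x' CI unfolding h_def d_def
      by (auto simp: pos_less_divide_eq)
    note k = integrable_convol_kernel[OF W] 
    have inn: "(\<integral>y. W y *\<^sub>R D (x - y) \<partial>lborel) \<bullet> h = (\<integral>y. (W y *\<^sub>R D (x - y)) \<bullet> h \<partial>lborel)"
      by (rule integral_inner_left[symmetric]) (rule integrable_convol_grad_kernel[OF W])
    have inni: "integrable lborel (\<lambda>y. (W y *\<^sub>R D (x - y)) \<bullet> h)"
      using integrable_convol_grad_kernel[OF W] by (rule integrable_inner_left)
    have "convol \<eta> W x' - convol \<eta> W x - (\<integral>y. W y *\<^sub>R D (x - y) \<partial>lborel) \<bullet> h =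
      (\<integral>y. \<eta> (x' - y) *\<^sub>R W y - \<eta> (x - y) *\<^sub>R W y - (W y *\<^sub>R D (x - y)) \<bullet> h \<partial>lborel)"
      unfolding convol_def inn using k inni by simp
    also have "\<dots> = (\<integral>y. W y * (\<eta> ((x - y) + h) - \<eta> (x - y) - D (x - y) \<bullet> h) \<partial>lborel)"
    proof -
      have "\<eta> (x' - y) = \<eta> ((x - y) + h)" for y by (simp add: h_def)
      then show ?thesis by (simp add: right_diff_distrib mult.commute)
    qed
    finally have E: "convol \<eta> W x' - convol \<eta> W x - (\<integral>y. W y *\<^sub>R D (x - y) \<partial>lborel) \<bullet> h =
       (\<integral>y. W y * (\<eta> ((x - y) + h) - \<eta> (x - y) - D (x - y) \<bullet> h) \<partial>lborel)" .
    have "norm (\<integral>y. W y * (\<eta> ((x - y) + h) - \<eta> (x - y) - D (x - y) \<bullet> h) \<partial>lborel) \<le>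
      (\<integral>y. \<bar>W y\<bar> * (C * (norm h)\<^sup>2) \<partial>lborel)"
    proof (rule order_trans[OF integral_norm_bound], rule integral_mono_AE')
      show "integrable lborel (\<lambda>y. \<bar>W y\<bar> * (C * (norm h)\<^sup>2))" using W by simp
      show "AE y in lborel. norm (W y * (\<eta> ((x - y) + h) - \<eta> (x - y) - D (x - y) \<bullet> h)) \<le> \<bar>W y\<bar> * (C * (norm h)\<^sup>2)"
        using taylor[OF h(1)] by (intro AE_I2) (simp add: abs_mult mult_left_mono)
    qed (use C in auto)
    also have "\<dots> = (C * I * norm h) * norm h" by (simp add: I_def power2_eq_square)
    also have "\<dots> \<le> e * norm h"
    proof (rule mult_right_mono)
      have "norm h * (C * I + 1) = C * I * norm h + norm h" by (simp add: algebra_simps)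
      then show "C * I * norm h \<le> e" using h(2) norm_ge_zero[of h] by linarith
    qed simp
    finally show "norm (convol \<eta> W x' - convol \<eta> W x - (\<integral>y. W y *\<^sub>R D (x - y) \<partial>lborel) \<bullet> (x' - x)) \<le> e * norm (x' - x)"
      using E by (simp add: h_def)
  qed
qed

lemma continuous_on_convol_grad:
  fixes W :: "'a \<Rightarrow> real"
  assumes W: "integrable lborel W"
  shows "continuous_on UNIV (\<lambda>x. \<integral>y. W y *\<^sub>R D (x - y) \<partial>lborel)"
proof (rule continuous_on_sequentiallyI)
  fix s and a :: 'a assume s: "s \<longlonglongrightarrow> a"
  have [measurable]: "W \<in> borel_measurable borel" using W by auto
  obtain B where B: "\<And>z. norm (D z) \<le> B" "B > 0" using mollifier_bounded by blast
  have bd: "\<bar>W y\<bar> * norm (D z) \<le> B * \<bar>W y\<bar>" for y z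
    using mult_right_mono[OF B(1)[of z], of "\<bar>W y\<bar>"] by (simp add: mult.commute)
  show "(\<lambda>n. \<integral>y. W y *\<^sub>R D (s n - y) \<partial>lborel) \<longlonglongrightarrow> (\<integral>y. W y *\<^sub>R D (a - y) \<partial>lborel)"
  proof (rule integral_dominated_convergence[where w="\<lambda>y. B * norm (W y)"])
    show "AE y in lborel. (\<lambda>n. W y *\<^sub>R D (s n - y)) \<longlonglongrightarrow> W y *\<^sub>R D (a - y)"
    proof (rule AE_I2)
      fix y
      have "isCont D (a - y)" using cont_grad continuous_on_eq_continuous_at open_UNIV by blast
      then show "(\<lambda>n. W y *\<^sub>R D (s n - y)) \<longlonglongrightarrow> W y *\<^sub>R D (a - y)"
        by (intro tendsto_intros isCont_tendsto_compose[of _ D] s)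
    qed
  qed (use W bd in auto)
qed

lemma borel_measurable_convol [measurable]:
  fixes W :: "'a \<Rightarrow> 'b::euclidean_space"
  assumes [measurable]: "W \<in> borel_measurable borel"
  shows "convol \<eta> W \<in> borel_measurable borel"
  unfolding convol_def by measurable

text \<open>Tonelli: for fixed y the kernel has integral 1 in x.\<close>

lemma nn_integral_convol_le:
  fixes W :: "'a \<Rightarrow> 'b::euclidean_space"
  assumes W: "integrable lborel W"
  shows "(\<integral>\<^sup>+x. norm (convol \<eta> W x) \<partial>lborel) \<le> (\<integral>\<^sup>+x. norm (W x) \<partial>lborel)"
proof -
  have [measurable]: "W \<in> borel_measurable borel" using W by auto
  have "(\<integral>\<^sup>+x. norm (convol \<eta> W x) \<partial>lborel) \<le> (\<integral>\<^sup>+x. \<integral>\<^sup>+y. norm (\<eta> (x - y) *\<^sub>R W y) \<partial>lborel \<partial>lborel)"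
    unfolding convol_def using integrable_convol_kernel[OF W]
    by (intro nn_integral_mono integral_norm_bound_ennreal)
  also have "\<dots> = (\<integral>\<^sup>+y. \<integral>\<^sup>+x. norm (\<eta> (x - y) *\<^sub>R W y) \<partial>lborel \<partial>lborel)"
    by (rule lborel_pair.Fubini') simp
  also have "\<dots> = (\<integral>\<^sup>+y. (\<integral>\<^sup>+x. ennreal (\<eta> (x - y)) * norm (W y) \<partial>lborel) \<partial>lborel)"
    using nonneg by (simp add: ennreal_mult)
  also have "\<dots> = (\<integral>\<^sup>+y. norm (W y) \<partial>lborel)"
    by (simp add: nn_integral_multc nn_integral_kernel)
  finally show ?thesis .
qed

lemma integrable_convol:
  fixes W :: "'a \<Rightarrow> 'b::euclidean_space"
  assumes W: "integrable lborel W"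
  shows "integrable lborel (convol \<eta> W)"
    and "(\<integral>x. norm (convol \<eta> W x) \<partial>lborel) \<le> (\<integral>x. norm (W x) \<partial>lborel)"
proof -
  have [measurable]: "W \<in> borel_measurable borel" using W by auto
  have fin: "(\<integral>\<^sup>+x. norm (W x) \<partial>lborel) < \<infinity>" using W by (simp add: integrable_iff_bounded)
  show i: "integrable lborel (convol \<eta> W)"
    unfolding integrable_iff_bounded using nn_integral_convol_le[OF W] fin by auto
  have "ennreal (\<integral>x. norm (convol \<eta> W x) \<partial>lborel) \<le> ennreal (\<integral>x. norm (W x) \<partial>lborel)"
    using nn_integral_convol_le[OF W] W i by (simp add: nn_integral_eq_integral)
  then show "(\<integral>x. norm (convol \<eta> W x) \<partial>lborel) \<le> (\<integral>x. norm (W x) \<partial>lborel)"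
    by simp
qed

lemma convol_diff_const:
  fixes W :: "'a \<Rightarrow> 'b::euclidean_space"
  assumes W: "integrable lborel W"
  shows "convol \<eta> W x - c = (\<integral>y. \<eta> (x - y) *\<^sub>R (W y - c) \<partial>lborel)"
  using integrable_convol_kernel[OF W, of x] integrable_kernel[of x] integral_kernel[of x]
  by (simp add: convol_def scaleR_diff_right)

text \<open>A weighted mean over \<open>ball x \<epsilon>\<close> cannot leave a ball that contains
  almost all the values. With suitable \<open>c\<close> and \<open>e\<close> this gives uniform
  convergence for continuous functions, the vanishing of mollifications away from a support, the
  value 1 of cutoffs, and bounds for mollified gradients.\<close>

lemma convol_norm_diff_le:
  fixes W :: "'a \<Rightarrow> 'b::euclidean_space"
  assumes W: "integrable lborel W" and e: "AE y in lborel. y \<in> ball x \<epsilon> \<longrightarrow> norm (W y - c) \<le> e"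
  shows "norm (convol \<eta> W x - c) \<le> e"
proof -
  have "norm (convol \<eta> W x - c) \<le> (\<integral>y. norm (\<eta> (x - y) *\<^sub>R (W y - c)) \<partial>lborel)"
    unfolding convol_diff_const[OF W] by (rule integral_norm_bound)
  also have "\<dots> \<le> (\<integral>y. \<eta> (x - y) * e \<partial>lborel)"
  proof (rule integral_mono_AE)
    show "integrable lborel (\<lambda>y. norm (\<eta> (x - y) *\<^sub>R (W y - c)))"
      using integrable_convol_kernel[OF W, of x] integrable_kernel[of x] by (simp add: scaleR_diff_right)
    show "AE y in lborel. norm (\<eta> (x - y) *\<^sub>R (W y - c)) \<le> \<eta> (x - y) * e"
      using e
    proof eventually_elim
      case (elim y)
      then show ?case using supp[of "x - y"] nonneg[of "x - y"]
        by (cases "y \<in> ball x \<epsilon>") (auto simp: dist_norm intro!: mult_left_mono)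
    qed
  qed (use integrable_kernel in auto)
  also have "\<dots> = e" by (simp add: integral_kernel)
  finally show ?thesis .
qed

text \<open>One-sided version: mollification keeps w below its essential supremum, and below the
  boundary level wherever the averaging ball misses the compact set.\<close>

lemma convol_le:
  fixes W :: "'a \<Rightarrow> real"
  assumes W: "integrable lborel W" and e: "AE y in lborel. y \<in> ball x \<epsilon> \<longrightarrow> W y \<le> c"
  shows "convol \<eta> W x \<le> c"
proof -
  have "(\<integral>y. \<eta> (x - y) *\<^sub>R (W y - c) \<partial>lborel) \<le> (\<integral>y. 0 \<partial>(lborel::'a measure))"
  proof (rule integral_mono_AE)
    show "integrable lborel (\<lambda>y. \<eta> (x - y) *\<^sub>R (W y - c))"
      using integrable_convol_kernel[OF W, of x] integrable_kernel[of x] by (simp add: right_diff_distrib)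
    show "AE y in lborel. \<eta> (x - y) *\<^sub>R (W y - c) \<le> 0"
      using e
    proof eventually_elim
      case (elim y)
      then show ?case using supp[of "x - y"] nonneg[of "x - y"]
        by (cases "y \<in> ball x \<epsilon>") (auto simp: dist_norm mult_nonneg_nonpos)
    qed
  qed auto
  then show ?thesis using convol_diff_const[OF W, of x c] by simp
qed

text \<open>Jensen's inequality for the probability density \<open>\<eta> (x - y)\<close>, with the
  tangent taken at the mean \<open>s\<close> of |W|. If \<open>s\<close> vanishes, so does the
  convolution.\<close>

lemma convol_powr_le:
  fixes W :: "'a \<Rightarrow> 'b::euclidean_space"
  assumes W: "integrable lborel W" and Wp: "integrable lborel (\<lambda>y. norm (W y) powr p)" and p: "1 \<le> p"
  shows "norm (convol \<eta> W x) powr p \<le> convol \<eta> (\<lambda>y. norm (W y) powr p) x"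
proof -
  define s where "s = (\<integral>y. \<eta> (x - y) * norm (W y) \<partial>lborel)"
  have i: "integrable lborel (\<lambda>y. \<eta> (x - y) * norm (W y))"
    using integrable_convol_kernel[OF integrable_norm[OF W], of x] by simp
  have ip: "integrable lborel (\<lambda>y. \<eta> (x - y) * norm (W y) powr p)"
    using integrable_convol_kernel[OF Wp, of x] by simp
  have le: "norm (convol \<eta> W x) \<le> s"
    unfolding convol_def s_def using nonneg by (intro order_trans[OF integral_norm_bound]) simp
  have nn: "0 \<le> convol \<eta> (\<lambda>y. norm (W y) powr p) x"
    unfolding convol_def using nonneg by (intro integral_nonneg_AE) simp
  show ?thesis
  proof (cases "s > 0")
    case False
    then have "norm (convol \<eta> W x) = 0" using le by (smt (verit) norm_ge_zero)
    then show ?thesis using nn by simp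
  next
    case s: True
    \<comment> \<open>The linear term integrates to 0 because \<open>s\<close> is the mean of |W|
      and the kernel has integral 1.\<close>
    have "s powr p = (\<integral>y. \<eta> (x - y) * (s powr p) + p * s powr (p - 1) * (\<eta> (x - y) * norm (W y) - \<eta> (x - y) * s) \<partial>lborel)"
      using i integrable_kernel[of x] by (simp add: integral_kernel s_def[symmetric])
    also have "\<dots> \<le> (\<integral>y. \<eta> (x - y) * norm (W y) powr p \<partial>lborel)"
    proof (rule integral_mono)
      fix y
      have "\<eta> (x - y) * (s powr p + p * s powr (p - 1) * (norm (W y) - s)) \<le> \<eta> (x - y) * norm (W y) powr p"
        using powr_tangent_le[OF p s, of "norm (W y)"] nonneg by (intro mult_left_mono) auto
      then show "\<eta> (x - y) * (s powr p) + p * s powr (p - 1) * (\<eta> (x - y) * norm (W y) - \<eta> (x - y) * s) \<le>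
         \<eta> (x - y) * norm (W y) powr p" by (simp add: algebra_simps)
    qed (use i ip integrable_kernel[of x] in auto)
    finally have "s powr p \<le> convol \<eta> (\<lambda>y. norm (W y) powr p) x" by (simp add: convol_def)
    moreover have "norm (convol \<eta> W x) powr p \<le> s powr p" using le p by (intro powr_mono2) auto
    ultimately show ?thesis by simp
  qed
qed

end

text \<open>Mollification contracts L^1, so a continuous \<open>g\<close> near \<open>W\<close> may
  be mollified instead. There uniform continuity gives the small constant \<open>e'\<close> on the
  ball of radius R + 1, outside which both \<open>g\<close> and its mollification vanish once
  \<open>\<epsilon> n < 1\<close>; \<open>e'\<close> is divided by the volume of this ball.\<close>

lemma convol_tendsto_L1:
  fixes W :: "'a::euclidean_space \<Rightarrow> 'b::euclidean_space"
  assumes W: "integrable lborel W"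
    and moll: "\<And>n. mollifier (\<eta> n) (D n) (\<epsilon> n) (C n)" and eps: "\<epsilon> \<longlonglongrightarrow> 0"
  shows "(\<lambda>n. \<integral>x. norm (convol (\<eta> n) W x - W x) \<partial>lborel) \<longlonglongrightarrow> 0"
proof (rule LIMSEQ_I)
  fix e :: real assume e: "0 < e"
  obtain g R0 where g: "continuous_on UNIV g" and R0: "\<And>x. R0 \<le> norm x \<Longrightarrow> g x = 0" and gi: "integrable lborel g"
    and Wg: "(\<integral>x. norm (W x - g x) \<partial>lborel) < e/4"
    using integrable_dense_continuous_support[OF W, of "e/4"] e by auto
  define R where "R = max R0 0"
  have R: "\<And>x. R \<le> norm x \<Longrightarrow> g x = 0" "0 \<le> R" using R0 by (auto simp: R_def)
  define m where "m = measure lborel (cball (0::'a) (R+1))"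
  have m: "0 \<le> m" by (simp add: m_def)
  define e' where "e' = e / (4 * (m + 1))"
  have e': "0 < e'" using e m by (simp add: e'_def)
  have "uniformly_continuous_on (cball 0 (R+2)) g"
    by (intro compact_uniformly_continuous continuous_on_subset[OF g]) auto
  then obtain d where d: "d > 0" "\<And>x y. x \<in> cball 0 (R+2) \<Longrightarrow> y \<in> cball 0 (R+2) \<Longrightarrow> dist y x < d \<Longrightarrow> dist (g y) (g x) < e'"
    unfolding uniformly_continuous_on_def using e' by meson
  have "eventually (\<lambda>n. \<epsilon> n < min d 1) sequentially"
    using eps d by (intro order_tendstoD) auto
  then obtain N where N: "\<And>n. n \<ge> N \<Longrightarrow> \<epsilon> n < min d 1" by (auto simp: eventually_sequentially)
  show "\<exists>no. \<forall>n\<ge>no. norm ((\<integral>x. norm (convol (\<eta> n) W x - W x) \<partial>lborel) - 0) < e"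
  proof (intro exI[of _ N] allI impI)
    fix n assume "N \<le> n"
    then have en: "\<epsilon> n < d" "\<epsilon> n < 1" using N by auto
    interpret mollifier "\<eta> n" "D n" "\<epsilon> n" "C n" by (rule moll)
    have ci: "integrable lborel (convol (\<eta> n) W)" "integrable lborel (convol (\<eta> n) g)"
      using integrable_convol W gi by auto
    have gg: "norm (convol (\<eta> n) g x - g x) \<le> e' * indicator (cball 0 (R+1)) x" for x
    proof (cases "x \<in> cball 0 (R+1)")
      case True
      have "norm (convol (\<eta> n) g x - g x) \<le> e'"
      proof (rule convol_norm_diff_le[OF gi], rule AE_I2, rule impI)
        fix y assume y: "y \<in> ball x (\<epsilon> n)"
        then have "norm (y - x) < 1" "dist y x < d" using en by (auto simp: dist_norm norm_minus_commute)
        moreover have "y \<in> cball 0 (R+2)" "x \<in> cball 0 (R+2)"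
          using True \<open>norm (y - x) < 1\<close> norm_triangle_sub[of y x] by auto
        ultimately show "norm (g y - g x) \<le> e'" using d(2) by (auto simp: dist_norm intro!: less_imp_le)
      qed
      then show ?thesis using True by simp
    next
      case False
      have "norm (convol (\<eta> n) g x - 0) \<le> 0"
      proof (rule convol_norm_diff_le[OF gi], rule AE_I2, rule impI)
        fix y assume y: "y \<in> ball x (\<epsilon> n)"
        then have "norm (x - y) < 1" using en by (auto simp: dist_norm)
        then have "R \<le> norm y" using False norm_triangle_sub[of x y] by auto
        then show "norm (g y - 0) \<le> 0" using R by simp
      qed
      then show ?thesis using False R by simp
    qed
    have "(\<integral>x. norm (convol (\<eta> n) g x - g x) \<partial>lborel) \<le> (\<integral>x. e' * indicator (cball 0 (R+1)) x \<partial>(lborel::'a measure))"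
    proof (rule integral_mono)
      show "integrable lborel (\<lambda>x::'a. e' * indicator (cball 0 (R+1)) x)"
        using emeasure_bounded_finite[of "cball (0::'a) (R+1)"] by (intro integrable_mult_right) (simp add: less_top)
    qed (use ci gi gg in auto)
    also have "\<dots> = e' * m" by (simp add: m_def)
    also have "\<dots> \<le> e / 4" using m e by (simp add: e'_def field_simps)
    finally have 1: "(\<integral>x. norm (convol (\<eta> n) g x - g x) \<partial>lborel) \<le> e/4" .
    have "convol (\<eta> n) W x - convol (\<eta> n) g x = convol (\<eta> n) (\<lambda>x. W x - g x) x" for x
      using integrable_convol_kernel[OF W, of x] integrable_convol_kernel[OF gi, of x]
      by (simp add: convol_def scaleR_diff_right)
    then have 2: "(\<integral>x. norm (convol (\<eta> n) W x - convol (\<eta> n) g x) \<partial>lborel) < e/4"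
      using integrable_convol(2)[of "\<lambda>x. W x - g x"] W gi Wg by simp
    have "(\<integral>x. norm (convol (\<eta> n) W x - W x) \<partial>lborel) \<le>
       (\<integral>x. (norm (convol (\<eta> n) W x - convol (\<eta> n) g x) + norm (convol (\<eta> n) g x - g x)) + norm (W x - g x) \<partial>lborel)"
      using ci W gi
      by (intro integral_mono) (auto, smt (verit, ccfv_threshold) diff_add_cancel norm_minus_commute norm_triangle_ineq4 norm_triangle_sub add_diff_eq diff_diff_eq2)
    also have "\<dots> = (\<integral>x. norm (convol (\<eta> n) W x - convol (\<eta> n) g x) \<partial>lborel) +
        (\<integral>x. norm (convol (\<eta> n) g x - g x) \<partial>lborel) + (\<integral>x. norm (W x - g x) \<partial>lborel)"
      using ci W gi by simp
    also have "\<dots> < e" using 1 2 Wg e by linarith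
    finally show "norm ((\<integral>x. norm (convol (\<eta> n) W x - W x) \<partial>lborel) - 0) < e" by simp
  qed
qed

section \<open>A Faber--Krahn inequality\<close>

text \<open>The fundamental theorem of calculus along the segment from x to x + y, then Tonelli;
  translation invariance makes the integral over x independent of the position on the
  segment.\<close>

lemma translation_L1_le:
  fixes \<psi> :: "'a::euclidean_space \<Rightarrow> real"
  assumes der: "\<And>x. (\<psi> has_derivative (\<lambda>h. D x \<bullet> h)) (at x)" and D: "continuous_on UNIV D"
  shows "(\<integral>\<^sup>+x. ennreal \<bar>\<psi> (x + y) - \<psi> x\<bar> \<partial>lborel) \<le> ennreal (norm y) * (\<integral>\<^sup>+x. ennreal (norm (D x)) \<partial>lborel)"
proof -
  have [measurable]: "D \<in> borel_measurable borel" by (rule borel_measurable_continuous_onI[OF D])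
  have "ennreal \<bar>\<psi> (x + y) - \<psi> x\<bar> \<le> (\<integral>\<^sup>+t. ennreal (indicator {0..1::real} t * norm (D (x + t *\<^sub>R y)) * norm y) \<partial>lborel)" for x
  proof -
    define g where "g t = D (x + t *\<^sub>R y) \<bullet> y" for t :: real
    have gc: "continuous_on {0..1} g"
      unfolding g_def by (intro continuous_intros continuous_on_compose2[OF D]) auto
    have gd: "((\<lambda>t. \<psi> (x + t *\<^sub>R y)) has_vector_derivative g t) (at t within {0..1})" for t
    proof -
      have "((\<lambda>t. \<psi> (x + t *\<^sub>R y)) has_derivative (\<lambda>s. D (x + t *\<^sub>R y) \<bullet> (s *\<^sub>R y))) (at t within {0..1})"
        by (rule has_derivative_compose[OF _ der]) (auto intro!: derivative_eq_intros)
      then show ?thesis unfolding has_vector_derivative_def g_def by simp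
    qed
    have "has_bochner_integral lborel (\<lambda>t. indicator {0..1} t *\<^sub>R g t) (\<psi> (x + 1 *\<^sub>R y) - \<psi> (x + 0 *\<^sub>R y))"
      by (rule has_bochner_integral_FTC_Icc[OF _ gd gc]) auto
    then have i: "integrable lborel (\<lambda>t. indicator {0..1} t *\<^sub>R g t)" "(\<integral>t. indicator {0..1} t *\<^sub>R g t \<partial>lborel) = \<psi> (x + y) - \<psi> x"
      by (auto simp: has_bochner_integral_iff)
    have "ennreal \<bar>\<psi> (x + y) - \<psi> x\<bar> \<le> (\<integral>\<^sup>+t. ennreal (norm (indicator {0..1} t *\<^sub>R g t)) \<partial>lborel)"
      using integral_norm_bound_ennreal[OF i(1)] i(2) by simp
    also have "\<dots> \<le> (\<integral>\<^sup>+t. ennreal (indicator {0..1::real} t * norm (D (x + t *\<^sub>R y)) * norm y) \<partial>lborel)"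
      by (intro nn_integral_mono ennreal_leI) (auto simp: g_def indicator_def Cauchy_Schwarz_ineq2)
    finally show ?thesis .
  qed
  then have "(\<integral>\<^sup>+x. ennreal \<bar>\<psi> (x + y) - \<psi> x\<bar> \<partial>lborel) \<le>
      (\<integral>\<^sup>+x. \<integral>\<^sup>+t. ennreal (indicator {0..1::real} t * norm (D (x + t *\<^sub>R y)) * norm y) \<partial>lborel \<partial>lborel)"
    by (intro nn_integral_mono) auto
  also have "\<dots> = (\<integral>\<^sup>+t. \<integral>\<^sup>+x. ennreal (indicator {0..1::real} t * norm (D (x + t *\<^sub>R y)) * norm y) \<partial>lborel \<partial>lborel)"
    by (rule lborel_pair.Fubini') simp
  also have "\<dots> = (\<integral>\<^sup>+t. indicator {0..1::real} t * (norm y * (\<integral>\<^sup>+x. ennreal (norm (D (t *\<^sub>R y + x))) \<partial>lborel)) \<partial>lborel)"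
  proof (rule nn_integral_cong)
    fix t :: real
    have "ennreal (indicator {0..1::real} t * norm (D (x + t *\<^sub>R y)) * norm y) =
        (indicator {0..1} t * ennreal (norm y)) * ennreal (norm (D (t *\<^sub>R y + x)))" for x
      by (cases "t \<in> {0..1}") (simp_all add: ennreal_mult mult.commute add.commute)
    then show "(\<integral>\<^sup>+x. ennreal (indicator {0..1::real} t * norm (D (x + t *\<^sub>R y)) * norm y) \<partial>lborel) =
       indicator {0..1::real} t * (norm y * (\<integral>\<^sup>+x. ennreal (norm (D (t *\<^sub>R y + x))) \<partial>lborel))"
      by (simp add: nn_integral_cmult mult.assoc)
  qed
  also have "\<dots> = (\<integral>\<^sup>+t. indicator {0..1::real} t * (norm y * (\<integral>\<^sup>+x. ennreal (norm (D x)) \<partial>lborel)) \<partial>lborel)"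
    by (subst nn_integral_lborel_plus[where f="\<lambda>x. ennreal (norm (D x))"]) auto
  also have "\<dots> = ennreal (norm y) * (\<integral>\<^sup>+x. ennreal (norm (D x)) \<partial>lborel)"
    by (subst nn_integral_multc) auto
  finally show ?thesis .
qed

text \<open>Replacing \<open>\<psi>\<close> by its average over balls of radius \<open>\<rho>\<close> costs \<open>\<rho> * \<parallel>D\<parallel>\<close> in \<open>L\<^sup>1\<close>, and the average is
  bounded by \<open>\<parallel>\<psi>\<parallel> / |B(\<rho>)|\<close>.\<close>
lemma faber_krahn_nn_integral:
  fixes \<psi> :: "'a::euclidean_space \<Rightarrow> real"
  assumes der: "\<And>x. (\<psi> has_derivative (\<lambda>h. D x \<bullet> h)) (at x)" and D: "continuous_on UNIV D"
    and pos: "\<And>x. 0 \<le> \<psi> x" and A[measurable]: "A \<in> sets borel"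
  shows "emeasure lborel (ball (0::'a) \<rho>) * (\<integral>\<^sup>+x. ennreal (\<psi> x) * indicator A x \<partial>lborel) \<le>
     emeasure lborel A * (\<integral>\<^sup>+x. ennreal (\<psi> x) \<partial>lborel) +
     emeasure lborel (ball (0::'a) \<rho>) * (ennreal \<rho> * (\<integral>\<^sup>+x. ennreal (norm (D x)) \<partial>lborel))"
proof -
  have \<psi>c: "continuous_on UNIV \<psi>" 
    by (rule continuous_at_imp_continuous_on) (auto intro: has_derivative_continuous[OF der])
  have [measurable]: "\<psi> \<in> borel_measurable borel" by (rule borel_measurable_continuous_onI[OF \<psi>c])
  have [measurable]: "D \<in> borel_measurable borel" by (rule borel_measurable_continuous_onI[OF D])
  have [measurable]: "ball (0::'a) \<rho> \<in> sets borel" by simp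
  have [measurable]: "(\<lambda>y. \<integral>\<^sup>+x. ennreal (\<psi> (x + y)) * indicator A x \<partial>lborel) \<in> borel_measurable borel"
    by measurable
  let ?B = "ball (0::'a) \<rho>"
  let ?I = "\<integral>\<^sup>+x. ennreal (\<psi> x) * indicator A x \<partial>lborel"
  let ?N = "\<integral>\<^sup>+x. ennreal (norm (D x)) \<partial>lborel"
  have add_ind: "(\<integral>\<^sup>+y. h y * indicator ?B y + c * indicator ?B y \<partial>lborel) =
      (\<integral>\<^sup>+y. h y * indicator ?B y \<partial>lborel) + c * emeasure lborel ?B"
    if [measurable]: "h \<in> borel_measurable borel" for h c
    by (simp add: nn_integral_add nn_integral_cmult_indicator)
  have 1: "?I \<le> (\<integral>\<^sup>+x. ennreal (\<psi> (x + y)) * indicator A x \<partial>lborel) + ennreal \<rho> * ?N" if "y \<in> ?B" for y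
  proof -
    have "?I \<le> (\<integral>\<^sup>+x. ennreal (\<psi> (x + y)) * indicator A x + ennreal \<bar>\<psi> (x + y) - \<psi> x\<bar> \<partial>lborel)"
    proof (rule nn_integral_mono)
      fix x
      show "ennreal (\<psi> x) * indicator A x \<le> ennreal (\<psi> (x + y)) * indicator A x + ennreal \<bar>\<psi> (x + y) - \<psi> x\<bar>"
      proof (cases "x \<in> A")
        case True
        have "ennreal (\<psi> x) \<le> ennreal (\<psi> (x + y) + \<bar>\<psi> (x + y) - \<psi> x\<bar>)" by (intro ennreal_leI) linarith
        then show ?thesis using True pos by simp
      qed simp
    qed
    also have "\<dots> = (\<integral>\<^sup>+x. ennreal (\<psi> (x + y)) * indicator A x \<partial>lborel) + (\<integral>\<^sup>+x. ennreal \<bar>\<psi> (x + y) - \<psi> x\<bar> \<partial>lborel)"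
      by (rule nn_integral_add) auto
    also have "(\<integral>\<^sup>+x. ennreal \<bar>\<psi> (x + y) - \<psi> x\<bar> \<partial>lborel) \<le> ennreal (norm y) * ?N"
      by (rule translation_L1_le[OF der D])
    also have "\<dots> \<le> ennreal \<rho> * ?N" using that by (intro mult_right_mono ennreal_leI) auto
    finally show ?thesis by (simp add: add_left_mono)
  qed
  have "emeasure lborel ?B * ?I = (\<integral>\<^sup>+y. ?I * indicator ?B y \<partial>lborel)"
    by (subst nn_integral_cmult_indicator) (auto simp: mult.commute)
  also have "\<dots> \<le> (\<integral>\<^sup>+y. (\<integral>\<^sup>+x. ennreal (\<psi> (x + y)) * indicator A x \<partial>lborel) * indicator ?B y + (ennreal \<rho> * ?N) * indicator ?B y \<partial>lborel)"
    using 1 by (intro nn_integral_mono) (auto simp: indicator_def)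
  also have "\<dots> = (\<integral>\<^sup>+y. (\<integral>\<^sup>+x. ennreal (\<psi> (x + y)) * indicator A x \<partial>lborel) * indicator ?B y \<partial>lborel) + (ennreal \<rho> * ?N) * emeasure lborel ?B"
    by (rule add_ind) measurable
  also have "(\<integral>\<^sup>+y. (\<integral>\<^sup>+x. ennreal (\<psi> (x + y)) * indicator A x \<partial>lborel) * indicator ?B y \<partial>lborel) \<le>
      (\<integral>\<^sup>+y. (\<integral>\<^sup>+x. ennreal (\<psi> (x + y)) * indicator A x \<partial>lborel) \<partial>lborel)"
    by (intro nn_integral_mono) (auto simp: indicator_def)
  also have "\<dots> = (\<integral>\<^sup>+x. (\<integral>\<^sup>+y. ennreal (\<psi> (x + y)) * indicator A x \<partial>lborel) \<partial>lborel)"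
    by (rule lborel_pair.Fubini') simp
  also have "\<dots> = (\<integral>\<^sup>+x. (\<integral>\<^sup>+y. ennreal (\<psi> (x + y)) \<partial>lborel) * indicator A x \<partial>lborel)"
    by (simp add: nn_integral_multc)
  also have "\<dots> = (\<integral>\<^sup>+x. (\<integral>\<^sup>+y. ennreal (\<psi> y) \<partial>lborel) * indicator A x \<partial>lborel)"
    by (subst nn_integral_lborel_plus[where f="\<lambda>x. ennreal (\<psi> x)"]) auto
  also have "\<dots> = emeasure lborel A * (\<integral>\<^sup>+x. ennreal (\<psi> x) \<partial>lborel)"
    by (simp add: nn_integral_cmult_indicator mult.commute[of "emeasure lborel A"])
  finally show ?thesis by (simp add: mult_ac)
qed

lemma faber_krahn_C1:
  fixes \<psi> :: "'a::euclidean_space \<Rightarrow> real"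
  assumes der: "\<And>x. (\<psi> has_derivative (\<lambda>h. D x \<bullet> h)) (at x)" and D: "continuous_on UNIV D"
    and pos: "\<And>x. 0 \<le> \<psi> x" and A[measurable]: "A \<in> sets borel" and fin: "emeasure lborel A < \<infinity>"
    and i: "integrable lborel \<psi>" "integrable lborel (\<lambda>x. norm (D x))" and \<rho>: "0 \<le> \<rho>"
  shows "measure lborel (ball (0::'a) \<rho>) * (\<integral>x. \<psi> x * indicator A x \<partial>lborel) \<le>
     measure lborel A * (\<integral>x. \<psi> x \<partial>lborel) +
     measure lborel (ball (0::'a) \<rho>) * (\<rho> * (\<integral>x. norm (D x) \<partial>lborel))"
proof -
  have iA: "integrable lborel (\<lambda>x. \<psi> x * indicator A x)"
    using i(1) by (rule Bochner_Integration.integrable_bound) (use i(1) in \<open>auto simp: indicator_def\<close>)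
  have e1: "(\<integral>\<^sup>+x. ennreal (\<psi> x) * indicator A x \<partial>lborel) = ennreal (\<integral>x. \<psi> x * indicator A x \<partial>lborel)"
    by (subst nn_integral_eq_integral[OF iA, symmetric]) (use pos in \<open>auto simp: ennreal_mult ennreal_indicator\<close>)
  have e2: "(\<integral>\<^sup>+x. ennreal (\<psi> x) \<partial>lborel) = ennreal (\<integral>x. \<psi> x \<partial>lborel)"
    using i pos by (intro nn_integral_eq_integral) auto
  have e3: "(\<integral>\<^sup>+x. ennreal (norm (D x)) \<partial>lborel) = ennreal (\<integral>x. norm (D x) \<partial>lborel)"
    using i pos by (intro nn_integral_eq_integral) auto
  have e4: "emeasure lborel (ball (0::'a) \<rho>) = ennreal (measure lborel (ball (0::'a) \<rho>))"
    using emeasure_lborel_ball_finite[of "0::'a" \<rho>] by (intro emeasure_eq_ennreal_measure) auto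
  have e5: "emeasure lborel A = ennreal (measure lborel A)"
    using fin by (intro emeasure_eq_ennreal_measure) auto
  have n: "0 \<le> (\<integral>x. \<psi> x * indicator A x \<partial>lborel)" "0 \<le> (\<integral>x. \<psi> x \<partial>lborel)"
    using pos by (auto intro!: integral_nonneg_AE)
  show ?thesis
  proof -
    let ?m = "measure lborel (ball (0::'a) \<rho>)" and ?a = "measure lborel A"
    let ?d = "\<integral>x. norm (D x) \<partial>lborel"
    have d: "0 \<le> ?d" by simp
    have "ennreal (?m * (\<integral>x. \<psi> x * indicator A x \<partial>lborel)) \<le> ennreal (?a * (\<integral>x. \<psi> x \<partial>lborel) + ?m * (\<rho> * ?d))"
      using faber_krahn_nn_integral[OF der D pos A, of \<rho>] n \<rho> d unfolding e1 e2 e3 e4 e5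
      by (simp only: ennreal_mult ennreal_plus mult_nonneg_nonneg measure_nonneg)
    moreover have "0 \<le> ?a * (\<integral>x. \<psi> x \<partial>lborel) + ?m * (\<rho> * ?d)" using n \<rho> d by simp
    ultimately show ?thesis by (simp only: ennreal_le_iff)
  qed
qed

section \<open>Weak gradients\<close>

lemma partial_deriv_eq:
  assumes "(\<phi> has_derivative (\<lambda>h. d \<bullet> h)) (at x)"
  shows "partial_deriv \<phi> i x = d $ i" "grad \<phi> x = d"
proof -
  have "frechet_derivative \<phi> (at x) = (\<lambda>h. d \<bullet> h)" using frechet_derivative_at[OF assms] by simp
  then show 1: "partial_deriv \<phi> i x = d $ i" for i by (simp add: partial_deriv_def inner_axis)
  then show "grad \<phi> x = d" by (simp add: grad_def vec_eq_iff)
qed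

lemma test_funI:
  assumes der: "\<And>x. (\<phi> has_derivative (\<lambda>h. D x \<bullet> h)) (at x)" and D: "continuous_on UNIV D"
    and K: "compact K" "K \<subseteq> \<Omega>" "\<And>x. x \<notin> K \<Longrightarrow> \<phi> x = 0"
  shows "test_fun \<Omega> \<phi>"
proof -
  have "closure {x. \<phi> x \<noteq> 0} \<subseteq> K" using K compact_imp_closed by (intro closure_minimal) auto
  moreover from this have "compact (closure {x. \<phi> x \<noteq> 0})"
    using K(1) by (metis closed_closure compact_Int_closed inf.absorb_iff2)
  moreover have "partial_deriv \<phi> i = (\<lambda>x. D x $ i)" for i using partial_deriv_eq(1)[OF der] by auto
  moreover have "continuous_on UNIV (\<lambda>x. D x $ i)" for i by (intro continuous_intros D)
  ultimately show ?thesis unfolding test_fun_def using K(2) der differentiableI by fastforce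
qed

lemma (in mollifier) has_derivative_mollifier: "(\<eta> has_derivative (\<lambda>h. D z \<bullet> h)) (at z)"
  unfolding has_derivative_at_alt
proof (intro conjI allI impI)
  show "bounded_linear ((\<bullet>) (D z))" by (rule bounded_linear_inner_right)
  fix e :: real assume e: "0 < e"
  define d where "d = min \<epsilon> (e / (\<bar>C\<bar> + 1))"
  have d: "d > 0" using eps_pos e by (simp add: d_def)
  show "\<exists>d>0. \<forall>y. norm (y - z) < d \<longrightarrow> norm (\<eta> y - \<eta> z - D z \<bullet> (y - z)) \<le> e * norm (y - z)"
  proof (intro exI[of _ d] conjI d allI impI)
    fix y assume y: "norm (y - z) < d"
    then have h: "norm (y - z) \<le> \<epsilon>" "norm (y - z) * (\<bar>C\<bar> + 1) \<le> e"
      unfolding d_def by (auto simp: pos_less_divide_eq)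
    have "norm (\<eta> y - \<eta> z - D z \<bullet> (y - z)) \<le> C * (norm (y - z))\<^sup>2" using taylor[OF h(1), of z] by simp
    also have "\<dots> \<le> (norm (y - z) * (\<bar>C\<bar> + 1)) * norm (y - z)"
      using mult_right_mono[of C "\<bar>C\<bar> + 1" "norm (y - z) * norm (y - z)"]
      by (simp add: power2_eq_square mult.assoc mult.left_commute)
    also have "\<dots> \<le> e * norm (y - z)" using h(2) by (rule mult_right_mono) simp
    finally show "norm (\<eta> y - \<eta> z - D z \<bullet> (y - z)) \<le> e * norm (y - z)" .
  qed
qed

lemma (in mollifier) kernel_has_derivative:
  "((\<lambda>y. \<eta> (x - y)) has_derivative (\<lambda>h. (- D (x - y)) \<bullet> h)) (at y)"
proof -
  have "((\<lambda>y. \<eta> (x - y)) has_derivative (\<lambda>h. D (x - y) \<bullet> (- h))) (at y)"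
    by (rule has_derivative_compose[OF _ has_derivative_mollifier]) (auto intro!: derivative_eq_intros)
  then show ?thesis by simp
qed

text \<open>The kernel itself is the test function that identifies the gradient of a mollification.
  The minus sign of the chain rule later cancels the one in the definition of the weak
  gradient.\<close>

lemma mollifier_kernel_test_fun:
  fixes \<eta> :: "real^'n \<Rightarrow> real"
  assumes m: "mollifier \<eta> D \<epsilon> C" and sub: "cball x \<epsilon> \<subseteq> \<Omega>"
  shows "test_fun \<Omega> (\<lambda>y. \<eta> (x - y))" "partial_deriv (\<lambda>y. \<eta> (x - y)) i y = - (D (x - y) $ i)"
proof -
  interpret mollifier \<eta> D \<epsilon> C by (rule m)
  show "test_fun \<Omega> (\<lambda>y. \<eta> (x - y))"
  proof (rule test_funI[OF kernel_has_derivative])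
    show "continuous_on UNIV (\<lambda>y. - D (x - y))"
      by (intro continuous_intros continuous_on_compose2[OF cont_grad]) auto
    show "compact (cball x \<epsilon>)" "cball x \<epsilon> \<subseteq> \<Omega>" using sub by auto
    show "\<eta> (x - y) = 0" if "y \<notin> cball x \<epsilon>" for y
      using that by (intro supp) (auto simp: dist_norm)
  qed
  show "partial_deriv (\<lambda>y. \<eta> (x - y)) i y = - (D (x - y) $ i)"
    using partial_deriv_eq(1)[OF kernel_has_derivative] by simp
qed

section \<open>Borel representatives and the gradient of a mollification\<close>

lemma compact_lebesgue [simp]: "compact K \<Longrightarrow> K \<in> sets (lebesgue :: 'a::euclidean_space measure)"
  by (simp add: borel_compact)

text \<open>Convolutions are set up over \<open>lborel\<close>, where Tonelli needs Borel functions,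
  whereas functions in Sobolev classes are only Lebesgue measurable; a change on a null set bridges
  the two.\<close>

lemma borel_rep_real:
  fixes f :: "'a::euclidean_space \<Rightarrow> real"
  assumes f: "integrable lebesgue f"
  shows "\<exists>W. integrable lborel W \<and> (AE x in lebesgue. W x = f x)"
proof -
  have "f \<in> borel_measurable (completion lborel)" using f by auto
  from completion_ex_borel_measurable_real[OF this]
  obtain W where W: "W \<in> borel_measurable lborel" "AE x in lborel. f x = W x" by auto
  then have AE: "AE x in lebesgue. f x = W x" by (simp add: AE_completion_iff)
  have "integrable lebesgue W"
  proof (subst integrable_cong_AE)
    show "AE x in lebesgue. W x = f x" using AE by eventually_elim simp
    show "W \<in> borel_measurable lebesgue" using W(1) by (rule measurable_completion)
  qed (use f in auto)
  then have "integrable lborel W" using integrable_completion[of W lborel] W(1) by simp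
  moreover have "AE x in lebesgue. W x = f x" using AE by eventually_elim simp
  ultimately show ?thesis by blast
qed

lemma borel_rep_vec:
  fixes f :: "'a::euclidean_space \<Rightarrow> real^'n"
  assumes f: "\<And>i. integrable lebesgue (\<lambda>x. f x $ i)"
  shows "\<exists>W. integrable lborel W \<and> (AE x in lebesgue. W x = f x)"
proof -
  have "\<forall>i. \<exists>W. integrable lborel W \<and> (AE x in lebesgue. W x = f x $ i)"
    using borel_rep_real[OF f] by auto
  then obtain W where W: "\<And>i. integrable lborel (W i)" "\<And>i. AE x in lebesgue. W i x = f x $ i" by metis
  have "AE x in lebesgue. \<forall>i. W i x = f x $ i" using W(2) by (simp add: AE_all_countable)
  then have "AE x in lebesgue. (\<Sum>i\<in>UNIV. W i x *\<^sub>R axis i 1) = f x"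
  proof eventually_elim
    case (elim x)
    have "(\<Sum>i\<in>UNIV. W i x *\<^sub>R axis i 1) = (\<Sum>i\<in>UNIV. (f x $ i) *s axis i 1)"
      using elim by (simp add: scalar_mult_eq_scaleR)
    then show ?case by (simp add: basis_expansion)
  qed
  moreover have "integrable lborel (\<lambda>x. \<Sum>i\<in>UNIV. W i x *\<^sub>R (axis i 1 :: real^'n))"
    using W(1) by (intro Bochner_Integration.integrable_sum integrable_scaleR_left) auto
  ultimately show ?thesis by blast
qed

lemma locLp_1_integrable:
  assumes "locLp \<Omega> 1 u" "compact K" "K \<subseteq> \<Omega>"
  shows "integrable (lebesgue_on K) u" "integrable lebesgue (\<lambda>x. indicator K x * u x)"
proof -
  have m: "u \<in> borel_measurable (lebesgue_on K)"
    using assms unfolding locLp_def by (auto intro: measurable_restrict_mono)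
  have "integrable (lebesgue_on K) (\<lambda>x. \<bar>u x\<bar> powr 1)" using assms by (auto simp: locLp_def)
  then have "integrable (lebesgue_on K) (\<lambda>x. \<bar>u x\<bar>)" by simp
  then show 1: "integrable (lebesgue_on K) u" using m integrable_abs_iff by blast
  then show "integrable lebesgue (\<lambda>x. indicator K x * u x)"
    using assms(2) by (simp add: integrable_restrict_space)
qed

lemma borel_measurable_vec_component [measurable (raw)]:
  fixes f :: "'a \<Rightarrow> real^'n"
  assumes "f \<in> borel_measurable M"
  shows "(\<lambda>x. f x $ i) \<in> borel_measurable M"
  by (rule measurable_compose[OF assms borel_measurable_continuous_onI]) (intro continuous_intros)

text \<open>Testing the weak gradient with \<open>\<lambda>y. \<eta> (x - y)\<close> moves the
  derivative from the kernel to w. Setting \<open>W\<close> and \<open>V\<close> to zero outside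
  \<open>K\<close> makes them globally integrable and changes nothing at x, as the kernel vanishes
  off \<open>cball x \<epsilon>\<close>.\<close>

lemma weak_grad_convol:
  fixes w :: "real^'n \<Rightarrow> real"
  assumes wg: "weak_grad \<Omega> w G" and \<Omega>: "open \<Omega>" and m: "mollifier \<eta> D \<epsilon> C"
    and sub: "cball x \<epsilon> \<subseteq> K" "K \<subseteq> \<Omega>" 
    and W: "integrable lborel W" "AE y in lebesgue. W y = indicator K y * w y"
    and V: "integrable lborel V" "AE y in lebesgue. V y = indicator K y *\<^sub>R G y"
  shows "(\<integral>y. W y *\<^sub>R D (x - y) \<partial>lborel) = convol \<eta> V x"
proof -
  interpret mollifier \<eta> D \<epsilon> C by (rule m)
  have sub': "cball x \<epsilon> \<subseteq> \<Omega>" using sub by auto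
  note T = mollifier_kernel_test_fun[OF m sub']
  have [measurable]: "\<Omega> \<in> sets lebesgue" using \<Omega> by simp
  have [measurable]: "W \<in> borel_measurable borel" "V \<in> borel_measurable borel" using W V by auto
  have Z: "D (x - y) = 0" "\<eta> (x - y) = 0" if "y \<notin> K" for y
    using that sub(1) by (auto intro!: supp supp_grad simp: dist_norm subset_iff not_le less_imp_le) (meson less_imp_le not_le)+
  have wm: "w \<in> borel_measurable (lebesgue_on \<Omega>)" "(\<lambda>y. G y $ i) \<in> borel_measurable (lebesgue_on \<Omega>)" for i
    using wg unfolding weak_grad_def locLp_def by auto
  have wm': "(\<lambda>y. indicator \<Omega> y * w y) \<in> borel_measurable lebesgue" "(\<lambda>y. indicator \<Omega> y * G y $ i) \<in> borel_measurable lebesgue" for i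
    using wm(1) wm(2)[of i] by (simp_all add: borel_measurable_restrict_space_iff)
  have "(\<integral>y. W y *\<^sub>R D (x - y) \<partial>lborel) $ i = convol \<eta> V x $ i" for i
  proof -
    have "(\<integral>y. W y *\<^sub>R D (x - y) \<partial>lborel) $ i = (\<integral>y. (W y *\<^sub>R D (x - y)) \<bullet> axis i 1 \<partial>lborel)"
      by (subst integral_inner_left) (auto simp: inner_axis integrable_convol_grad_kernel[OF W(1)])
    also have "\<dots> = (\<integral>y. W y * D (x - y) $ i \<partial>lborel)" by (simp add: inner_axis)
    also have "\<dots> = (\<integral>y. W y * D (x - y) $ i \<partial>lebesgue)"
      by (subst integral_completion) auto
    also have "\<dots> = (\<integral>y. indicator \<Omega> y *\<^sub>R (w y * - partial_deriv (\<lambda>y. \<eta> (x - y)) i y) \<partial>lebesgue)"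
    proof (rule integral_cong_AE)
      show "(\<lambda>y. W y * D (x - y) $ i) \<in> borel_measurable lebesgue" by (auto intro!: measurable_completion)
      have "(\<lambda>y. (indicator \<Omega> y * w y) * (D (x - y) $ i)) \<in> borel_measurable lebesgue"
        by (intro borel_measurable_times wm'(1)) (auto intro!: measurable_completion)
      then show "(\<lambda>y. indicator \<Omega> y *\<^sub>R (w y * - partial_deriv (\<lambda>y. \<eta> (x - y)) i y)) \<in> borel_measurable lebesgue"
        by (simp add: T mult.assoc)
      show "AE y in lebesgue. W y * D (x - y) $ i = indicator \<Omega> y *\<^sub>R (w y * - partial_deriv (\<lambda>y. \<eta> (x - y)) i y)"
        using W(2)
      proof eventually_elim
        case (elim y)
        then show ?case using Z(1)[of y] sub by (cases "y \<in> K") (auto simp: T indicator_def)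
      qed
    qed
    also have "\<dots> = - (\<integral>y. w y * partial_deriv (\<lambda>y. \<eta> (x - y)) i y \<partial>lebesgue_on \<Omega>)"
      by (simp add: integral_restrict_space)
    also have "\<dots> = (\<integral>y. G y $ i * \<eta> (x - y) \<partial>lebesgue_on \<Omega>)"
      using wg T(1) unfolding weak_grad_def by auto
    also have "\<dots> = (\<integral>y. indicator \<Omega> y *\<^sub>R (G y $ i * \<eta> (x - y)) \<partial>lebesgue)"
      by (simp add: integral_restrict_space)
    also have "\<dots> = (\<integral>y. \<eta> (x - y) * V y $ i \<partial>lebesgue)"
    proof (rule integral_cong_AE)
      show "(\<lambda>y. \<eta> (x - y) * V y $ i) \<in> borel_measurable lebesgue" by (auto intro!: measurable_completion)
      have "(\<lambda>y. (indicator \<Omega> y * G y $ i) * \<eta> (x - y)) \<in> borel_measurable lebesgue"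
        by (intro borel_measurable_times wm'(2)) (auto intro!: measurable_completion)
      then show "(\<lambda>y. indicator \<Omega> y *\<^sub>R (G y $ i * \<eta> (x - y))) \<in> borel_measurable lebesgue"
        by (simp add: mult.assoc)
      show "AE y in lebesgue. indicator \<Omega> y *\<^sub>R (G y $ i * \<eta> (x - y)) = \<eta> (x - y) * V y $ i"
        using V(2)
      proof eventually_elim
        case (elim y)
        then show ?case using Z(2)[of y] sub by (cases "y \<in> K") (auto simp: indicator_def)
      qed
    qed
    also have "\<dots> = (\<integral>y. \<eta> (x - y) * V y $ i \<partial>lborel)"
      by (subst integral_completion) auto
    also have "\<dots> = (\<integral>y. (\<eta> (x - y) *\<^sub>R V y) \<bullet> axis i 1 \<partial>lborel)" by (simp add: inner_axis)
    also have "\<dots> = convol \<eta> V x $ i" unfolding convol_def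
      by (subst integral_inner_left) (auto simp: inner_axis integrable_convol_kernel[OF V(1)])
    finally show ?thesis .
  qed
  then show ?thesis by (simp add: vec_eq_iff)
qed

section \<open>Differences and uniqueness of weak gradients\<close>

lemma locLp_1_iff:
  assumes "open \<Omega>"
  shows "locLp \<Omega> 1 u \<longleftrightarrow> u \<in> borel_measurable (lebesgue_on \<Omega>) \<and>
     (\<forall>K. compact K \<and> K \<subseteq> \<Omega> \<longrightarrow> integrable (lebesgue_on K) u)"
proof
  assume "locLp \<Omega> 1 u"
  then show "u \<in> borel_measurable (lebesgue_on \<Omega>) \<and> (\<forall>K. compact K \<and> K \<subseteq> \<Omega> \<longrightarrow> integrable (lebesgue_on K) u)"
    using locLp_1_integrable(1) by (auto simp: locLp_def)
next
  assume "u \<in> borel_measurable (lebesgue_on \<Omega>) \<and> (\<forall>K. compact K \<and> K \<subseteq> \<Omega> \<longrightarrow> integrable (lebesgue_on K) u)"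
  then show "locLp \<Omega> 1 u" by (auto simp: locLp_def)
qed

lemma locLp_1_diff:
  assumes "open \<Omega>" "locLp \<Omega> 1 u" "locLp \<Omega> 1 v"
  shows "locLp \<Omega> 1 (\<lambda>x. u x - v x)"
  using assms unfolding locLp_1_iff[OF assms(1)] by (auto intro!: borel_measurable_diff)

lemma integrable_lebesgue_on_support:
  assumes \<Omega>: "open \<Omega>" and K: "compact K" "K \<subseteq> \<Omega>"
    and u: "integrable (lebesgue_on K) u" and z: "\<And>x. x \<notin> K \<Longrightarrow> u x = (0::real)"
  shows "integrable (lebesgue_on \<Omega>) u"
proof -
  have [simp]: "\<Omega> \<in> sets lebesgue" using \<Omega> by simp
  have e: "indicator \<Omega> x * u x = indicator K x * u x" for x using K z by (auto simp: indicator_def)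
  show ?thesis using u K by (simp add: integrable_restrict_space e)
qed

lemma integrable_mult_continuous_support:
  fixes u \<psi> :: "real^'n \<Rightarrow> real"
  assumes \<Omega>: "open \<Omega>" and u: "locLp \<Omega> 1 u" and K: "compact K" "K \<subseteq> \<Omega>"
    and \<psi>: "continuous_on UNIV \<psi>" "\<And>x. x \<notin> K \<Longrightarrow> \<psi> x = 0"
  shows "integrable (lebesgue_on \<Omega>) (\<lambda>x. u x * \<psi> x)"
proof (rule integrable_lebesgue_on_support[OF \<Omega> K])
  have "compact (\<psi> ` K)" using K \<psi> by (intro compact_continuous_image continuous_on_subset[OF \<psi>(1)]) auto
  then obtain B where B: "\<And>x. x \<in> K \<Longrightarrow> norm (\<psi> x) \<le> B" "B > 0" using compact_imp_bounded bounded_pos by (metis imageI)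
  have ui: "integrable (lebesgue_on K) u" using locLp_1_integrable[OF u K] by auto
  have um[measurable]: "u \<in> borel_measurable (lebesgue_on K)" using ui by auto
  have "\<psi> \<in> borel_measurable borel" by (rule borel_measurable_continuous_onI[OF \<psi>(1)])
  then have [measurable]: "\<psi> \<in> borel_measurable (lebesgue_on K)"
    by (intro measurable_restrict_space1 measurable_completion) simp
  show "integrable (lebesgue_on K) (\<lambda>x. u x * \<psi> x)"
  proof (rule Bochner_Integration.integrable_bound)
    show "integrable (lebesgue_on K) (\<lambda>x. B * u x)" using ui by simp
    show "AE x in lebesgue_on K. norm (u x * \<psi> x) \<le> norm (B * u x)"
      using B by (intro AE_I2) (auto simp: abs_mult mult.commute[of "\<bar>u _\<bar>"] intro!: mult_right_mono)
  qed measurable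
qed (use \<psi> in auto)

lemma partial_deriv_zero_outside:
  fixes \<phi> :: "real^'n \<Rightarrow> real"
  assumes "closed K" "\<And>x. x \<notin> K \<Longrightarrow> \<phi> x = 0" "x \<notin> K"
  shows "partial_deriv \<phi> i x = 0"
proof -
  have "((\<lambda>x. 0) has_derivative (\<lambda>h. 0 \<bullet> h)) (at x)" by simp
  then have "(\<phi> has_derivative (\<lambda>h. 0 \<bullet> h)) (at x)"
    by (rule has_derivative_transform_within_open[OF _ open_Compl[OF assms(1)]]) (use assms in auto)
  then show ?thesis using partial_deriv_eq(1) by fastforce
qed

text \<open>Linearity of the integral requires every product to be integrable; the compact support
  of the test function and of its partial derivatives provides this.\<close>

lemma weak_grad_diff:
  fixes u v :: "real^'n \<Rightarrow> real"
  assumes \<Omega>: "open \<Omega>" and u: "weak_grad \<Omega> u Du" and v: "weak_grad \<Omega> v Dv"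
  shows "weak_grad \<Omega> (\<lambda>x. u x - v x) (\<lambda>x. Du x - Dv x)"
  unfolding weak_grad_def
proof (intro conjI allI impI)
  show "locLp \<Omega> 1 (\<lambda>x. u x - v x)" using u v \<Omega> by (intro locLp_1_diff) (auto simp: weak_grad_def)
  show "locLp \<Omega> 1 (\<lambda>x. (Du x - Dv x) $ i)" for i
    using locLp_1_diff[OF \<Omega>, of "\<lambda>x. Du x $ i" "\<lambda>x. Dv x $ i"] u v by (auto simp: weak_grad_def)
  fix \<phi> i assume t: "test_fun \<Omega> \<phi>"
  define K where "K = closure {x. \<phi> x \<noteq> 0}"
  have K: "compact K" "K \<subseteq> \<Omega>" "\<And>x. x \<notin> K \<Longrightarrow> \<phi> x = 0"
    using t closure_subset[of "{x. \<phi> x \<noteq> 0}"] by (auto simp: test_fun_def K_def)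
  have c: "continuous_on UNIV (partial_deriv \<phi> i)" "continuous_on UNIV \<phi>"
    using t by (auto simp: test_fun_def differentiable_imp_continuous_within continuous_at_imp_continuous_on)
  have z: "partial_deriv \<phi> i x = 0" if "x \<notin> K" for x
    by (rule partial_deriv_zero_outside[OF compact_imp_closed[OF K(1)] _ that]) (rule K(3))
  note I1 = integrable_mult_continuous_support[OF \<Omega> _ K(1,2) c(1) z]
  note I2 = integrable_mult_continuous_support[OF \<Omega> _ K(1,2) c(2) K(3)]
  have L: "locLp \<Omega> 1 u" "locLp \<Omega> 1 v" "locLp \<Omega> 1 (\<lambda>x. Du x $ i)" "locLp \<Omega> 1 (\<lambda>x. Dv x $ i)"
    using u v by (auto simp: weak_grad_def)
  have "(\<integral>x. (u x - v x) * partial_deriv \<phi> i x \<partial>lebesgue_on \<Omega>) =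
     (\<integral>x. u x * partial_deriv \<phi> i x \<partial>lebesgue_on \<Omega>) - (\<integral>x. v x * partial_deriv \<phi> i x \<partial>lebesgue_on \<Omega>)"
    using I1[OF L(1)] I1[OF L(2)] by (simp add: left_diff_distrib)
  also have "\<dots> = - (\<integral>x. Du x $ i * \<phi> x \<partial>lebesgue_on \<Omega>) + (\<integral>x. Dv x $ i * \<phi> x \<partial>lebesgue_on \<Omega>)"
    using u v t by (simp add: weak_grad_def)
  also have "\<dots> = - (\<integral>x. (Du x - Dv x) $ i * \<phi> x \<partial>lebesgue_on \<Omega>)"
    using I2[OF L(3)] I2[OF L(4)] by (simp add: left_diff_distrib)
  finally show "(\<integral>x. (u x - v x) * partial_deriv \<phi> i x \<partial>lebesgue_on \<Omega>) = - (\<integral>x. (Du x - Dv x) $ i * \<phi> x \<partial>lebesgue_on \<Omega>)" .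
qed

lemma mollifier_sequence:
  assumes "0 < e"
  obtains \<eta> :: "nat \<Rightarrow> 'a::euclidean_space \<Rightarrow> real" and D \<epsilon> C
  where "\<And>n. mollifier (\<eta> n) (D n) (\<epsilon> n) (C n)" "\<And>n. \<epsilon> n \<le> e" "\<epsilon> \<longlonglongrightarrow> 0"
proof -
  define \<epsilon> where "\<epsilon> n = e / real (Suc n)" for n
  have "\<forall>n. \<exists>(\<eta> :: 'a \<Rightarrow> real) D C. mollifier \<eta> D (\<epsilon> n) C"
    using assms by (intro allI mollifier_exists) (simp add: \<epsilon>_def)
  then obtain \<eta> :: "nat \<Rightarrow> 'a \<Rightarrow> real" and D C where "\<And>n. mollifier (\<eta> n) (D n) (\<epsilon> n) (C n)" by metis
  moreover have "\<epsilon> n \<le> e" for n using assms by (simp add: \<epsilon>_def field_simps)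
  moreover have "\<epsilon> \<longlonglongrightarrow> 0" unfolding \<epsilon>_def
    using tendsto_mult[OF tendsto_const[of e] LIMSEQ_inverse_real_of_nat] by (simp add: divide_inverse)
  ultimately show ?thesis using that by blast
qed

text \<open>This is the room that mollification at scale at most \<open>e\<close> needs: at points
  of \<open>K'\<close> it only sees data in \<open>K''\<close>, and at points off \<open>K'\<close>
  it does not see \<open>K\<close> at all.\<close>

lemma compact_nested_neighbourhoods:
  fixes K :: "'a::euclidean_space set"
  assumes K: "compact K" "K \<subseteq> \<Omega>" and \<Omega>: "open \<Omega>"
  obtains e K' K'' where "0 < e" "compact K'" "compact K''" "K \<subseteq> K'" "K' \<subseteq> K''" "K'' \<subseteq> \<Omega>"
    "\<And>x. x \<in> K' \<Longrightarrow> cball x e \<subseteq> K''" "\<And>x. x \<notin> K' \<Longrightarrow> cball x e \<inter> K = {}"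
proof -
  obtain e where e: "e > 0" "(\<Union>x\<in>K. cball x e) \<subseteq> \<Omega>"
    using compact_subset_open_imp_cball_epsilon_subset[OF K(1) \<Omega> K(2)] by blast
  \<comment> \<open>A closed neighbourhood written as a Minkowski sum, which makes its compactness
    immediate. Half the admissible radius is spent on \<open>K'\<close> and half on the step to
    \<open>K''\<close>.\<close>
  define N where "N r = {x + y |x y. x \<in> K \<and> y \<in> cball 0 r}" for r :: real
  have N: "x \<in> N r \<longleftrightarrow> (\<exists>k\<in>K. dist k x \<le> r)" for x r
  proof
    assume "\<exists>k\<in>K. dist k x \<le> r"
    then obtain k where "k \<in> K" "dist k x \<le> r" by auto
    then have "x = k + (x - k)" "x - k \<in> cball 0 r" by (auto simp: dist_norm norm_minus_commute)
    then show "x \<in> N r" unfolding N_def using \<open>k \<in> K\<close> by blast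
  qed (auto simp: N_def dist_norm intro!: bexI)
  have c: "compact (N r)" for r unfolding N_def using K(1) by (intro compact_sums) auto
  show ?thesis
  proof (rule that[of "e/2" "N (e/2)" "N e"])
    show "K \<subseteq> N (e/2)" using e(1) by (force simp: N)
    show "N (e/2) \<subseteq> N e"
    proof
      fix x assume "x \<in> N (e/2)"
      then obtain k where "k \<in> K" "dist k x \<le> e/2" by (auto simp: N)
      then show "x \<in> N e" using e(1) unfolding N by (intro bexI[of _ k]) auto
    qed
    show "N e \<subseteq> \<Omega>" using e(2) by (force simp: N)
    show "cball x (e/2) \<subseteq> N e" if "x \<in> N (e/2)" for x
    proof
      fix y assume y: "y \<in> cball x (e/2)"
      obtain k where k: "k \<in> K" "dist k x \<le> e/2" using \<open>x \<in> N (e/2)\<close> N by auto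
      have "dist k y \<le> e" using k y dist_triangle[of k y x] by auto
      then show "y \<in> N e" using k N by auto
    qed
    show "cball x (e/2) \<inter> K = {}" if "x \<notin> N (e/2)" for x
      using that by (auto simp: N dist_commute)
  qed (use e c in auto)
qed

lemma weak_grad_borel_rep:
  fixes w :: "real^'n \<Rightarrow> real"
  assumes wg: "weak_grad \<Omega> w G" and K: "compact K" "K \<subseteq> \<Omega>"
  obtains W V where "integrable lborel W" "AE y in lebesgue. W y = indicator K y * w y"
    "integrable lborel V" "AE y in lebesgue. V y = indicator K y *\<^sub>R G y"
proof -
  have "integrable lebesgue (\<lambda>x. indicator K x * w x)"
    using wg K by (intro locLp_1_integrable(2)) (auto simp: weak_grad_def)
  from borel_rep_real[OF this] obtain W where W: "integrable lborel W" "AE y in lebesgue. W y = indicator K y * w y" by auto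
  have "integrable lebesgue (\<lambda>x. indicator K x * G x $ i)" for i
    using wg K by (intro locLp_1_integrable(2)) (auto simp: weak_grad_def)
  then have "integrable lebesgue (\<lambda>x. (indicator K x *\<^sub>R G x) $ i)" for i by simp
  from borel_rep_vec[OF this] obtain V where V: "integrable lborel V" "AE y in lebesgue. V y = indicator K y *\<^sub>R G y" by auto
  show ?thesis using that W V by blast
qed

text \<open>The difference is a weak gradient of 0, so its mollifications vanish on a neighbourhood
  of \<open>K\<close>, and they converge to it in L^1. Membership in a Sobolev class speaks of some
  weak gradient; uniqueness carries its integrability over to the given \<open>Du\<close> and
  \<open>Dv\<close>.\<close>

lemma weak_grad_unique:
  fixes u :: "real^'n \<Rightarrow> real"
  assumes \<Omega>: "open \<Omega>" and G1: "weak_grad \<Omega> u G1" and G2: "weak_grad \<Omega> u G2" and K: "compact K" "K \<subseteq> \<Omega>"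
  shows "AE x in lebesgue. x \<in> K \<longrightarrow> G1 x = G2 x"
proof -
  have wg: "weak_grad \<Omega> (\<lambda>x. 0) (\<lambda>x. G1 x - G2 x)"
    using weak_grad_diff[OF \<Omega> G1 G2] by simp
  obtain e K' K'' where e: "0 < e" "compact K'" "compact K''" "K \<subseteq> K'" "K' \<subseteq> K''" "K'' \<subseteq> \<Omega>"
    "\<And>x. x \<in> K' \<Longrightarrow> cball x e \<subseteq> K''"
    by (rule compact_nested_neighbourhoods[OF K \<Omega>]) blast
  obtain W :: "real^'n \<Rightarrow> real" and V where W: "integrable lborel W" "AE y in lebesgue. W y = indicator K'' y * 0"
    and V: "integrable lborel V" "AE y in lebesgue. V y = indicator K'' y *\<^sub>R (G1 y - G2 y)"
    by (rule weak_grad_borel_rep[OF wg e(3,6)]) (rule that; assumption)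
  have W0: "AE y in lborel. W y = 0" using W(2) by (simp add: AE_completion_iff)
  obtain \<eta> :: "nat \<Rightarrow> real^'n \<Rightarrow> real" and D \<epsilon> C
    where m: "\<And>n. mollifier (\<eta> n) (D n) (\<epsilon> n) (C n)" "\<And>n. \<epsilon> n \<le> e" "\<epsilon> \<longlonglongrightarrow> 0"
    by (rule mollifier_sequence[OF e(1)]) blast
  have "convol (\<eta> n) V x = 0" if "x \<in> K'" for n x
  proof -
    have "cball x (\<epsilon> n) \<subseteq> K''" using e(7)[OF that] m(2)[of n] by (meson order_trans subset_cball)
    from weak_grad_convol[OF wg \<Omega> m(1) this e(6) W V]
    have "convol (\<eta> n) V x = (\<integral>y. W y *\<^sub>R D n (x - y) \<partial>lborel)" by simp
    also have "\<dots> = 0" by (rule integral_eq_zero_AE) (use W0 in auto)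
    finally show ?thesis .
  qed
  then have z: "norm (V x) * indicator K' x \<le> norm (convol (\<eta> n) V x - V x)" for n x
    by (auto simp: indicator_def)
  have Vi: "integrable lborel (\<lambda>x. norm (V x) * indicator K' x)"
    using e(2) V(1) by (intro integrable_real_mult_indicator integrable_norm) (auto simp: borel_compact)
  have "(\<integral>x. norm (V x) * indicator K' x \<partial>lborel) \<le> (\<integral>x. norm (convol (\<eta> n) V x - V x) \<partial>lborel)" for n
    using V(1) mollifier.integrable_convol(1)[OF m(1) V(1)] Vi z by (intro integral_mono) auto
  with convol_tendsto_L1[OF V(1) m(1,3)]
  have "(\<integral>x. norm (V x) * indicator K' x \<partial>lborel) \<le> 0" by (intro LIMSEQ_le_const) auto
  then have "(\<integral>x. norm (V x) * indicator K' x \<partial>lborel) = 0"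
    by (intro antisym integral_nonneg_AE) auto
  then have "AE x in lborel. norm (V x) * indicator K' x = 0"
    using integral_nonneg_eq_0_iff_AE[OF Vi] by auto
  then have "AE x in lebesgue. norm (V x) * indicator K' x = 0" by (simp add: AE_completion_iff)
  then show ?thesis using V(2)
  proof eventually_elim
    case (elim x)
    then show ?case using e(4,5) by (auto simp: indicator_def)
  qed
qed

section \<open>Passage to the limit in the test functions\<close>

text \<open>At the kink the difference quotient is at most
  \<open>\<bar>s - k\<bar> powr (a - 1)\<close>, which tends to 0 because a > 1. It is used with the
  exponents 2 and r + 1.\<close>

lemma positive_part_powr_has_derivative:
  fixes k a :: real
  assumes a: "1 < a"
  shows "((\<lambda>t. max 0 (t - k) powr a) has_real_derivative a * max 0 (t - k) powr (a - 1)) (at t)"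
proof -
  consider "t < k" | "t > k" | "t = k" by linarith
  then show ?thesis
  proof cases
    case 1
    have "((\<lambda>t. 0) has_real_derivative 0) (at t)" by simp
    then have "((\<lambda>t. max 0 (t - k) powr a) has_real_derivative 0) (at t)"
      by (rule has_field_derivative_transform_within_open[where S="{..<k}"]) (use 1 in auto)
    then show ?thesis using 1 by simp
  next
    case 2
    have "((\<lambda>t. (t - k) powr a) has_real_derivative a * (t - k) powr (a - 1)) (at t)"
      using 2 by (auto intro!: derivative_eq_intros)
    then have "((\<lambda>t. max 0 (t - k) powr a) has_real_derivative a * (t - k) powr (a - 1)) (at t)"
      by (rule has_field_derivative_transform_within_open[where S="{k<..}"]) (use 2 in auto)
    then show ?thesis using 2 by simp
  next
    case 3
    have "((\<lambda>s. (max 0 (s - k) powr a - max 0 (k - k) powr a) / (s - k)) \<longlongrightarrow> 0) (at k)"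
    proof (rule Lim_null_comparison[where g="\<lambda>s. \<bar>s - k\<bar> powr (a - 1)"])
      show "\<forall>\<^sub>F s in at k. norm ((max 0 (s - k) powr a - max 0 (k - k) powr a) / (s - k)) \<le> \<bar>s - k\<bar> powr (a - 1)"
      proof (rule eventually_at_filter[THEN iffD2], rule always_eventually, intro allI impI)
        fix s :: real assume "s \<noteq> k"
        then show "norm ((max 0 (s - k) powr a - max 0 (k - k) powr a) / (s - k)) \<le> \<bar>s - k\<bar> powr (a - 1)"
          by (cases "s < k") (auto simp: powr_diff)
      qed
      have "((\<lambda>s. \<bar>s - k\<bar> powr (a - 1)) \<longlongrightarrow> \<bar>k - k\<bar> powr (a - 1)) (at k)"
        using a by (intro tendsto_powr' tendsto_intros) auto
      then show "((\<lambda>s. \<bar>s - k\<bar> powr (a - 1)) \<longlongrightarrow> 0) (at k)" by simp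
    qed
    then show ?thesis using 3 a by (simp add: has_field_derivative_iff)
  qed
qed

lemma continuous_on_positive_part_powr:
  fixes k a :: real
  assumes "0 < a"
  shows "continuous_on UNIV (\<lambda>t. max 0 (t - k) powr a)"
  using assms by (intro continuous_on_powr' continuous_intros) auto

text \<open>Mollify the indicator of an intermediate compact set \<open>L\<close>: the result is 1
  where the averaging ball lies inside \<open>L\<close>, in particular on \<open>K\<close>, and 0
  where it misses \<open>L\<close>. Neighbourhoods on both sides of \<open>L\<close> leave space for
  this.\<close>

lemma cutoff_exists:
  fixes K :: "(real^'n) set"
  assumes \<Omega>: "open \<Omega>" and K: "compact K" "K \<subseteq> \<Omega>"
  obtains \<phi> where "test_fun \<Omega> \<phi>" "\<And>x. 0 \<le> \<phi> x" "\<And>x. x \<in> K \<Longrightarrow> \<phi> x = 1"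
proof -
  obtain e K' L where e: "0 < e" "compact K'" "compact L" "K \<subseteq> K'" "K' \<subseteq> L" "L \<subseteq> \<Omega>"
    "\<And>x. x \<in> K' \<Longrightarrow> cball x e \<subseteq> L" 
    by (rule compact_nested_neighbourhoods[OF K \<Omega>]) blast
  obtain e' L' L'' where e': "0 < e'" "compact L'" "compact L''" "L \<subseteq> L'" "L' \<subseteq> L''" "L'' \<subseteq> \<Omega>"
    "\<And>x. x \<notin> L' \<Longrightarrow> cball x e' \<inter> L = {}"
    by (rule compact_nested_neighbourhoods[OF e(3,6) \<Omega>]) blast
  obtain \<eta> :: "real^'n \<Rightarrow> real" and D C where m: "mollifier \<eta> D (min e e') C"
    using mollifier_exists[of "min e e'"] e(1) e'(1) by auto
  define W :: "real^'n \<Rightarrow> real" where "W = indicator L"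
  have W: "integrable lborel W" unfolding W_def
    using e(3) emeasure_compact_finite[OF e(3)] by (simp add: borel_compact)
  show ?thesis
  proof (rule that[of "convol \<eta> W"])
    show "test_fun \<Omega> (convol \<eta> W)"
    proof (rule test_funI[OF mollifier.convol_has_derivative[OF m W] mollifier.continuous_on_convol_grad[OF m W] e'(2)])
      show "L' \<subseteq> \<Omega>" using e' by auto
      fix x assume "x \<notin> L'"
      then have "cball x e' \<inter> L = {}" by (rule e'(7))
      then have "AE y in lborel. y \<in> ball x (min e e') \<longrightarrow> norm (W y - 0) \<le> 0"
        by (intro AE_I2) (auto simp: W_def indicator_def disjoint_iff dest: less_imp_le)
      from mollifier.convol_norm_diff_le[OF m W this] show "convol \<eta> W x = 0" by simp
    qed
    show "0 \<le> convol \<eta> W x" for x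
      unfolding convol_def W_def using mollifier.nonneg[OF m] by (intro integral_nonneg_AE) auto
    fix x assume "x \<in> K"
    then have "cball x e \<subseteq> L" using e(4) e(7)[of x] by blast
    then have "AE y in lborel. y \<in> ball x (min e e') \<longrightarrow> norm (W y - 1) \<le> 0"
      by (intro AE_I2) (auto simp: W_def indicator_def subset_iff dest: less_imp_le)
    from mollifier.convol_norm_diff_le[OF m W this] show "convol \<eta> W x = 1" by simp
  qed
qed

lemma integrable_lebesgue_on_shrink:
  fixes f :: "'a::euclidean_space \<Rightarrow> real"
  assumes K: "compact K" "compact K'" "K \<subseteq> K'" and f: "integrable (lebesgue_on K') f"
    and z: "AE x in lebesgue. x \<in> K' - K \<longrightarrow> f x = 0"
  shows "integrable (lebesgue_on K) f" "(\<integral>x. f x \<partial>lebesgue_on K') = (\<integral>x. f x \<partial>lebesgue_on K)"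
proof -
  have f': "integrable lebesgue (\<lambda>x. indicator K' x * f x)" using f K(2) by (simp add: integrable_restrict_space)
  have m: "(\<lambda>x. indicator K x * (indicator K' x * f x)) \<in> borel_measurable lebesgue"
    by (rule borel_measurable_times[OF borel_measurable_indicator borel_measurable_integrable[OF f']]) (use K(1) in simp)
  have e: "indicator K x * (indicator K' x * f x) = indicator K x * f x" for x using K by (auto simp: indicator_def)
  have ae: "AE x in lebesgue. indicator K' x * f x = indicator K x * f x"
    using z by eventually_elim (use K(3) in \<open>auto simp: indicator_def\<close>)
  have "integrable lebesgue (\<lambda>x. indicator K x * f x)"
    using f' integrable_cong_AE[OF _ _ ae] m unfolding e by auto
  then show "integrable (lebesgue_on K) f" using K(1) by (simp add: integrable_restrict_space)
  show "(\<integral>x. f x \<partial>lebesgue_on K') = (\<integral>x. f x \<partial>lebesgue_on K)"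
    using integral_cong_AE[OF _ _ ae] f' m K unfolding e by (auto simp: integral_restrict_space)
qed

lemma borel_measurable_vec_lambda_components:
  fixes f :: "'a \<Rightarrow> real^'n"
  assumes "\<And>i. (\<lambda>x. f x $ i) \<in> borel_measurable M"
  shows "f \<in> borel_measurable M"
  unfolding borel_measurable_euclidean_space[where f=f]
  using assms by (auto simp: Basis_vec_def inner_axis)

lemma measurable_lebesgue_on_subset:
  "f \<in> borel_measurable (lebesgue_on \<Omega>) \<Longrightarrow> K \<subseteq> \<Omega> \<Longrightarrow> f \<in> borel_measurable (lebesgue_on K)"
  by (rule measurable_restrict_mono)

lemma continuous_borel_measurable_lebesgue_on:
  fixes f :: "'a::euclidean_space \<Rightarrow> 'b::euclidean_space"
  assumes "continuous_on UNIV f"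
  shows "f \<in> borel_measurable (lebesgue_on K)"
  by (intro measurable_restrict_space1 measurable_completion) 
     (simp add: borel_measurable_continuous_onI[OF assms])

lemma integrable_lebesgue_on_lborel:
  fixes g :: "'a::euclidean_space \<Rightarrow> real"
  assumes "integrable lborel g" "compact K"
  shows "integrable (lebesgue_on K) g"
proof -
  have "integrable lebesgue g" using assms(1) integrable_completion[of g lborel] by auto
  then have "integrable lebesgue (\<lambda>x. g x * indicator K x)" using assms(2) by (intro integrable_real_mult_indicator) auto
  then show ?thesis using assms(2) by (simp add: integrable_restrict_space mult.commute)
qed

lemma integral_lebesgue_on_le_lborel:
  fixes g :: "'a::euclidean_space \<Rightarrow> real"
  assumes g: "integrable lborel g" "\<And>x. 0 \<le> g x" and K: "compact K"
  shows "(\<integral>x. g x \<partial>lebesgue_on K) \<le> (\<integral>x. g x \<partial>lborel)"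
proof -
  have gl: "integrable lebesgue g" using g(1) integrable_completion[of g lborel] by auto
  have "(\<integral>x. g x \<partial>lebesgue_on K) = (\<integral>x. indicator K x * g x \<partial>lebesgue)"
    using K by (simp add: integral_restrict_space)
  also have "\<dots> \<le> (\<integral>x. g x \<partial>lebesgue)"
    using gl K integrable_real_mult_indicator[OF _ gl, of K] g(2)
    by (intro integral_mono) (auto simp: mult.commute indicator_def)
  also have "\<dots> = (\<integral>x. g x \<partial>lborel)" using g(1) by (intro integral_completion) auto
  finally show ?thesis .
qed

text \<open>The case split decides which of the two summands alone dominates the product.\<close>

lemma young_powr:
  fixes s d p :: real
  assumes p: "1 < p" and s: "0 \<le> s" and d: "0 \<le> d"
  shows "s * d \<le> s powr (p / (p - 1)) + d powr p"
proof (cases "s \<le> d powr (p - 1)")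
  case True
  have "s * d \<le> d powr (p - 1) * d" using True d by (rule mult_right_mono)
  also have "\<dots> = d powr p" using d p by (cases "d = 0") (auto simp: powr_diff)
  finally show ?thesis by (simp add: add_increasing)
next
  case False
  then have s0: "s > 0" using powr_ge_zero[of d "p - 1"] by linarith
  have "d = (d powr (p - 1)) powr (1 / (p - 1))" using d p by (simp add: powr_powr)
  also have "\<dots> \<le> s powr (1 / (p - 1))" using False p by (intro powr_mono2) auto
  finally have "s * d \<le> s powr 1 * s powr (1 / (p - 1))" using s0 by simp
  also have "\<dots> = s powr (p / (p - 1))" 
  proof -
    have "1 + 1 / (p - 1) = p / (p - 1)" using p by (simp add: field_simps)
    then show ?thesis by (metis powr_add)
  qed
  finally show ?thesis by (simp add: add_increasing2)
qed

lemma powr_le_one_add_powr: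
  fixes d s r :: real
  assumes "0 \<le> d" "0 \<le> s" "s \<le> r"
  shows "d powr s \<le> 1 + d powr r"
proof (cases "d \<le> 1")
  case True
  then have "d powr s \<le> 1" using assms by (intro powr_le1) auto
  then show ?thesis by (simp add: add_increasing2)
next
  case False
  then have "d powr s \<le> d powr r" using assms by (intro powr_mono) auto
  then show ?thesis by simp
qed

lemma finite_measure_lebesgue_on_compact: "compact K \<Longrightarrow> finite_measure (lebesgue_on K)" for K :: "'a::euclidean_space set"
  by (rule finite_measure_lebesgue_on) (rule lmeasurable_compact)

lemma weak_grad_borel_measurable:
  fixes G :: "real^'n \<Rightarrow> real^'n"
  assumes "weak_grad \<Omega> u G"
  shows "u \<in> borel_measurable (lebesgue_on \<Omega>)" "G \<in> borel_measurable (lebesgue_on \<Omega>)"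
  using assms by (auto simp: weak_grad_def locLp_def intro!: borel_measurable_vec_lambda_components)

lemma borel_set_rep:
  assumes A: "A \<in> sets lebesgue" "emeasure lebesgue A < \<infinity>"
  obtains A' where "A' \<in> sets borel" "AE x in lebesgue. x \<in> A' \<longleftrightarrow> x \<in> A"
    "emeasure lborel A' < \<infinity>" "measure lborel A' = measure lebesgue A"
proof -
  have "integrable lebesgue (indicator A :: 'a::euclidean_space \<Rightarrow> real)" using A by simp
  from borel_rep_real[OF this] obtain W :: "'a \<Rightarrow> real" where W: "integrable lborel W" "AE x in lebesgue. W x = indicator A x" by auto
  define A' where "A' = W -` {1}"
  have A'm: "A' \<in> sets borel" unfolding A'_def using W(1) measurable_sets[of W borel borel "{1}"] by simp
  have ae: "AE x in lebesgue. x \<in> A' \<longleftrightarrow> x \<in> A"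
    using W(2) by eventually_elim (auto simp: A'_def indicator_def split: if_splits)
  have "emeasure lborel A' = emeasure lebesgue A'" using A'm by simp
  also have "\<dots> = emeasure lebesgue A" using A A'm ae by (intro emeasure_eq_AE) auto
  finally have "emeasure lborel A' = emeasure lebesgue A" .
  then show ?thesis using that[OF A'm ae] A(2) by (simp add: measure_def)
qed

text \<open>The truncated powers \<open>z\<^sup>2\<close> and \<open>z powr (r + 1)\<close> are the
  two instances. As \<open>h\<close> vanishes up to \<open>k\<close> and w is at most
  \<open>c\<close>, hence at most \<open>k\<close>, off \<open>K\<close>, the composition lives on
  \<open>K\<close>. One bound \<open>B\<close> for \<open>h\<close> and \<open>h'\<close> below
  \<open>S\<close> suffices because mollification keeps w below \<open>S\<close>.\<close>

locale weak_grad_composition =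
  fixes \<Omega> K :: "(real^'n) set" and w :: "real^'n \<Rightarrow> real" and G :: "real^'n \<Rightarrow> real^'n" and c S p :: real
    and h h' :: "real \<Rightarrow> real" and k B :: real
  assumes \<Omega>: "open \<Omega>" and wg: "weak_grad \<Omega> w G" and K: "compact K" "K \<subseteq> \<Omega>"
    and c: "AE x in lebesgue. x \<in> \<Omega> - K \<longrightarrow> w x \<le> c" "0 \<le> c"
    and S: "AE x in lebesgue. x \<in> \<Omega> \<longrightarrow> w x \<le> S" "0 \<le> S"
    and p: "1 \<le> p" "locLp \<Omega> p (\<lambda>x. norm (G x))"
    and h: "\<And>t. (h has_real_derivative h' t) (at t)" "continuous_on UNIV h'"
      "\<And>t. t \<le> k \<Longrightarrow> h t = 0" "\<And>t. t \<le> k \<Longrightarrow> h' t = 0" "\<And>t. 0 \<le> h t" "\<And>t. 0 \<le> h' t"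
      "\<And>t. t \<le> S \<Longrightarrow> h t \<le> B" "\<And>t. t \<le> S \<Longrightarrow> h' t \<le> B"
    and k: "c \<le> k"
begin

lemma h_continuous: "continuous_on UNIV h"
  using h(1) by (intro continuous_at_imp_continuous_on ballI) (rule DERIV_isCont)

lemma borel_measurable_h [measurable]: "h \<in> borel_measurable borel" "h' \<in> borel_measurable borel"
  using h_continuous h(2) by (auto intro: borel_measurable_continuous_onI)

text \<open>The approximants are \<open>h\<close> applied to mollifications of w. Off
  \<open>K'\<close> these average values at most \<open>c\<close>, so \<open>h\<close> and
  \<open>h'\<close> vanish there. By Jensen the p-th power of their gradient is bounded by a
  mollification of |G|^p: a majorant that varies with n but converges in L^1. For locally bounded
  \<open>G\<close> a uniform bound is available in addition.\<close>

lemma composition_approx: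
  obtains K' \<psi> E gn g where "compact K'" "K' \<subseteq> \<Omega>" "K \<subseteq> K'"
    "\<And>n x. (\<psi> n has_derivative (\<lambda>v. E n x \<bullet> v)) (at x)" "\<And>n. continuous_on UNIV (E n)"
    "\<And>n x. x \<notin> K' \<Longrightarrow> \<psi> n x = 0 \<and> E n x = 0" "\<And>n x. 0 \<le> \<psi> n x \<and> \<psi> n x \<le> B"
    "AE x in lebesgue_on K'. (\<lambda>n. \<psi> n x) \<longlonglongrightarrow> h (w x)"
    "AE x in lebesgue_on K'. (\<lambda>n. E n x) \<longlonglongrightarrow> h' (w x) *\<^sub>R G x"
    "\<And>n x. x \<in> K' \<Longrightarrow> norm (E n x) powr p \<le> gn n x"
    "AE x in lebesgue_on K'. norm (h' (w x) *\<^sub>R G x) powr p \<le> g x"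
    "\<And>n. integrable (lebesgue_on K') (gn n)" "integrable (lebesgue_on K') g"
    "(\<lambda>n. \<integral>x. \<bar>gn n x - g x\<bar> \<partial>lebesgue_on K') \<longlonglongrightarrow> 0"
    "locLinf \<Omega> (\<lambda>x. norm (G x)) \<Longrightarrow> \<exists>M. \<forall>n. \<forall>x\<in>K'. norm (E n x) \<le> M"
proof -
  obtain e K' K'' where e: "0 < e" "compact K'" "compact K''" "K \<subseteq> K'" "K' \<subseteq> K''" "K'' \<subseteq> \<Omega>"
    "\<And>x. x \<in> K' \<Longrightarrow> cball x e \<subseteq> K''" "\<And>x. x \<notin> K' \<Longrightarrow> cball x e \<inter> K = {}"
    by (rule compact_nested_neighbourhoods[OF K \<Omega>]) blast
  obtain W V where W: "integrable lborel W" "AE y in lebesgue. W y = indicator K'' y * w y"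
    and V: "integrable lborel V" "AE y in lebesgue. V y = indicator K'' y *\<^sub>R G y"
    by (rule weak_grad_borel_rep[OF wg e(3,6)]) (rule that; assumption)
  have [measurable]: "W \<in> borel_measurable borel" "V \<in> borel_measurable borel" using W V by auto
  obtain \<eta> :: "nat \<Rightarrow> real^'n \<Rightarrow> real" and D \<epsilon> C
    where m: "\<And>n. mollifier (\<eta> n) (D n) (\<epsilon> n) (C n)" "\<And>n. \<epsilon> n \<le> e" "\<epsilon> \<longlonglongrightarrow> 0"
    by (rule mollifier_sequence[OF e(1)]) blast
  note ci = mollifier.integrable_convol(1)[OF m(1)]
  have AEM: "(AE x in lebesgue_on K'. P x) \<longleftrightarrow> (AE x in lebesgue. x \<in> K' \<longrightarrow> P x)" for P
    by (rule AE_restrict_space_iff) (use e(2) in simp)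
  \<comment> \<open>Adding the errors of function and gradient lets a single subsequence converge
    almost everywhere for both.\<close>
  define q where "q n x = norm (convol (\<eta> n) W x - W x) + norm (convol (\<eta> n) V x - V x)" for n x
  have qi: "integrable lborel (q n)" for n
    unfolding q_def using ci[OF W(1)] ci[OF V(1)] W(1) V(1) by (intro Bochner_Integration.integrable_add) auto
  have "(\<integral>x. norm (q n x) \<partial>lborel) =
     (\<integral>x. norm (convol (\<eta> n) W x - W x) \<partial>lborel) + (\<integral>x. norm (convol (\<eta> n) V x - V x) \<partial>lborel)" for n
  proof -
    have "norm (q n x) = q n x" for x by (simp add: q_def)
    then show ?thesis
      unfolding q_def using ci[OF W(1)] ci[OF V(1)] W(1) V(1) by (simp add: Bochner_Integration.integral_add)
  qed
  then have q0: "(\<lambda>n. \<integral>x. norm (q n x) \<partial>lborel) \<longlonglongrightarrow> 0"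
    using tendsto_add[OF convol_tendsto_L1[OF W(1) m(1,3)] convol_tendsto_L1[OF V(1) m(1,3)]] by simp
  obtain r where r: "strict_mono r" "AE x in lborel. (\<lambda>n. q (r n) x) \<longlonglongrightarrow> 0"
    using tendsto_L1_AE_subseq[of lborel q, OF qi q0] by blast
  have rl: "AE x in lebesgue. (\<lambda>n. q (r n) x) \<longlonglongrightarrow> 0" using r(2) by (simp add: AE_completion_iff)
  define Wn where "Wn n = convol (\<eta> (r n)) W" for n
  define Dn where "Dn n x = (\<integral>y. W y *\<^sub>R D (r n) (x - y) \<partial>lborel)" for n x
  have Dn: "Dn n x = convol (\<eta> (r n)) V x" if "x \<in> K'" for n x
  proof -
    have "cball x (\<epsilon> (r n)) \<subseteq> K''" using e(7)[OF that] m(2)[of "r n"] by (meson order_trans subset_cball)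
    then show ?thesis unfolding Dn_def by (rule weak_grad_convol[OF wg \<Omega> m(1) _ e(6) W V])
  qed
  have lim: "AE x in lebesgue_on K'. (\<lambda>n. Wn n x) \<longlonglongrightarrow> w x \<and> (\<lambda>n. Dn n x) \<longlonglongrightarrow> G x"
    unfolding AEM using rl W(2) V(2)
  proof eventually_elim
    case (elim x)
    have "(\<lambda>n. convol (\<eta> (r n)) W x) \<longlonglongrightarrow> W x" "(\<lambda>n. convol (\<eta> (r n)) V x) \<longlonglongrightarrow> V x"
      by (rule Lim_null[THEN iffD2], rule Lim_null_comparison[OF _ elim(1)], simp add: q_def)+
    then show ?case using elim(2,3) e(5) by (auto simp: Dn Wn_def indicator_def split: if_splits)
  qed
  have Wd: "(Wn n has_derivative (\<lambda>v. Dn n x \<bullet> v)) (at x)" for n x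
    unfolding Wn_def Dn_def by (rule mollifier.convol_has_derivative[OF m(1) W(1)])
  have Dc: "continuous_on UNIV (Dn n)" for n
    unfolding Dn_def by (rule mollifier.continuous_on_convol_grad[OF m(1) W(1)])
  have Wc: "continuous_on UNIV (Wn n)" for n
    by (rule continuous_at_imp_continuous_on) (auto intro: has_derivative_continuous[OF Wd])
  \<comment> \<open>Extending w by zero outside \<open>K''\<close> preserves both upper bounds
    because \<open>c\<close> and \<open>S\<close> are non-negative.\<close>
  have "AE y in lebesgue. y \<notin> K \<longrightarrow> W y \<le> c" "AE y in lebesgue. W y \<le> S"
    using W(2) c(1) S(1) by (eventually_elim, use e(6) c(2) S(2) in \<open>auto simp: indicator_def\<close>)+
  then have Wb: "AE y in lborel. y \<notin> K \<longrightarrow> W y \<le> c" "AE y in lborel. W y \<le> S"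
    by (simp_all add: AE_completion_iff)
  have WS: "Wn n x \<le> S" for n x
    unfolding Wn_def by (rule mollifier.convol_le[OF m(1) W(1)]) (use Wb(2) in auto)
  have Wk: "Wn n x \<le> k" if x: "x \<notin> K'" for n x
  proof -
    have "ball x (\<epsilon> (r n)) \<inter> K = {}" using e(8)[OF x] m(2)[of "r n"] by (fastforce simp: disjoint_iff)
    then have "AE y in lborel. y \<in> ball x (\<epsilon> (r n)) \<longrightarrow> W y \<le> c" using Wb(1) by (auto elim!: eventually_mono)
    from mollifier.convol_le[OF m(1) W(1) this] show ?thesis using k by (simp add: Wn_def)
  qed
  define g where "g x = norm (V x) powr p" for x
  have gi: "integrable lborel g"
  proof -
    have "integrable (lebesgue_on K'') (\<lambda>x. norm (G x) powr p)" using p(2) e(3,6) by (auto simp: locLp_def)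
    then have I: "integrable lebesgue (\<lambda>x. indicator K'' x * norm (G x) powr p)"
      using e(3) by (simp add: integrable_restrict_space)
    have gm: "g \<in> borel_measurable borel" unfolding g_def by measurable
    have "AE x in lebesgue. g x = indicator K'' x * norm (G x) powr p"
      using V(2) by eventually_elim (auto simp: g_def indicator_def)
    then have "integrable lebesgue g"
      using I gm by (subst integrable_cong_AE[where g="\<lambda>x. indicator K'' x * norm (G x) powr p"])
         (auto intro!: measurable_completion)
    then show ?thesis using integrable_completion[of g lborel] gm by simp
  qed
  define gn where "gn n = convol (\<eta> (r n)) g" for n
  have gni: "integrable lborel (gn n)" for n unfolding gn_def by (rule ci[OF gi])
  have L1: "(\<lambda>n. \<integral>x. \<bar>gn n x - g x\<bar> \<partial>lborel) \<longlonglongrightarrow> 0"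
    using LIMSEQ_subseq_LIMSEQ[OF convol_tendsto_L1[OF gi m(1,3)] r(1)] by (simp add: gn_def o_def)
  have L1': "(\<lambda>n. \<integral>x. \<bar>gn n x - g x\<bar> \<partial>lebesgue_on K') \<longlonglongrightarrow> 0"
  proof (rule tendsto_sandwich[OF _ _ tendsto_const L1])
    show "\<forall>\<^sub>F n in sequentially. (\<integral>x. \<bar>gn n x - g x\<bar> \<partial>lebesgue_on K') \<le> (\<integral>x. \<bar>gn n x - g x\<bar> \<partial>lborel)"
      using gi gni e(2) by (intro always_eventually allI integral_lebesgue_on_le_lborel) auto
  qed simp
  have pw: "norm (h' t *\<^sub>R d) powr p \<le> B powr p * b" if "t \<le> S" "norm d powr p \<le> b" for t b and d :: "real^'n"
  proof -
    have "norm (h' t *\<^sub>R d) powr p = h' t powr p * norm d powr p" using h(6)[of t] by (simp add: powr_mult)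
    also have "\<dots> \<le> B powr p * b" using that h(6)[of t] h(8)[of t] p(1) by (intro mult_mono powr_mono2) auto
    finally show ?thesis .
  qed
  have isC: "isCont h t" "isCont h' t" for t
    using h_continuous h(2) by (auto simp: continuous_on_eq_continuous_at)
  show ?thesis
  proof (rule that[of K' "\<lambda>n x. h (Wn n x)" "\<lambda>n x. h' (Wn n x) *\<^sub>R Dn n x" "\<lambda>n x. B powr p * gn n x" "\<lambda>x. B powr p * g x"])
    show "((\<lambda>x. h (Wn n x)) has_derivative (\<lambda>v. (h' (Wn n x) *\<^sub>R Dn n x) \<bullet> v)) (at x)" for n x
      using has_derivative_compose[OF Wd[of n x] h(1)[unfolded has_field_derivative_def]] by (simp add: o_def)
    show "continuous_on UNIV (\<lambda>x. h' (Wn n x) *\<^sub>R Dn n x)" for n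
      by (intro continuous_intros continuous_on_compose2[OF h(2) Wc] Dc) auto
    show "AE x in lebesgue_on K'. (\<lambda>n. h (Wn n x)) \<longlonglongrightarrow> h (w x)"
      using lim by eventually_elim (auto intro: isCont_tendsto_compose[OF isC(1)])
    show "AE x in lebesgue_on K'. (\<lambda>n. h' (Wn n x) *\<^sub>R Dn n x) \<longlonglongrightarrow> h' (w x) *\<^sub>R G x"
      using lim by eventually_elim (auto intro!: tendsto_intros isCont_tendsto_compose[OF isC(2)])
    show "norm (h' (Wn n x) *\<^sub>R Dn n x) powr p \<le> B powr p * gn n x" if "x \<in> K'" for n x
      unfolding gn_def Dn[OF that] g_def
      by (rule pw[OF WS mollifier.convol_powr_le[OF m(1) V(1) gi[unfolded g_def] p(1)]])
    show "AE x in lebesgue_on K'. norm (h' (w x) *\<^sub>R G x) powr p \<le> B powr p * g x"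
      unfolding AEM using V(2) S(1)
    proof eventually_elim
      case (elim x)
      show ?case
      proof
        assume "x \<in> K'"
        then have "w x \<le> S" "V x = G x" using elim e(5,6) by (auto simp: indicator_def)
        then show "norm (h' (w x) *\<^sub>R G x) powr p \<le> B powr p * g x" by (intro pw) (simp_all add: g_def)
      qed
    qed
    show "(\<lambda>n. \<integral>x. \<bar>B powr p * gn n x - B powr p * g x\<bar> \<partial>lebesgue_on K') \<longlonglongrightarrow> 0"
      using tendsto_mult_right_zero[OF L1', of "B powr p"] by (simp add: abs_mult flip: right_diff_distrib)
    show "integrable (lebesgue_on K') (\<lambda>x. B powr p * gn n x)" "integrable (lebesgue_on K') (\<lambda>x. B powr p * g x)" for n
      using gi gni e(2) by (auto intro!: integrable_mult_right integrable_lebesgue_on_lborel)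
    show "\<exists>M. \<forall>n. \<forall>x\<in>K'. norm (h' (Wn n x) *\<^sub>R Dn n x) \<le> M" if bd: "locLinf \<Omega> (\<lambda>x. norm (G x))"
    proof -
      obtain M where "AE x in lebesgue_on K''. \<bar>norm (G x)\<bar> \<le> M"
        using bd e(3,6) unfolding locLinf_def by blast
      then have "AE x in lebesgue. x \<in> K'' \<longrightarrow> norm (G x) \<le> M" using e(3) by (simp add: AE_restrict_space_iff)
      then have "AE x in lebesgue. norm (V x) \<le> \<bar>M\<bar>"
        using V(2) by eventually_elim (auto simp: indicator_def)
      then have M: "AE x in lborel. norm (V x) \<le> \<bar>M\<bar>" by (simp add: AE_completion_iff)
      have "norm (convol (\<eta> n) V x - 0) \<le> \<bar>M\<bar>" for n x
        by (rule mollifier.convol_norm_diff_le[OF m(1) V(1)]) (use M in auto)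
      then have "norm (h' (Wn n x) *\<^sub>R Dn n x) \<le> B * \<bar>M\<bar>" if "x \<in> K'" for n x
        using h(6)[of "Wn n x"] h(8)[OF WS[of n x]] by (auto simp: Dn[OF that] intro!: mult_mono)
      then show ?thesis by blast
    qed
  qed (use e Wk WS h L1' in auto)
qed

lemma borel_measurable_w_G:
  assumes "K' \<subseteq> \<Omega>"
  shows "w \<in> borel_measurable (lebesgue_on K')" "G \<in> borel_measurable (lebesgue_on K')"
  using measurable_lebesgue_on_subset[OF _ assms] weak_grad_borel_measurable[OF wg] by blast+

lemma AE_zero_outside:
  assumes "K' \<subseteq> \<Omega>"
  shows "AE x in lebesgue. x \<in> K' - K \<longrightarrow> h (w x) = 0 \<and> h' (w x) = 0"
  using c(1) by eventually_elim (use h(3,4) assms k in auto)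

text \<open>The limit on the left uses one of two majorants, matching the two integrability settings
  of the theorem: a Young bound for the flux \<open>F\<close> with the varying L^1-convergent
  majorants, or an integrable flux against uniformly bounded gradients. On the right the
  approximants are bounded by \<open>B\<close>.\<close>

lemma tested_inequality:
  assumes F: "F \<in> borel_measurable (lebesgue_on \<Omega>)"
    and Q: "\<And>\<phi>. test_fun \<Omega> \<phi> \<Longrightarrow> (\<And>x. 0 \<le> \<phi> x) \<Longrightarrow>
      integrable (lebesgue_on \<Omega>) (\<lambda>x. R x * \<phi> x) \<and>
      (\<integral>x. F x \<bullet> grad \<phi> x \<partial>lebesgue_on \<Omega>) \<le> (\<integral>x. R x * \<phi> x \<partial>lebesgue_on \<Omega>)"
    and dom: "(\<exists>H. locLp \<Omega> 1 H \<and> (\<forall>x\<in>\<Omega>. \<forall>d\<ge>0. norm (F x) * d \<le> H x + 2 * d powr p)) \<or>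
      (locLp \<Omega> 1 (\<lambda>x. norm (F x)) \<and> locLinf \<Omega> (\<lambda>x. norm (G x)))"
  shows "integrable (lebesgue_on K) (\<lambda>x. (F x \<bullet> G x) * h' (w x))"
    and "integrable (lebesgue_on K) (\<lambda>x. R x * h (w x))"
    and "(\<integral>x. (F x \<bullet> G x) * h' (w x) \<partial>lebesgue_on K) \<le> (\<integral>x. R x * h (w x) \<partial>lebesgue_on K)"
proof -
  obtain K' \<psi> E gn g where K': "compact K'" "K' \<subseteq> \<Omega>" "K \<subseteq> K'"
    and \<psi>: "\<And>n x. (\<psi> n has_derivative (\<lambda>v. E n x \<bullet> v)) (at x)" "\<And>n. continuous_on UNIV (E n)"
      "\<And>n x. x \<notin> K' \<Longrightarrow> \<psi> n x = 0 \<and> E n x = 0" "\<And>n x. 0 \<le> \<psi> n x \<and> \<psi> n x \<le> B"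
      "AE x in lebesgue_on K'. (\<lambda>n. \<psi> n x) \<longlonglongrightarrow> h (w x)"
    and E: "AE x in lebesgue_on K'. (\<lambda>n. E n x) \<longlonglongrightarrow> h' (w x) *\<^sub>R G x"
    and gn: "\<And>n x. x \<in> K' \<Longrightarrow> norm (E n x) powr p \<le> gn n x"
      "AE x in lebesgue_on K'. norm (h' (w x) *\<^sub>R G x) powr p \<le> g x"
    and gi: "\<And>n. integrable (lebesgue_on K') (gn n)" "integrable (lebesgue_on K') g"
      "(\<lambda>n. \<integral>x. \<bar>gn n x - g x\<bar> \<partial>lebesgue_on K') \<longlonglongrightarrow> 0"
    and Eb: "locLinf \<Omega> (\<lambda>x. norm (G x)) \<Longrightarrow> \<exists>M. \<forall>n. \<forall>x\<in>K'. norm (E n x) \<le> M"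
    by (rule composition_approx) (rule that; assumption)
  let ?M = "lebesgue_on K'"
  have K'l[simp]: "K' \<in> sets lebesgue" using K' by simp
  have sp: "space ?M = K'" by simp
  note [measurable] = borel_measurable_w_G[OF K'(2)] measurable_lebesgue_on_subset[OF F K'(2)]
  have \<psi>c: "continuous_on UNIV (\<psi> n)" for n
    by (rule continuous_at_imp_continuous_on) (auto intro: has_derivative_continuous[OF \<psi>(1)])
  have [measurable]: "\<psi> n \<in> borel_measurable ?M" "E n \<in> borel_measurable ?M" for n
    using \<psi>c \<psi>(2) continuous_borel_measurable_lebesgue_on by blast+
  define l where "l x = F x \<bullet> (h' (w x) *\<^sub>R G x)" for x
  have Lm: "(\<lambda>x. F x \<bullet> E n x) \<in> borel_measurable ?M" for n by measurable
  have lm: "l \<in> borel_measurable ?M" unfolding l_def by measurable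
  have Llim: "AE x in ?M. (\<lambda>n. F x \<bullet> E n x) \<longlonglongrightarrow> l x"
    unfolding l_def using E by eventually_elim (rule tendsto_inner[OF tendsto_const])
  have Lconv: "integrable ?M l \<and> (\<lambda>n. \<integral>x. F x \<bullet> E n x \<partial>?M) \<longlonglongrightarrow> (\<integral>x. l x \<partial>?M)"
    using dom
  proof
    assume "\<exists>H. locLp \<Omega> 1 H \<and> (\<forall>x\<in>\<Omega>. \<forall>d\<ge>0. norm (F x) * d \<le> H x + 2 * d powr p)"
    then obtain H where H: "locLp \<Omega> 1 H" "\<And>x d. x \<in> \<Omega> \<Longrightarrow> 0 \<le> d \<Longrightarrow> norm (F x) * d \<le> H x + 2 * d powr p" by blast
    have Hi: "integrable ?M H" using locLp_1_integrable[OF H(1) K'(1,2)] by simp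
    have le: "\<bar>F x \<bullet> v\<bar> \<le> H x + 2 * b" if "x \<in> K'" "norm v powr p \<le> b" for x v b
      using Cauchy_Schwarz_ineq2[of "F x" v] H(2)[of x "norm v"] that K'(2) by force
    have 1: "integrable ?M (\<lambda>x. H x + 2 * gn n x)" "integrable ?M (\<lambda>x. H x + 2 * g x)" for n using Hi gi by auto
    have 2: "AE x in ?M. \<bar>F x \<bullet> E n x\<bar> \<le> H x + 2 * gn n x" for n by (rule AE_I2) (simp add: le gn)
    have 3: "AE x in ?M. \<bar>l x\<bar> \<le> H x + 2 * g x"
      using gn(2) AE_space unfolding l_def by eventually_elim (rule le, simp_all only: sp)
    have 4: "(\<lambda>n. \<integral>x. \<bar>(H x + 2 * gn n x) - (H x + 2 * g x)\<bar> \<partial>?M) \<longlonglongrightarrow> 0"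
    proof -
      have "\<bar>(H x + 2 * gn n x) - (H x + 2 * g x)\<bar> = 2 * \<bar>gn n x - g x\<bar>" for n x by (simp add: abs_if)
      then show ?thesis using tendsto_mult_right_zero[OF gi(3), of 2] by simp
    qed
    show ?thesis using integral_dominated_convergence_varying[OF lm Lm 1 Llim 2 3 4] by blast
  next
    assume a: "locLp \<Omega> 1 (\<lambda>x. norm (F x)) \<and> locLinf \<Omega> (\<lambda>x. norm (G x))"
    then obtain M where M: "\<And>n x. x \<in> K' \<Longrightarrow> norm (E n x) \<le> M" using Eb by blast
    have i: "integrable ?M (\<lambda>x. norm (F x) * M)" using a locLp_1_integrable[OF _ K'(1,2)] by auto
    have b: "AE x in ?M. norm (F x \<bullet> E n x) \<le> norm (F x) * M" for n
      using M by (intro AE_I2) (auto intro!: order_trans[OF Cauchy_Schwarz_ineq2] mult_left_mono)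
    show ?thesis
      using integral_dominated_convergence[OF lm Lm i Llim b] integrable_dominated_convergence[OF lm Lm i Llim b] by blast
  qed
  \<comment> \<open>Only products of \<open>R\<close> with test functions are known to be
    integrable; a test function equal to 1 on \<open>K'\<close> yields integrability of
    \<open>R\<close> itself there.\<close>
  obtain \<kappa> where \<kappa>: "test_fun \<Omega> \<kappa>" "\<And>x. 0 \<le> \<kappa> x" "\<And>x. x \<in> K' \<Longrightarrow> \<kappa> x = 1"
    by (rule cutoff_exists[OF \<Omega> K'(1,2)]) (rule that; assumption)
  have Ri: "integrable ?M R"
  proof -
    have "integrable (lebesgue_on \<Omega>) (\<lambda>x. R x * \<kappa> x)" using Q[OF \<kappa>(1,2)] by blast
    then have "integrable lebesgue (\<lambda>x. (indicator \<Omega> x * (R x * \<kappa> x)) * indicator K' x)"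
      using \<Omega> by (intro integrable_real_mult_indicator) (simp_all add: integrable_restrict_space)
    moreover have "(indicator \<Omega> x * (R x * \<kappa> x)) * indicator K' x = indicator K' x * R x" for x
      using \<kappa>(3)[of x] K'(2) by (auto simp: indicator_def)
    ultimately show ?thesis by (simp add: integrable_restrict_space)
  qed
  have [measurable]: "R \<in> borel_measurable ?M" using Ri by auto
  have Rlim: "AE x in ?M. (\<lambda>n. R x * \<psi> n x) \<longlonglongrightarrow> R x * h (w x)"
    using \<psi>(5) by eventually_elim (auto intro!: tendsto_intros)
  have Rb: "AE x in ?M. norm (R x * \<psi> n x) \<le> B * norm (R x)" for n
    using \<psi>(4) by (intro AE_I2) (simp add: abs_mult mult.commute[of "\<bar>R _\<bar>"] mult_right_mono)
  have Rm: "(\<lambda>x. R x * h (w x)) \<in> borel_measurable ?M" "(\<lambda>x. R x * \<psi> n x) \<in> borel_measurable ?M" for n by measurable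
  have Rc: "integrable ?M (\<lambda>x. R x * h (w x))" "(\<lambda>n. \<integral>x. R x * \<psi> n x \<partial>?M) \<longlonglongrightarrow> (\<integral>x. R x * h (w x) \<partial>?M)"
    using integral_dominated_convergence[OF Rm _ Rlim Rb] integrable_dominated_convergence[OF Rm _ Rlim Rb] Ri by auto
  have ineq: "(\<integral>x. F x \<bullet> E n x \<partial>?M) \<le> (\<integral>x. R x * \<psi> n x \<partial>?M)" for n
  proof -
    have eq: "(\<integral>x. U x \<partial>lebesgue_on \<Omega>) = (\<integral>x. U x \<partial>?M)" if "\<And>x. x \<notin> K' \<Longrightarrow> U x = 0" for U :: "real^'n \<Rightarrow> real"
    proof -
      have "(\<integral>x. U x \<partial>lebesgue_on \<Omega>) = (\<integral>x. indicator \<Omega> x * U x \<partial>lebesgue)"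
        using \<Omega> by (simp add: integral_restrict_space)
      also have "\<dots> = (\<integral>x. indicator K' x * U x \<partial>lebesgue)"
        by (rule Bochner_Integration.integral_cong) (use that K'(2) in \<open>auto simp: indicator_def\<close>)
      finally show ?thesis by (simp add: integral_restrict_space)
    qed
    have t: "test_fun \<Omega> (\<psi> n)" by (rule test_funI[OF \<psi>(1,2) K'(1,2)]) (use \<psi>(3) in auto)
    have "grad (\<psi> n) x = E n x" for x by (rule partial_deriv_eq(2)[OF \<psi>(1)])
    then show ?thesis using Q[OF t] \<psi>(3,4) by (simp add: eq)
  qed
  have lim: "(\<integral>x. l x \<partial>?M) \<le> (\<integral>x. R x * h (w x) \<partial>?M)"
    using Lconv Rc(2) ineq by (intro LIMSEQ_le[of "\<lambda>n. \<integral>x. F x \<bullet> E n x \<partial>?M"]) auto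
  have z: "AE x in lebesgue. x \<in> K' - K \<longrightarrow> l x = 0" "AE x in lebesgue. x \<in> K' - K \<longrightarrow> R x * h (w x) = 0"
    using AE_zero_outside[OF K'(2)] by (eventually_elim, auto simp: l_def)+
  note s1 = integrable_lebesgue_on_shrink[OF K(1) K'(1,3) conjunct1[OF Lconv] z(1)]
  note s2 = integrable_lebesgue_on_shrink[OF K(1) K'(1,3) Rc(1) z(2)]
  have l: "l = (\<lambda>x. (F x \<bullet> G x) * h' (w x))" by (simp add: l_def fun_eq_iff mult.commute)
  show "integrable (lebesgue_on K) (\<lambda>x. (F x \<bullet> G x) * h' (w x))" using s1(1) unfolding l .
  show "integrable (lebesgue_on K) (\<lambda>x. R x * h (w x))" by (rule s2(1))
  show "(\<integral>x. (F x \<bullet> G x) * h' (w x) \<partial>lebesgue_on K) \<le> (\<integral>x. R x * h (w x) \<partial>lebesgue_on K)"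
    using lim[unfolded s1(2) s2(2)] unfolding l .
qed

text \<open>The approximants need not vanish off {w > k}, so the smooth inequality keeps the
  indicator of this set on its left side. In the limit \<open>h (w x)\<close> does vanish there and
  the indicator disappears.\<close>

lemma faber_krahn_weak_grad:
  assumes \<rho>: "0 \<le> \<rho>"
  shows "measure lborel (ball (0::real^'n) \<rho>) * (\<integral>x. h (w x) \<partial>lebesgue_on K) \<le>
      measure lebesgue {x\<in>K. k < w x} * (\<integral>x. h (w x) \<partial>lebesgue_on K) +
      measure lborel (ball (0::real^'n) \<rho>) * (\<rho> * (\<integral>x. h' (w x) * norm (G x) \<partial>lebesgue_on K))"
proof -
  obtain K' \<psi> E gn g where K': "compact K'" "K' \<subseteq> \<Omega>" "K \<subseteq> K'"
    and \<psi>: "\<And>n x. (\<psi> n has_derivative (\<lambda>v. E n x \<bullet> v)) (at x)" "\<And>n. continuous_on UNIV (E n)"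
      "\<And>n x. x \<notin> K' \<Longrightarrow> \<psi> n x = 0 \<and> E n x = 0" "\<And>n x. 0 \<le> \<psi> n x \<and> \<psi> n x \<le> B"
      "AE x in lebesgue_on K'. (\<lambda>n. \<psi> n x) \<longlonglongrightarrow> h (w x)"
    and E: "AE x in lebesgue_on K'. (\<lambda>n. E n x) \<longlonglongrightarrow> h' (w x) *\<^sub>R G x"
    and gn: "\<And>n x. x \<in> K' \<Longrightarrow> norm (E n x) powr p \<le> gn n x"
      "AE x in lebesgue_on K'. norm (h' (w x) *\<^sub>R G x) powr p \<le> g x"
    and gi: "\<And>n. integrable (lebesgue_on K') (gn n)" "integrable (lebesgue_on K') g"
      "(\<lambda>n. \<integral>x. \<bar>gn n x - g x\<bar> \<partial>lebesgue_on K') \<longlonglongrightarrow> 0"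
    by (rule composition_approx) (rule that; assumption)
  let ?M = "lebesgue_on K'"
  interpret M: finite_measure ?M by (rule finite_measure_lebesgue_on_compact[OF K'(1)])
  have K'l[simp]: "K' \<in> sets lebesgue" using K' by simp
  note [measurable] = borel_measurable_w_G[OF K'(2)]
  have \<psi>c: "continuous_on UNIV (\<psi> n)" for n
    by (rule continuous_at_imp_continuous_on) (auto intro: has_derivative_continuous[OF \<psi>(1)])
  have [measurable]: "\<psi> n \<in> borel_measurable ?M" "E n \<in> borel_measurable ?M" for n
    using \<psi>c \<psi>(2) continuous_borel_measurable_lebesgue_on by blast+
  have \<psi>b: "\<bar>\<psi> n x\<bar> \<le> B" for n x using \<psi>(4)[of n x] by auto
  have B: "0 \<le> B" using \<psi>(4) order_trans by blast
  define A0 where "A0 = {x\<in>K. k < w x}"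
  have A0m: "A0 \<in> sets lebesgue"
  proof -
    have "{x \<in> space (lebesgue_on K). k < w x} \<in> sets (lebesgue_on K)"
      using borel_measurable_w_G(1)[OF K(2)] by measurable
    then show ?thesis using K(1) by (simp add: A0_def sets_restrict_space_iff)
  qed
  have "emeasure lebesgue A0 \<le> emeasure lebesgue K" using A0m K(1) by (intro emeasure_mono) (auto simp: A0_def)
  also have "\<dots> < \<infinity>" using emeasure_compact_finite[OF K(1)] K(1) by (simp add: borel_compact)
  finally have A0f: "emeasure lebesgue A0 < \<infinity>" .
  \<comment> \<open>The smooth inequality is stated for Borel sets, while the superlevel set of w is
    only Lebesgue measurable.\<close>
  obtain A where A: "A \<in> sets borel" "AE x in lebesgue. x \<in> A \<longleftrightarrow> x \<in> A0"
    "emeasure lborel A < \<infinity>" "measure lborel A = measure lebesgue A0"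
    by (rule borel_set_rep[OF A0m A0f]) (rule that; assumption)
  note [measurable] = A(1)
  have [measurable]: "A \<in> sets lebesgue" using A(1) by simp
  have indm[measurable]: "(indicator A :: real^'n \<Rightarrow> real) \<in> borel_measurable ?M"
    using A(1) by (intro measurable_restrict_space1 borel_measurable_indicator) simp
  let ?m = "measure lborel (ball (0::real^'n) \<rho>)"
  have ineq: "?m * (\<integral>x. \<psi> n x * indicator A x \<partial>?M) \<le>
     measure lebesgue A0 * (\<integral>x. \<psi> n x \<partial>?M) + ?m * (\<rho> * (\<integral>x. norm (E n x) \<partial>?M))" for n
  proof -
    have s: "integrable lborel U \<and> (\<integral>x. U x \<partial>lborel) = (\<integral>x. U x \<partial>?M)"
      if U: "U \<in> borel_measurable borel" "\<And>x. x \<notin> K' \<Longrightarrow> U x = 0" "\<And>x. x \<in> K' \<Longrightarrow> \<bar>U x\<bar> \<le> b" for U :: "real^'n \<Rightarrow> real" and b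
    proof
      have "integrable lborel (\<lambda>x. b * indicator K' x :: real)"
        using emeasure_compact_finite[OF K'(1)] K'(1) by (intro integrable_mult_right) (simp add: borel_compact)
      then show "integrable lborel U"
        by (rule Bochner_Integration.integrable_bound) (use U in \<open>auto simp: indicator_def intro: order_trans[OF _ abs_ge_self]\<close>)
      have "(\<integral>x. U x \<partial>?M) = (\<integral>x. indicator K' x * U x \<partial>lebesgue)" by (simp add: integral_restrict_space)
      also have "\<dots> = (\<integral>x. U x \<partial>lebesgue)"
        using U(2) by (intro Bochner_Integration.integral_cong) (auto simp: indicator_def)
      finally show "(\<integral>x. U x \<partial>lborel) = (\<integral>x. U x \<partial>?M)" using U(1) by (simp add: integral_completion)
    qed
    have m: "\<psi> n \<in> borel_measurable borel" "(\<lambda>x. norm (E n x)) \<in> borel_measurable borel"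
      using \<psi>c \<psi>(2) by (auto intro!: borel_measurable_continuous_onI continuous_on_norm)
    have "compact (E n ` K')" by (intro compact_continuous_image continuous_on_subset[OF \<psi>(2)] K'(1)) auto
    then obtain b where b: "\<And>x. x \<in> K' \<Longrightarrow> norm (E n x) \<le> b"
      using compact_imp_bounded bounded_iff by (metis imageI)
    have 1: "integrable lborel (\<psi> n)" "(\<integral>x. \<psi> n x \<partial>lborel) = (\<integral>x. \<psi> n x \<partial>?M)"
      using s[OF m(1) _ \<psi>b] \<psi>(3) by auto
    have 2: "integrable lborel (\<lambda>x. norm (E n x))" "(\<integral>x. norm (E n x) \<partial>lborel) = (\<integral>x. norm (E n x) \<partial>?M)"
      using s[OF m(2), of b] \<psi>(3) b by auto
    have 3: "(\<integral>x. \<psi> n x * indicator A x \<partial>lborel) = (\<integral>x. \<psi> n x * indicator A x \<partial>?M)"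
      using \<psi>b \<psi>(3) m(1) A(1) B by (intro conjunct2[OF s[of _ B]]) (auto simp: indicator_def)
    show ?thesis
      using faber_krahn_C1[OF \<psi>(1,2) _ A(1,3) 1(1) 2(1) \<rho>] \<psi>(4) unfolding 1 2 3 A(4) by blast
  qed
  have \<psi>lim: "(\<lambda>n. \<integral>x. \<psi> n x \<partial>?M) \<longlonglongrightarrow> (\<integral>x. h (w x) \<partial>?M)" "integrable ?M (\<lambda>x. h (w x))"
  proof -
    have b: "AE x in ?M. norm (\<psi> n x) \<le> B" for n using \<psi>b by auto
    have m: "(\<lambda>x. h (w x)) \<in> borel_measurable ?M" "\<psi> n \<in> borel_measurable ?M" for n by measurable
    show "(\<lambda>n. \<integral>x. \<psi> n x \<partial>?M) \<longlonglongrightarrow> (\<integral>x. h (w x) \<partial>?M)" "integrable ?M (\<lambda>x. h (w x))"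
      using integral_dominated_convergence[OF m _ \<psi>(5) b] integrable_dominated_convergence[OF m _ \<psi>(5) b] by auto
  qed
  have Alim: "(\<lambda>n. \<integral>x. \<psi> n x * indicator A x \<partial>?M) \<longlonglongrightarrow> (\<integral>x. h (w x) * indicator A x \<partial>?M)"
  proof (rule integral_dominated_convergence[where w="\<lambda>_. B"])
    show "AE x in ?M. (\<lambda>n. \<psi> n x * indicator A x) \<longlonglongrightarrow> h (w x) * indicator A x"
      using \<psi>(5) by eventually_elim (auto intro!: tendsto_intros)
    show "AE x in ?M. norm (\<psi> n x * indicator A x) \<le> B" for n
      using \<psi>b[of n] B by (intro AE_I2) (auto simp: indicator_def)
  qed (auto intro!: borel_measurable_times indm)
  have Aeq: "(\<integral>x. h (w x) * indicator A x \<partial>?M) = (\<integral>x. h (w x) \<partial>?M)"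
  proof (rule integral_cong_AE)
    have "AE x in lebesgue. x \<in> K' \<longrightarrow> h (w x) * indicator A x = h (w x)"
      using A(2) AE_zero_outside[OF K'(2)]
    proof eventually_elim
      case (elim x)
      then show ?case using h(3)[of "w x"] by (cases "x \<in> K"; cases "k < w x") (auto simp: A0_def)
    qed
    then show "AE x in ?M. h (w x) * indicator A x = h (w x)" by (simp add: AE_restrict_space_iff)
  qed measurable
  have Elim: "integrable ?M (\<lambda>x. h' (w x) * norm (G x)) \<and>
     (\<lambda>n. \<integral>x. norm (E n x) \<partial>?M) \<longlonglongrightarrow> (\<integral>x. h' (w x) * norm (G x) \<partial>?M)"
  proof -
    have nG: "norm (h' t *\<^sub>R v) = h' t * norm v" for t and v :: "real^'n" using h(6) by simp
    have le: "norm v \<le> 1 + b" if "norm v powr p \<le> b" for v :: "real^'n" and b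
      using powr_le_one_add_powr[of "norm v" 1 p] p(1) that by simp
    have 1: "integrable ?M (\<lambda>x. 1 + gn n x)" "integrable ?M (\<lambda>x. 1 + g x)" for n using gi by auto
    have 2: "AE x in ?M. \<bar>norm (E n x)\<bar> \<le> 1 + gn n x" for n by (rule AE_I2) (simp add: le gn)
    have 3: "AE x in ?M. \<bar>h' (w x) * norm (G x)\<bar> \<le> 1 + g x"
      using gn(2) unfolding nG[symmetric] by eventually_elim (simp only: abs_norm_cancel le)
    have 4: "(\<lambda>n. \<integral>x. \<bar>(1 + gn n x) - (1 + g x)\<bar> \<partial>?M) \<longlonglongrightarrow> 0" using gi(3) by simp
    have 5: "AE x in ?M. (\<lambda>n. norm (E n x)) \<longlonglongrightarrow> h' (w x) * norm (G x)"
      using E unfolding nG[symmetric] by eventually_elim (rule tendsto_norm)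
    have m: "(\<lambda>x. h' (w x) * norm (G x)) \<in> borel_measurable ?M" "(\<lambda>x. norm (E n x)) \<in> borel_measurable ?M" for n by measurable
    show ?thesis using integral_dominated_convergence_varying[OF m 1 5 2 3 4] by blast
  qed
  have lim: "?m * (\<integral>x. h (w x) \<partial>?M) \<le> measure lebesgue A0 * (\<integral>x. h (w x) \<partial>?M) + ?m * (\<rho> * (\<integral>x. h' (w x) * norm (G x) \<partial>?M))"
  proof (rule LIMSEQ_le)
    show "(\<lambda>n. ?m * (\<integral>x. \<psi> n x * indicator A x \<partial>?M)) \<longlonglongrightarrow> ?m * (\<integral>x. h (w x) \<partial>?M)"
      using Alim unfolding Aeq by (intro tendsto_intros)
    show "(\<lambda>n. measure lebesgue A0 * (\<integral>x. \<psi> n x \<partial>?M) + ?m * (\<rho> * (\<integral>x. norm (E n x) \<partial>?M))) \<longlonglongrightarrow>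
        measure lebesgue A0 * (\<integral>x. h (w x) \<partial>?M) + ?m * (\<rho> * (\<integral>x. h' (w x) * norm (G x) \<partial>?M))"
      using \<psi>lim(1) Elim by (intro tendsto_intros) auto
  qed (use ineq in auto)
  have z: "AE x in lebesgue. x \<in> K' - K \<longrightarrow> h (w x) = 0" "AE x in lebesgue. x \<in> K' - K \<longrightarrow> h' (w x) * norm (G x) = 0"
    using AE_zero_outside[OF K'(2)] by (eventually_elim, auto)+
  note s1 = integrable_lebesgue_on_shrink(2)[OF K(1) K'(1,3) \<psi>lim(2) z(1)]
  note s2 = integrable_lebesgue_on_shrink(2)[OF K(1) K'(1,3) conjunct1[OF Elim] z(2)]
  show ?thesis using lim unfolding s1 s2 A0_def .
qed

end

section \<open>The energy argument\<close>

text \<open>At z = 0 both sides are 0, because \<open>0 powr s = 0\<close> for every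
  exponent.\<close>

lemma powr_mult_self: "0 \<le> z \<Longrightarrow> z * z powr s = z powr (s + 1)" for z s :: real
  by (cases "z = 0") (auto simp: powr_add)

text \<open>Either C z <= (\<open>\<gamma>\<close>/2) d, and the coercive term absorbs the product,
  or d is at most (2C/\<open>\<gamma>\<close>) z and can be replaced by it. The factor 1/2 leaves
  half of the coercive term on the left.\<close>

lemma young_absorb:
  fixes C \<gamma> d z r :: real
  assumes "0 < C" "0 < \<gamma>" "0 \<le> d" "0 \<le> z" "1 < r"
  shows "C * d powr (r - 1) * z \<le> \<gamma> / 2 * d powr r + C * (2 * C / \<gamma>) powr (r - 1) * z powr r"
proof (cases "C * z \<le> \<gamma> / 2 * d")
  case True
  have "C * d powr (r - 1) * z = d powr (r - 1) * (C * z)" by simp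
  also have "\<dots> \<le> d powr (r - 1) * (\<gamma> / 2 * d)" using True by (intro mult_left_mono) auto
  also have "\<dots> = \<gamma> / 2 * (d * d powr (r - 1))" by simp
  also have "\<dots> = \<gamma> / 2 * d powr r" using powr_mult_self[OF assms(3), of "r - 1"] by simp
  finally show ?thesis using assms by (simp add: add_increasing2)
next
  case False
  then have "d \<le> (2 * C / \<gamma>) * z" using assms by (simp add: field_simps)
  then have "d powr (r - 1) \<le> ((2 * C / \<gamma>) * z) powr (r - 1)" using assms by (intro powr_mono2) auto
  also have "\<dots> = (2 * C / \<gamma>) powr (r - 1) * z powr (r - 1)" by (intro powr_mult)
  finally have "C * d powr (r - 1) * z \<le> C * ((2 * C / \<gamma>) powr (r - 1) * z powr (r - 1)) * z"
    using assms by (intro mult_right_mono mult_left_mono) auto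
  also have "\<dots> = C * (2 * C / \<gamma>) powr (r - 1) * (z * z powr (r - 1))" by simp
  also have "\<dots> = C * (2 * C / \<gamma>) powr (r - 1) * z powr r" using powr_mult_self[OF assms(4), of "r - 1"] by simp
  finally show ?thesis using assms by (simp add: add_increasing)
qed

lemma powr_mult_le_add:
  fixes d z r :: real
  assumes "0 \<le> d" "0 \<le> z" "1 < r"
  shows "z powr (r - 1) * d \<le> z powr r + d powr r"
proof (cases "d \<le> z")
  case True
  have "z powr (r - 1) * d \<le> z powr (r - 1) * z" using True by (intro mult_left_mono) auto
  also have "\<dots> = z powr r" using powr_mult_self[OF assms(2), of "r - 1"] by (simp add: mult.commute)
  finally show ?thesis by (simp add: add_increasing2)
next
  case False
  have "z powr (r - 1) * d \<le> d powr (r - 1) * d" using False assms by (intro mult_right_mono powr_mono2) auto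
  also have "\<dots> = d powr r" using powr_mult_self[OF assms(1), of "r - 1"] by (simp add: mult.commute)
  finally show ?thesis by (simp add: add_increasing)
qed

text \<open>The purely measure-theoretic core: \<open>d\<close> stands for |Dw| and
  \<open>m \<rho>\<close> for the volume of a ball. The factor 2 in \<open>E\<close> is the
  derivative 2z of the tested square. The conclusion is incompatible with \<open>S\<close> being the
  least essential upper bound of w.\<close>

lemma (in finite_measure) energy_faber_krahn_bound:
  fixes w d :: "'a \<Rightarrow> real" and m :: "real \<Rightarrow> real"
  assumes w[measurable]: "w \<in> borel_measurable M" and d[measurable]: "d \<in> borel_measurable M" "\<And>x. 0 \<le> d x"
    and S: "AE x in M. w x \<le> S" and r: "1 < r" and \<gamma>: "0 < \<gamma>" and C: "0 < C" and k0: "k0 < S"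
    and di: "integrable M (\<lambda>x. d x powr r)"
    and E: "\<And>k. k0 \<le> k \<Longrightarrow> k < S \<Longrightarrow>
      2 * \<gamma> * (\<integral>x. d x powr r * max 0 (w x - k) \<partial>M) \<le>
        C * (\<integral>x. (d x powr (r - 1) + d x powr r) * max 0 (w x - k) powr 2 \<partial>M)"
    and FK: "\<And>k \<rho>. k0 \<le> k \<Longrightarrow> k < S \<Longrightarrow> 0 \<le> \<rho> \<Longrightarrow>
      m \<rho> * (\<integral>x. max 0 (w x - k) powr (r + 1) \<partial>M) \<le>
        measure M {x\<in>space M. k < w x} * (\<integral>x. max 0 (w x - k) powr (r + 1) \<partial>M) +
        m \<rho> * (\<rho> * (\<integral>x. (r + 1) * max 0 (w x - k) powr r * d x \<partial>M))"
    and m: "\<And>\<rho>. 0 < \<rho> \<Longrightarrow> 0 < m \<rho>" "0 < \<rho>0" "2 * measure M (space M) \<le> m \<rho>0"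
  shows "\<exists>k<S. k0 \<le> k \<and> (AE x in M. w x \<le> k)"
proof (rule ccontr)
  assume contra: "\<not> ?thesis"
  define z where "z k x = max 0 (w x - k)" for k x
  have [measurable]: "z k \<in> borel_measurable M" for k unfolding z_def by measurable
  have z0: "0 \<le> z k x" for k x by (simp add: z_def)
  have zS: "AE x in M. z k x \<le> S - k" if "k < S" for k
    using S by eventually_elim (use that in \<open>auto simp: z_def\<close>)
  have int: "integrable M (\<lambda>x. d x powr s * z k x powr a)" if "k < S" "0 \<le> s" "s \<le> r" "0 \<le> a" for k s a
  proof (rule Bochner_Integration.integrable_bound)
    show "integrable M (\<lambda>x. (1 + d x powr r) * (S - k) powr a)" using di by simp
    show "AE x in M. norm (d x powr s * z k x powr a) \<le> norm ((1 + d x powr r) * (S - k) powr a)"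
      using zS[OF that(1)]
    proof eventually_elim
      case (elim x)
      have "d x powr s * z k x powr a \<le> (1 + d x powr r) * (S - k) powr a"
        using elim that z0 by (intro mult_mono powr_le_one_add_powr d powr_mono2) (auto simp: add_increasing2)
      moreover have "0 \<le> d x powr s * z k x powr a" by simp
      ultimately show ?case by (metis abs_of_nonneg order_trans real_norm_def)
    qed
  qed measurable
  have intz: "integrable M (\<lambda>x. z k x powr a)" if "k < S" "0 \<le> a" for k a
  proof (rule Bochner_Integration.integrable_bound)
    show "integrable M (\<lambda>x. (S - k) powr a)" by simp
    show "AE x in M. norm (z k x powr a) \<le> norm ((S - k) powr a)"
      using zS[OF that(1)] by eventually_elim (use that z0 in \<open>auto intro!: powr_mono2\<close>)
  qed measurable
  \<comment> \<open>Above this level z <= S - k <= \<open>\<gamma> / C\<close>, so the term C d^r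
    z^2 is at most \<open>\<gamma>\<close> d^r z and one half of the left side absorbs it.\<close>
  define k1 where "k1 = max k0 (S - \<gamma> / C)"
  have k1: "k0 \<le> k1" "k1 < S" using k0 \<gamma> C by (auto simp: k1_def)
  have zp2: "z k x powr 2 = z k x * z k x" for k x
    using powr_mult_self[OF z0, of k x 1] z0[of k x] by (simp add: powr_one')
  have i1: "integrable M (\<lambda>x. d x powr r * z k x)" if "k < S" for k
    using int[OF that, of r 1] r z0 by simp
  have i2: "integrable M (\<lambda>x. d x powr (r - 1) * z k x powr 2)" if "k < S" for k
    using int[OF that, of "r - 1" 2] r by simp
  have i3: "integrable M (\<lambda>x. d x powr r * z k x powr 2)" if "k < S" for k
    using int[OF that, of r 2] r by simp
  have E1: "\<gamma> * (\<integral>x. d x powr r * z k x \<partial>M) \<le> C * (\<integral>x. d x powr (r - 1) * z k x powr 2 \<partial>M)"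
    if k: "k1 \<le> k" "k < S" for k
  proof -
    have kS: "C * (S - k) \<le> \<gamma>"
    proof -
      have "S - k \<le> \<gamma> / C" using k by (simp add: k1_def)
      then show ?thesis using C by (simp add: field_simps)
    qed
    have "2 * \<gamma> * (\<integral>x. d x powr r * z k x \<partial>M) \<le> C * (\<integral>x. (d x powr (r - 1) + d x powr r) * z k x powr 2 \<partial>M)"
      using E[of k] k k1 by (simp add: z_def)
    also have "(\<integral>x. (d x powr (r - 1) + d x powr r) * z k x powr 2 \<partial>M) =
       (\<integral>x. d x powr (r - 1) * z k x powr 2 \<partial>M) + (\<integral>x. d x powr r * z k x powr 2 \<partial>M)"
      using i2[OF k(2)] i3[OF k(2)] by (simp add: distrib_right)
    finally have a: "2 * \<gamma> * (\<integral>x. d x powr r * z k x \<partial>M) \<le> C * (\<integral>x. d x powr (r - 1) * z k x powr 2 \<partial>M) +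
        C * (\<integral>x. d x powr r * z k x powr 2 \<partial>M)" by (simp add: distrib_left)
    have "C * (\<integral>x. d x powr r * z k x powr 2 \<partial>M) = (\<integral>x. C * (d x powr r * z k x powr 2) \<partial>M)" by simp
    also have "\<dots> \<le> (\<integral>x. \<gamma> * (d x powr r * z k x) \<partial>M)"
    proof (rule integral_mono_AE)
      show "AE x in M. C * (d x powr r * z k x powr 2) \<le> \<gamma> * (d x powr r * z k x)"
        using zS[OF k(2)]
      proof eventually_elim
        case (elim x)
        have "C * z k x \<le> C * (S - k)" using elim C by (intro mult_left_mono) auto
        then have "(d x powr r * z k x) * (C * z k x) \<le> (d x powr r * z k x) * \<gamma>"
          using kS z0 by (intro mult_left_mono) auto
        then show ?case by (simp add: zp2 mult_ac)
      qed
    qed (use i1[OF k(2)] i3[OF k(2)] in auto)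
    also have "\<dots> = \<gamma> * (\<integral>x. d x powr r * z k x \<partial>M)" by simp
    finally show ?thesis using a by linarith
  qed
  define P where "P = {x\<in>space M. w x = S}"
  have [measurable]: "P \<in> sets M" unfolding P_def by measurable
  \<comment> \<open>On \<open>P\<close> the weight z equals S - k. The left side of
    \<open>E1\<close> is thus at least \<open>\<gamma>\<close> (S - k) times the integral of d^r
    over \<open>P\<close>, while the right side is of order (S - k)^2; dividing by S - k and letting
    k tend to S gives the claim.\<close>
  have dP: "AE x in M. w x = S \<longrightarrow> d x = 0"
  proof -
    have iP: "integrable M (\<lambda>x. d x powr r * indicator P x)"
      using di by (intro integrable_real_mult_indicator) auto
    define I where "I = (\<integral>x. d x powr (r - 1) \<partial>M)"
    have iI: "integrable M (\<lambda>x. d x powr (r - 1))"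
    proof (rule Bochner_Integration.integrable_bound)
      show "integrable M (\<lambda>x. 1 + d x powr r)" using di by simp
      show "AE x in M. norm (d x powr (r - 1)) \<le> norm (1 + d x powr r)"
        using powr_le_one_add_powr[OF d(2), of "r - 1" r] r by (intro AE_I2) (auto intro: order_trans)
    qed measurable
    have b: "(\<integral>x. d x powr r * indicator P x \<partial>M) \<le> C * I / \<gamma> * (S - k)" if k: "k1 \<le> k" "k < S" for k
    proof -
      have "\<gamma> * ((S - k) * (\<integral>x. d x powr r * indicator P x \<partial>M)) = (\<integral>x. \<gamma> * ((S - k) * (d x powr r * indicator P x)) \<partial>M)" by simp
      also have "\<dots> \<le> (\<integral>x. \<gamma> * (d x powr r * z k x) \<partial>M)"
        using iP i1[OF k(2)] \<gamma> z0 k(2) by (intro integral_mono) (auto simp: indicator_def P_def z_def mult_ac)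
      also have "\<dots> = \<gamma> * (\<integral>x. d x powr r * z k x \<partial>M)" by simp
      also have "\<dots> \<le> C * (\<integral>x. d x powr (r - 1) * z k x powr 2 \<partial>M)" by (rule E1[OF k])
      also have "(\<integral>x. d x powr (r - 1) * z k x powr 2 \<partial>M) \<le> (\<integral>x. d x powr (r - 1) * (S - k)\<^sup>2 \<partial>M)"
      proof (rule integral_mono_AE)
        show "AE x in M. d x powr (r - 1) * z k x powr 2 \<le> d x powr (r - 1) * (S - k)\<^sup>2"
          using zS[OF k(2)]
        proof eventually_elim
          case (elim x)
          then have "z k x * z k x \<le> (S - k) * (S - k)" using z0[of k x] by (intro mult_mono) auto
          then show ?case by (simp add: zp2 power2_eq_square mult_left_mono)
        qed
      qed (use i2[OF k(2)] iI in auto)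
      also have "\<dots> = I * (S - k)\<^sup>2" by (simp add: I_def)
      finally have "\<gamma> * ((S - k) * (\<integral>x. d x powr r * indicator P x \<partial>M)) \<le> C * (I * (S - k)\<^sup>2)"
        using C by simp
      then have "(S - k) * (\<gamma> * (\<integral>x. d x powr r * indicator P x \<partial>M)) \<le> (S - k) * (C * I * (S - k))"
        by (simp add: power2_eq_square mult_ac)
      then have "\<gamma> * (\<integral>x. d x powr r * indicator P x \<partial>M) \<le> C * I * (S - k)"
        using k(2) by (simp add: mult_le_cancel_left)
      then show ?thesis using \<gamma> by (simp add: field_simps)
    qed
    have "(\<integral>x. d x powr r * indicator P x \<partial>M) \<le> 0"
    proof (rule tendsto_lowerbound[where F="at_left S"])
      have "((\<lambda>k. C * I / \<gamma> * (S - k)) \<longlongrightarrow> C * I / \<gamma> * (S - S)) (at_left S)" by (intro tendsto_intros)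
      then show "((\<lambda>k. C * I / \<gamma> * (S - k)) \<longlongrightarrow> 0) (at_left S)" by simp
      show "\<forall>\<^sub>F k in at_left S. (\<integral>x. d x powr r * indicator P x \<partial>M) \<le> C * I / \<gamma> * (S - k)"
        using k1(2) by (intro eventually_at_leftI[of k1]) (use b in auto)
    qed simp
    then have "(\<integral>x. d x powr r * indicator P x \<partial>M) = 0"
      by (intro antisym integral_nonneg_AE) auto
    then have "AE x in M. d x powr r * indicator P x = 0"
      using integral_nonneg_eq_0_iff_AE[OF iP] by auto
    then show ?thesis using AE_space by eventually_elim (auto simp: P_def indicator_def)
  qed
  have dS: "AE x in M. d x = 0 \<or> w x < S" using dP S by eventually_elim auto
  \<comment> \<open>\<open>J\<close> leaves out the level set \<open>P\<close> and \<open>X\<close>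
    includes it. As d vanishes on \<open>P\<close>, every gradient term is bounded through
    \<open>J\<close> alone, and this difference will rule out a \<open>P\<close> of positive
    measure.\<close>
  define J where "J k = (\<integral>x. z k x powr (r + 1) * indicator {x\<in>space M. w x < S} x \<partial>M)" for k
  define X where "X k = (\<integral>x. z k x powr (r + 1) \<partial>M)" for k
  have iJ: "integrable M (\<lambda>x. z k x powr (r + 1) * indicator {x\<in>space M. w x < S} x)" if "k < S" for k
    using intz[OF that, of "r + 1"] r by (intro integrable_real_mult_indicator) auto
  have iX: "integrable M (\<lambda>x. z k x powr (r + 1))" if "k < S" for k using intz[OF that, of "r + 1"] r by simp
  have JX: "J k \<le> X k" if "k < S" for k unfolding J_def X_def
    using iJ[OF that] iX[OF that] by (intro integral_mono) (auto simp: indicator_def)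
  have J0: "0 \<le> J k" "0 \<le> X k" for k by (auto simp: J_def X_def intro!: integral_nonneg_AE)
  define C1 where "C1 = C * (2 * C / \<gamma>) powr (r - 1)"
  have C1: "0 \<le> C1" using C by (simp add: C1_def)
  define C2 where "C2 = 2 * C1 / \<gamma>"
  have C2: "0 \<le> C2" using C1 \<gamma> by (simp add: C2_def)
  have E2: "(\<integral>x. d x powr r * z k x \<partial>M) \<le> C2 * J k" if k: "k1 \<le> k" "k < S" for k
  proof -
    have "\<gamma> * (\<integral>x. d x powr r * z k x \<partial>M) \<le> (\<integral>x. C * (d x powr (r - 1) * z k x powr 2) \<partial>M)"
      using E1[OF k] by simp
    also have "\<dots> \<le> (\<integral>x. \<gamma> / 2 * (d x powr r * z k x) + C1 * (z k x powr (r + 1) * indicator {x\<in>space M. w x < S} x) \<partial>M)"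
    proof (rule integral_mono_AE)
      show "AE x in M. C * (d x powr (r - 1) * z k x powr 2) \<le>
        \<gamma> / 2 * (d x powr r * z k x) + C1 * (z k x powr (r + 1) * indicator {x\<in>space M. w x < S} x)"
        using dS AE_space
      proof eventually_elim
        case (elim x)
        show ?case
        proof (cases "d x = 0")
          case True
          then show ?thesis using C1 by simp
        next
          case False
          then have w: "w x < S" using elim by auto
          have "C * (d x powr (r - 1) * z k x powr 2) = (C * d x powr (r - 1) * z k x) * z k x" by (simp add: zp2)
          also have "\<dots> \<le> (\<gamma> / 2 * d x powr r + C1 * z k x powr r) * z k x"
            unfolding C1_def using young_absorb[OF C \<gamma> d(2) z0 r] z0 by (intro mult_right_mono)
          also have "\<dots> = \<gamma> / 2 * (d x powr r * z k x) + C1 * (z k x * z k x powr r)" by (simp add: algebra_simps)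
          also have "z k x * z k x powr r = z k x powr (r + 1)" by (rule powr_mult_self[OF z0])
          finally show ?thesis using w elim by simp
        qed
      qed
    qed (use i1[OF k(2)] i2[OF k(2)] iJ[OF k(2)] in auto)
    also have "\<dots> = \<gamma> / 2 * (\<integral>x. d x powr r * z k x \<partial>M) + C1 * J k"
      using i1[OF k(2)] iJ[OF k(2)] by (simp add: J_def)
    finally show ?thesis using \<gamma> by (simp add: C2_def field_simps)
  qed
  \<comment> \<open>The factor r + 1 comes from differentiating the power, the summands 1 and
    \<open>C2\<close> from splitting z^r d into z^(r+1) and d^r z.\<close>
  define C3 where "C3 = (r + 1) * (1 + C2)"
  have C3: "0 < C3" using r C2 by (simp add: C3_def)
  have F1: "m \<rho> * X k \<le> measure M {x\<in>space M. k < w x} * X k + m \<rho> * (\<rho> * (C3 * J k))"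
    if k: "k1 \<le> k" "k < S" and \<rho>: "0 < \<rho>" for k \<rho>
  proof -
    have i: "integrable M (\<lambda>x. (r + 1) * z k x powr r * d x)"
    proof -
      have "integrable M (\<lambda>x. z k x powr r * d x)"
        using int[OF k(2), of 1 r] r d(2) by (simp add: mult.commute)
      from integrable_mult_right[OF this, of "r + 1"] show ?thesis by (simp only: mult.assoc)
    qed
    have "(\<integral>x. (r + 1) * z k x powr r * d x \<partial>M) \<le> (\<integral>x. (r + 1) * (z k x powr (r + 1) * indicator {x\<in>space M. w x < S} x + d x powr r * z k x) \<partial>M)"
    proof (rule integral_mono_AE)
      show "AE x in M. (r + 1) * z k x powr r * d x \<le> (r + 1) * (z k x powr (r + 1) * indicator {x\<in>space M. w x < S} x + d x powr r * z k x)"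
        using dS AE_space
      proof eventually_elim
        case (elim x)
        show ?case
        proof (cases "d x = 0")
          case True
          then show ?thesis using r z0 by simp
        next
          case False
          then have w: "w x < S" using elim by auto
          have "z k x powr r * d x = z k x * (z k x powr (r - 1) * d x)"
            using powr_mult_self[OF z0, of k x "r - 1"] by (simp add: mult_ac)
          also have "\<dots> \<le> z k x * (z k x powr r + d x powr r)"
            using powr_mult_le_add[OF d(2) z0 r] z0 by (intro mult_left_mono)
          also have "\<dots> = z k x powr (r + 1) + d x powr r * z k x"
            using powr_mult_self[OF z0, of k x r] by (simp add: algebra_simps)
          finally have "(r + 1) * (z k x powr r * d x) \<le> (r + 1) * (z k x powr (r + 1) + d x powr r * z k x)"
            using r by (intro mult_left_mono) auto
          then show ?thesis using w elim by (simp add: mult.assoc)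
        qed
      qed
    qed (use i i1[OF k(2)] iJ[OF k(2)] in auto)
    also have "\<dots> = (r + 1) * (J k + (\<integral>x. d x powr r * z k x \<partial>M))"
      using i1[OF k(2)] iJ[OF k(2)] by (simp add: J_def)
    also have "\<dots> \<le> (r + 1) * (J k + C2 * J k)" using E2[OF k] r by (intro mult_left_mono) auto
    also have "\<dots> = C3 * J k" by (simp add: C3_def algebra_simps)
    finally have "m \<rho> * (\<rho> * (\<integral>x. (r + 1) * z k x powr r * d x \<partial>M)) \<le> m \<rho> * (\<rho> * (C3 * J k))"
      using \<rho> m(1)[OF \<rho>] by (intro mult_left_mono) auto
    then show ?thesis using FK[of k \<rho>] k k1 \<rho> by (simp add: z_def X_def)
  qed
  define kn where "kn n = S - (S - k1) / real (Suc n)" for n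
  have kn: "k1 \<le> kn n" "kn n < S" for n
  proof -
    have "(S - k1) / real (Suc n) \<le> (S - k1) / 1" using k1(2) by (intro divide_left_mono) auto
    then show "k1 \<le> kn n" by (simp add: kn_def)
    have "0 < (S - k1) / real (Suc n)" using k1(2) by simp
    then show "kn n < S" by (simp add: kn_def)
  qed
  have knlim: "kn \<longlonglongrightarrow> S"
  proof -
    have "(\<lambda>n. S - (S - k1) * inverse (real (Suc n))) \<longlonglongrightarrow> S - (S - k1) * 0"
      by (intro tendsto_intros LIMSEQ_inverse_real_of_nat)
    then show ?thesis by (simp add: kn_def[abs_def] divide_inverse)
  qed
  have knmono: "kn i \<le> kn j" if "i \<le> j" for i j
  proof -
    have "(S - k1) / real (Suc j) \<le> (S - k1) / real (Suc i)" using that k1(2) by (intro divide_left_mono) auto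
    then show ?thesis by (simp add: kn_def)
  qed
  have knS: "S \<le> t" if "\<And>n. kn n < t" for t
    using knlim that by (intro LIMSEQ_le_const2[OF knlim]) (auto intro: less_imp_le)
  have lim1: "(\<lambda>n. measure M {x\<in>space M. kn n < w x \<and> w x < S}) \<longlonglongrightarrow> 0"
  proof -
    have "(\<lambda>n. measure M {x\<in>space M. kn n < w x \<and> w x < S}) \<longlonglongrightarrow> measure M (\<Inter>n. {x\<in>space M. kn n < w x \<and> w x < S})"
    proof (rule finite_Lim_measure_decseq)
      show "range (\<lambda>n. {x\<in>space M. kn n < w x \<and> w x < S}) \<subseteq> sets M" by auto
      show "decseq (\<lambda>n. {x\<in>space M. kn n < w x \<and> w x < S})"
        unfolding decseq_def using knmono by (auto intro: le_less_trans)
    qed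
    moreover have "(\<Inter>n. {x\<in>space M. kn n < w x \<and> w x < S}) = {}" using knS by force
    ultimately show ?thesis by simp
  qed
  have lim2: "(\<lambda>n. measure M {x\<in>space M. kn n < w x}) \<longlonglongrightarrow> measure M P"
  proof -
    have "(\<lambda>n. measure M {x\<in>space M. kn n < w x}) \<longlonglongrightarrow> measure M (\<Inter>n. {x\<in>space M. kn n < w x})"
    proof (rule finite_Lim_measure_decseq)
      show "range (\<lambda>n. {x\<in>space M. kn n < w x}) \<subseteq> sets M" by auto
      show "decseq (\<lambda>n. {x\<in>space M. kn n < w x})"
        unfolding decseq_def using knmono by (auto intro: le_less_trans)
    qed
    moreover have "(\<Inter>n. {x\<in>space M. kn n < w x}) = {x\<in>space M. S \<le> w x}"
    proof (intro equalityI subsetI)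
      fix x assume "x \<in> (\<Inter>n. {x\<in>space M. kn n < w x})"
      then show "x \<in> {x\<in>space M. S \<le> w x}" using knS by auto
    qed (use kn(2) in \<open>auto intro: less_le_trans\<close>)
    moreover have "measure M {x\<in>space M. S \<le> w x} = measure M P"
    proof (rule finite_measure_eq_AE)
      show "AE x in M. x \<in> {x\<in>space M. S \<le> w x} \<longleftrightarrow> x \<in> P"
        using S by eventually_elim (auto simp: P_def)
    qed auto
    ultimately show ?thesis by simp
  qed
  \<comment> \<open>The radius \<open>\<rho>0\<close> is so large that the whole space has at most
    half the volume of the ball, so \<open>F1\<close> gives X <= 2 \<open>\<rho>0\<close> C3 J. With
    t = (S - k)^(r+1), X is at least t times the measure of \<open>P\<close> and J at most t times
    the measure of {k < w < S}. The factor t cancels, and these sets decrease to the empty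
    set.\<close>
  have P0: "measure M P = 0"
  proof -
    have "measure M P \<le> 2 * \<rho>0 * C3 * measure M {x\<in>space M. kn n < w x \<and> w x < S}" for n
    proof -
      note k = kn[of n]
      have "measure M {x\<in>space M. kn n < w x} \<le> m \<rho>0 / 2"
        using m(3) bounded_measure[of "{x\<in>space M. kn n < w x}"] by linarith
      then have "measure M {x\<in>space M. kn n < w x} * X (kn n) \<le> m \<rho>0 / 2 * X (kn n)" using J0 by (intro mult_right_mono)
      with F1[OF k m(2)] have "m \<rho>0 * X (kn n) \<le> m \<rho>0 * (2 * \<rho>0 * C3 * J (kn n))" by (simp add: mult_ac)
      then have XJ: "X (kn n) \<le> 2 * \<rho>0 * C3 * J (kn n)" using m(1)[OF m(2)] by (simp add: mult_le_cancel_left)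
      define t where "t = (S - kn n) powr (r + 1)"
      have t: "0 < t" using k by (simp add: t_def)
      have "t * measure M P = (\<integral>x. t * indicator P x \<partial>M)" by simp
      also have "\<dots> \<le> X (kn n)" unfolding X_def
      proof (rule integral_mono[OF _ iX[OF k(2)]])
        show "integrable M (\<lambda>x. t * indicator P x)"
          by (intro integrable_mult_right) (simp add: less_top[symmetric])
        show "t * indicator P x \<le> z (kn n) x powr (r + 1)" for x
          using k(2) by (cases "x \<in> P") (auto simp: P_def t_def z_def)
      qed
      also have "\<dots> \<le> 2 * \<rho>0 * C3 * J (kn n)" by (rule XJ)
      also have "J (kn n) \<le> (\<integral>x. t * indicator {x\<in>space M. kn n < w x \<and> w x < S} x \<partial>M)" unfolding J_def
      proof (rule integral_mono_AE[OF iJ[OF k(2)]])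
        show "AE x in M. z (kn n) x powr (r + 1) * indicator {x\<in>space M. w x < S} x \<le> t * indicator {x\<in>space M. kn n < w x \<and> w x < S} x"
          using zS[OF k(2)] AE_space
        proof eventually_elim
          case (elim x)
          show ?case
          proof (cases "kn n < w x")
            case True
            have "z (kn n) x powr (r + 1) \<le> t" unfolding t_def using elim z0 r by (intro powr_mono2) auto
            then show ?thesis using True by (auto simp: indicator_def)
          next
            case False
            then have "z (kn n) x = 0" by (simp add: z_def)
            then show ?thesis using t by (simp add: indicator_def)
          qed
        qed
      qed (intro integrable_mult_right, simp add: less_top[symmetric])
      also have "\<dots> = t * measure M {x\<in>space M. kn n < w x \<and> w x < S}" by simp
      finally have "t * measure M P \<le> t * (2 * \<rho>0 * C3 * measure M {x\<in>space M. kn n < w x \<and> w x < S})"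
        using m(2) C3 by (simp add: mult_ac)
      then show ?thesis using t by (simp add: mult_le_cancel_left)
    qed
    then have "measure M P \<le> 2 * \<rho>0 * C3 * 0"
      by (intro LIMSEQ_le_const[OF tendsto_mult[OF tendsto_const lim1]]) auto
    then show ?thesis by (simp add: measure_le_0_iff)
  qed
  \<comment> \<open>With this radius the gradient term in \<open>F1\<close> is at most a quarter of
    the left side. Since \<open>P\<close> is a null set, the measure term is at most a quarter too
    for large n; hence X <= X/2 and X vanishes.\<close>
  define \<rho> where "\<rho> = 1 / (4 * C3)"
  have \<rho>: "0 < \<rho>" using C3 by (simp add: \<rho>_def)
  have "\<forall>\<^sub>F n in sequentially. measure M {x\<in>space M. kn n < w x} < m \<rho> / 4"
    using lim2 P0 m(1)[OF \<rho>] by (intro order_tendstoD) auto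
  then obtain n where n: "measure M {x\<in>space M. kn n < w x} < m \<rho> / 4" by (auto simp: eventually_sequentially)
  note k = kn[of n]
  have "measure M {x\<in>space M. kn n < w x} * X (kn n) \<le> m \<rho> / 4 * X (kn n)" using n J0 by (intro mult_right_mono) auto
  moreover have "m \<rho> * (\<rho> * (C3 * J (kn n))) \<le> m \<rho> / 4 * X (kn n)"
  proof -
    have "\<rho> * (C3 * J (kn n)) = J (kn n) / 4" using C3 by (simp add: \<rho>_def)
    also have "\<dots> \<le> X (kn n) / 4" using JX[OF k(2)] by simp
    finally have "m \<rho> * (\<rho> * (C3 * J (kn n))) \<le> m \<rho> * (X (kn n) / 4)" using m(1)[OF \<rho>] by (intro mult_left_mono) auto
    then show ?thesis by simp
  qed
  ultimately have "m \<rho> * X (kn n) \<le> m \<rho> / 2 * X (kn n)" using F1[OF k \<rho>] by linarith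
  then have "X (kn n) \<le> X (kn n) / 2" using m(1)[OF \<rho>] by (simp add: mult_le_cancel_left)
  then have "X (kn n) = 0" using J0(2)[of "kn n"] by linarith
  then have "AE x in M. z (kn n) x powr (r + 1) = 0"
    using integral_nonneg_eq_0_iff_AE[OF iX[OF k(2)]] by (auto simp: X_def)
  then have "AE x in M. w x \<le> kn n" by eventually_elim (auto simp: z_def)
  then show False using contra k k1 by (meson order_trans)
qed

section \<open>Lower order terms\<close>

text \<open>The gap is the minimum of g x s - g x t over the compact set of triples (x, s, t) with t
  + k <= s. It is positive by strict monotonicity, and the separation k keeps s and t from
  merging.\<close>

lemma compact_strict_mono_gap:
  fixes g :: "'a::euclidean_space \<Rightarrow> real \<Rightarrow> real"
  assumes K: "compact K" and g: "continuous_on (K \<times> UNIV) (\<lambda>(x, t). g x t)"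
    and mono: "\<And>x. x \<in> K \<Longrightarrow> strict_mono (g x)" and k: "0 < k"
  shows "\<exists>\<delta>>0. \<forall>x\<in>K. \<forall>s t. \<bar>s\<bar> \<le> m \<longrightarrow> \<bar>t\<bar> \<le> m \<longrightarrow> t + k \<le> s \<longrightarrow> g x t + \<delta> \<le> g x s"
proof -
  define T where "T = (K \<times> {-m..m} \<times> {-m..m}) \<inter> {y. snd (snd y) + k \<le> fst (snd y)}"
  have "closed {y :: 'a \<times> real \<times> real. snd (snd y) + k \<le> fst (snd y)}"
    by (intro closed_Collect_le continuous_intros)
  then have T: "compact T" unfolding T_def using K by (intro compact_Int_closed compact_Times) auto
  define h where "h y = g (fst y) (fst (snd y)) - g (fst y) (snd (snd y))" for y
  have c1: "continuous_on T (\<lambda>y. g (fst y) (fst (snd y)))"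
  proof -
    have "continuous_on T (\<lambda>y. (\<lambda>(x, t). g x t) (fst y, fst (snd y)))"
      by (rule continuous_on_compose2[OF g]) (auto simp: T_def intro!: continuous_intros)
    then show ?thesis by simp
  qed
  have c2: "continuous_on T (\<lambda>y. g (fst y) (snd (snd y)))"
  proof -
    have "continuous_on T (\<lambda>y. (\<lambda>(x, t). g x t) (fst y, snd (snd y)))"
      by (rule continuous_on_compose2[OF g]) (auto simp: T_def intro!: continuous_intros)
    then show ?thesis by simp
  qed
  have hc: "continuous_on T h" unfolding h_def using c1 c2 by (intro continuous_intros)
  show ?thesis
  proof (cases "T = {}")
    case True
    then have "\<not> (\<bar>s\<bar> \<le> m \<and> \<bar>t\<bar> \<le> m \<and> t + k \<le> s)" if "x \<in> K" for x s t
    proof -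
      have "(x, s, t) \<notin> T" using True by auto
      then show ?thesis using that by (auto simp: T_def abs_le_iff)
    qed
    then show ?thesis by (intro exI[of _ 1]) auto
  next
    case False
    obtain y where y: "y \<in> T" "\<And>z. z \<in> T \<Longrightarrow> h y \<le> h z" using continuous_attains_inf[OF T False hc] by blast
    have "snd (snd y) < fst (snd y)" "fst y \<in> K" using y(1) k by (auto simp: T_def)
    then have "0 < h y" unfolding h_def using mono strict_monoD by fastforce
    moreover have "g x t + h y \<le> g x s" if "x \<in> K" "\<bar>s\<bar> \<le> m" "\<bar>t\<bar> \<le> m" "t + k \<le> s" for x s t
      using y(2)[of "(x, s, t)"] that by (auto simp: T_def h_def abs_le_iff)
    ultimately show ?thesis by blast
  qed
qed

lemma compact_continuous_bound:
  fixes g :: "'a::euclidean_space \<Rightarrow> real \<Rightarrow> real"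
  assumes K: "compact K" and g: "continuous_on (K \<times> UNIV) (\<lambda>(x, t). g x t)"
  shows "\<exists>C>0. \<forall>x\<in>K. \<forall>t. \<bar>t\<bar> \<le> m \<longrightarrow> \<bar>g x t\<bar> \<le> C"
proof -
  have "compact ((\<lambda>(x, t). g x t) ` (K \<times> {-m..m}))"
    using K by (intro compact_continuous_image continuous_on_subset[OF g] compact_Times) auto
  then obtain C where C: "C > 0" "\<And>y. y \<in> (\<lambda>(x, t). g x t) ` (K \<times> {-m..m}) \<Longrightarrow> norm y \<le> C"
    using compact_imp_bounded bounded_pos by metis
  have "\<bar>g x t\<bar> \<le> C" if "x \<in> K" "\<bar>t\<bar> \<le> m" for x t
  proof -
    have "g x t \<in> (\<lambda>(x, t). g x t) ` (K \<times> {-m..m})" using that by (force simp: abs_le_iff)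
    then show ?thesis using C(2) by force
  qed
  then show ?thesis using C(1) by blast
qed

text \<open>By homogeneity: if |b - a| <= \<open>\<theta>\<close> a, then b/a is close to 1 and
  continuity of the power at 1 gives the small multiple of a^\<open>\<sigma>\<close>; otherwise a
  and b are both at most (1 + 1/\<open>\<theta>\<close>) |b - a|, which determines \<open>C\<close>.
  The arbitrarily small coefficient lets the gap of g absorb the first term.\<close>

lemma powr_diff_le:
  fixes \<sigma> \<epsilon> :: real
  assumes \<sigma>: "0 < \<sigma>" and \<epsilon>: "0 < \<epsilon>"
  shows "\<exists>C>0. \<forall>a b. 0 \<le> a \<longrightarrow> 0 \<le> b \<longrightarrow> \<bar>b powr \<sigma> - a powr \<sigma>\<bar> \<le> \<epsilon> * a powr \<sigma> + C * \<bar>b - a\<bar> powr \<sigma>"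
proof -
  have "isCont (\<lambda>s::real. s powr \<sigma>) 1" by (intro continuous_intros) auto
  then obtain d where d: "d > 0" "\<And>s. \<bar>s - 1\<bar> < d \<Longrightarrow> \<bar>s powr \<sigma> - 1\<bar> < \<epsilon>"
    using \<epsilon> unfolding continuous_at_eps_delta dist_real_def by (metis powr_one_eq_one)
  define \<theta> where "\<theta> = d / 2"
  have \<theta>: "0 < \<theta>" using d by (simp add: \<theta>_def)
  define C where "C = (1 + 1 / \<theta>) powr \<sigma>"
  have "0 < 1 + 1 / \<theta>" using \<theta> by (simp add: add_pos_pos)
  then have C: "C > 0" unfolding C_def by (simp only: powr_gt_zero)
  have "\<bar>b powr \<sigma> - a powr \<sigma>\<bar> \<le> \<epsilon> * a powr \<sigma> + C * \<bar>b - a\<bar> powr \<sigma>" if a: "0 \<le> a" and b: "0 \<le> b" for a b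
  proof (cases "a > 0 \<and> \<bar>b - a\<bar> \<le> \<theta> * a")
    case True
    have "\<bar>b / a - 1\<bar> = \<bar>b - a\<bar> / a" using True by (simp add: diff_divide_distrib[symmetric] field_simps abs_divide)
    also have "\<dots> \<le> \<theta>" using True by (simp add: field_simps)
    also have "\<dots> < d" using d by (simp add: \<theta>_def)
    finally have "\<bar>(b / a) powr \<sigma> - 1\<bar> < \<epsilon>" by (rule d(2))
    then have "a powr \<sigma> * \<bar>(b / a) powr \<sigma> - 1\<bar> \<le> a powr \<sigma> * \<epsilon>" by (intro mult_left_mono) auto
    moreover have "a powr \<sigma> * \<bar>(b / a) powr \<sigma> - 1\<bar> = \<bar>a powr \<sigma> * ((b / a) powr \<sigma> - 1)\<bar>" by (simp add: abs_mult)
    moreover have "a powr \<sigma> * ((b / a) powr \<sigma> - 1) = b powr \<sigma> - a powr \<sigma>"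
      using True b by (simp add: powr_divide right_diff_distrib)
    moreover have "0 \<le> C * \<bar>b - a\<bar> powr \<sigma>" using C by simp
    ultimately show ?thesis by (simp add: mult.commute)
  next
    case False
    define e where "e = \<bar>b - a\<bar>"
    have e0: "0 \<le> e" by (simp add: e_def)
    have "a \<le> e / \<theta>" using False a \<theta> by (auto simp: e_def field_simps)
    then have ab: "a \<le> (1 + 1 / \<theta>) * e" "b \<le> (1 + 1 / \<theta>) * e" using e0 by (auto simp: e_def algebra_simps)
    have "((1 + 1 / \<theta>) * e) powr \<sigma> = C * e powr \<sigma>" using e0 \<theta> by (simp add: C_def powr_mult)
    moreover have "a powr \<sigma> \<le> ((1 + 1 / \<theta>) * e) powr \<sigma>" "b powr \<sigma> \<le> ((1 + 1 / \<theta>) * e) powr \<sigma>"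
      using ab a b \<sigma> by (auto intro!: powr_mono2)
    moreover have "\<bar>b powr \<sigma> - a powr \<sigma>\<bar> \<le> max (a powr \<sigma>) (b powr \<sigma>)"
      using powr_ge_zero[of a \<sigma>] powr_ge_zero[of b \<sigma>] by linarith
    moreover have "0 \<le> \<epsilon> * a powr \<sigma>" using \<epsilon> by simp
    ultimately show ?thesis unfolding e_def by linarith
  qed
  then show ?thesis using C by blast
qed

text \<open>Subadditivity of a power with exponent at most 1, from t <= t^\<open>\<sigma>\<close> on
  the unit interval applied to a/b and (b - a)/b. No multiple of a^\<open>\<sigma>\<close> remains,
  so for \<open>\<sigma>\<close> <= 1 a gap of f alone can close the estimate.\<close>

lemma powr_diff_le_concave:
  fixes \<sigma> a b :: real
  assumes \<sigma>: "0 < \<sigma>" "\<sigma> \<le> 1" and a: "0 \<le> a" and b: "0 \<le> b"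
  shows "\<bar>b powr \<sigma> - a powr \<sigma>\<bar> \<le> \<bar>b - a\<bar> powr \<sigma>"
proof -
  have *: "b powr \<sigma> - a powr \<sigma> \<le> (b - a) powr \<sigma>" if "0 \<le> a" "a \<le> b" "0 < b" for a b :: real
  proof -
    have le: "t \<le> t powr \<sigma>" if "0 \<le> t" "t \<le> 1" for t :: real
      using powr_mono'[of \<sigma> 1 t] \<sigma> that by simp
    have "1 = a / b + (b - a) / b" using that by (simp add: field_simps)
    also have "\<dots> \<le> (a / b) powr \<sigma> + ((b - a) / b) powr \<sigma>"
      using that by (intro add_mono le) (auto simp: field_simps)
    also have "\<dots> = (a powr \<sigma> + (b - a) powr \<sigma>) / b powr \<sigma>"
      using that by (simp add: powr_divide add_divide_distrib)
    finally have "b powr \<sigma> \<le> a powr \<sigma> + (b - a) powr \<sigma>" using that by (simp add: pos_le_divide_eq)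
    then show ?thesis by simp
  qed
  consider "a = b" | "a < b" | "b < a" by linarith
  then show ?thesis
  proof cases
    case 2
    then have "a powr \<sigma> \<le> b powr \<sigma>" using a \<sigma> by (intro powr_mono2) auto
    then show ?thesis using *[of a b] a 2 by simp
  next
    case 3
    then have "b powr \<sigma> \<le> a powr \<sigma>" using b \<sigma> by (intro powr_mono2) auto
    then show ?thesis using *[of b a] b 3 by simp
  qed simp
qed

text \<open>Below the threshold \<open>d0\<close>, where d^\<open>\<sigma>\<close> equals
  \<open>\<epsilon>\<close>, the constant suffices; above it the larger exponent s dominates. This
  trades a low power of the gradient for a constant that the gap of f absorbs.\<close>

lemma powr_le_small_add:
  fixes \<sigma> s \<epsilon> :: real
  assumes \<sigma>: "0 < \<sigma>" "\<sigma> \<le> s" and \<epsilon>: "0 < \<epsilon>"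
  shows "\<exists>C>0. \<forall>d\<ge>0. d powr \<sigma> \<le> \<epsilon> + C * d powr s"
proof -
  define d0 where "d0 = \<epsilon> powr (1 / \<sigma>)"
  have d0: "0 < d0" "d0 powr \<sigma> = \<epsilon>" using \<sigma> \<epsilon> by (auto simp: d0_def powr_powr)
  have "d powr \<sigma> \<le> \<epsilon> + d0 powr (\<sigma> - s) * d powr s" if d: "0 \<le> d" for d
  proof (cases "d \<le> d0")
    case True
    have "d powr \<sigma> \<le> d0 powr \<sigma>" using True d \<sigma> by (intro powr_mono2) auto
    then show ?thesis using d0 by (simp add: add_increasing2)
  next
    case False
    have "d powr \<sigma> = d powr (\<sigma> - s) * d powr s" using False d0 by (simp flip: powr_add)
    also have "\<dots> \<le> d0 powr (\<sigma> - s) * d powr s"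
      using False d0 \<sigma> by (intro mult_right_mono powr_mono2') auto
    finally show ?thesis using \<epsilon> by simp
  qed
  then show ?thesis using d0 by (intro exI[of _ "d0 powr (\<sigma> - s)"]) auto
qed

text \<open>Here s, t, \<open>\<xi>\<close>, \<open>\<zeta>\<close> stand for the values u, v and
  their gradients at a point where u - v is at least k. A gap of g removes the powers of
  |\<open>\<xi>\<close>| by itself, a gap of f removes constants; only powers of the difference of
  the gradients survive. The bound \<open>L\<close> on that difference matters when
  \<open>\<sigma>\<close> exceeds p.\<close>

lemma lower_order_bound:
  fixes K :: "(real^'n) set" and f g :: "real^'n \<Rightarrow> real \<Rightarrow> real"
  assumes K: "compact K"
    and f: "continuous_on (K \<times> UNIV) (\<lambda>(x, t). f x t)" and g: "continuous_on (K \<times> UNIV) (\<lambda>(x, t). g x t)"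
    and fm: "\<And>x. x \<in> K \<Longrightarrow> mono (f x)" and gm: "\<And>x. x \<in> K \<Longrightarrow> mono (g x)"
    and pq: "2 \<le> p" "1 < q" "q \<le> p" "0 < \<sigma>" and k: "0 < k"
    and cs: "(\<sigma> \<le> 1 \<and> (\<forall>x\<in>K. strict_mono (f x)))
        \<or> (1 \<le> \<sigma> \<and> \<sigma> \<le> max q 2 - 1 \<and> (\<forall>x\<in>K. strict_mono (f x)) \<and> (\<forall>x\<in>K. strict_mono (g x)))
        \<or> (max q 2 - 1 \<le> \<sigma> \<and> \<sigma> \<le> p - 1 \<and> (\<forall>x\<in>K. strict_mono (g x)))
        \<or> (p - 1 \<le> \<sigma> \<and> (\<forall>x\<in>K. strict_mono (g x)))"
  shows "\<exists>r C. max 2 q \<le> r \<and> r \<le> p \<and> 0 < C \<and>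
    (\<forall>x\<in>K. \<forall>s t. \<forall>\<xi> \<zeta> :: real^'n. \<bar>s\<bar> \<le> m \<longrightarrow> \<bar>t\<bar> \<le> m \<longrightarrow> t + k \<le> s \<longrightarrow> (p < \<sigma> \<longrightarrow> norm (\<xi> - \<zeta>) \<le> L) \<longrightarrow>
      f x t + g x t * norm \<zeta> powr \<sigma> - f x s - g x s * norm \<xi> powr \<sigma> \<le>
      C * (norm (\<xi> - \<zeta>) powr (r - 1) + norm (\<xi> - \<zeta>) powr r))"
proof -
  obtain G where G: "G > 0" "\<And>x t. x \<in> K \<Longrightarrow> \<bar>t\<bar> \<le> m \<Longrightarrow> \<bar>g x t\<bar> \<le> G"
    using compact_continuous_bound[OF K g] by blast
  \<comment> \<open>The difference of the g-terms is split as (g x t - g x s)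
    a^\<open>\<sigma>\<close> + g x t (b^\<open>\<sigma>\<close> - a^\<open>\<sigma>\<close>): the
    first part carries the gap of g, with a favourable sign, and the second is controlled by the
    bound \<open>G\<close>.\<close>
  have basic: "f x t + g x t * b powr \<sigma> - f x s - g x s * a powr \<sigma> \<le> - \<delta> - \<delta>' * a powr \<sigma> + G * \<bar>b powr \<sigma> - a powr \<sigma>\<bar>"
    if "x \<in> K" "\<bar>t\<bar> \<le> m" "f x t + \<delta> \<le> f x s" "g x t + \<delta>' \<le> g x s" for x s t a b \<delta> \<delta>'
  proof -
    have "g x t * b powr \<sigma> - g x s * a powr \<sigma> = (g x t - g x s) * a powr \<sigma> + g x t * (b powr \<sigma> - a powr \<sigma>)"
      by (simp add: algebra_simps)
    moreover have "(g x t - g x s) * a powr \<sigma> \<le> (- \<delta>') * a powr \<sigma>" using that by (intro mult_right_mono) auto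
    moreover have "g x t * (b powr \<sigma> - a powr \<sigma>) \<le> G * \<bar>b powr \<sigma> - a powr \<sigma>\<bar>"
    proof (rule order_trans[OF abs_ge_self])
      show "\<bar>g x t * (b powr \<sigma> - a powr \<sigma>)\<bar> \<le> G * \<bar>b powr \<sigma> - a powr \<sigma>\<bar>"
        unfolding abs_mult using G(2)[OF that(1,2)] by (rule mult_right_mono) simp
    qed
    ultimately show ?thesis using that(3) by simp
  qed
  have nd: "\<bar>norm \<zeta> - norm \<xi>\<bar> \<le> norm (\<xi> - \<zeta>)" for \<xi> \<zeta> :: "real^'n"
    by (metis norm_minus_commute norm_triangle_ineq3)
  have strictg: "\<exists>C>0. \<forall>x\<in>K. \<forall>s t \<delta>. \<forall>\<xi> \<zeta> :: real^'n. \<bar>s\<bar> \<le> m \<longrightarrow> \<bar>t\<bar> \<le> m \<longrightarrow> t + k \<le> s \<longrightarrow> f x t + \<delta> \<le> f x s \<longrightarrow>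
      f x t + g x t * norm \<zeta> powr \<sigma> - f x s - g x s * norm \<xi> powr \<sigma> \<le> - \<delta> + C * norm (\<xi> - \<zeta>) powr \<sigma>"
    if sg: "\<forall>x\<in>K. strict_mono (g x)"
  proof -
    obtain \<delta>' where d': "\<delta>' > 0" "\<And>x s t. x \<in> K \<Longrightarrow> \<bar>s\<bar> \<le> m \<Longrightarrow> \<bar>t\<bar> \<le> m \<Longrightarrow> t + k \<le> s \<Longrightarrow> g x t + \<delta>' \<le> g x s"
      using compact_strict_mono_gap[OF K g _ k] sg by blast
    \<comment> \<open>The coefficient \<open>\<delta>' / G\<close> becomes \<open>\<delta>'\<close>
      after multiplication by \<open>G\<close> and then cancels against the gap of g.\<close>
    obtain C where C: "C > 0" "\<And>a b. 0 \<le> a \<Longrightarrow> 0 \<le> b \<Longrightarrow> \<bar>b powr \<sigma> - a powr \<sigma>\<bar> \<le> (\<delta>' / G) * a powr \<sigma> + C * \<bar>b - a\<bar> powr \<sigma>"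
      using powr_diff_le[OF pq(4), of "\<delta>' / G"] d'(1) G(1) by auto
    have "f x t + g x t * norm \<zeta> powr \<sigma> - f x s - g x s * norm \<xi> powr \<sigma> \<le> - \<delta> + (G * C) * norm (\<xi> - \<zeta>) powr \<sigma>"
      if "x \<in> K" "\<bar>s\<bar> \<le> m" "\<bar>t\<bar> \<le> m" "t + k \<le> s" "f x t + \<delta> \<le> f x s" for x s t \<delta> and \<xi> \<zeta> :: "real^'n"
    proof -
      have "\<bar>norm \<zeta> powr \<sigma> - norm \<xi> powr \<sigma>\<bar> \<le> (\<delta>' / G) * norm \<xi> powr \<sigma> + C * \<bar>norm \<zeta> - norm \<xi>\<bar> powr \<sigma>"
        by (rule C(2)) auto
      also have "\<dots> \<le> (\<delta>' / G) * norm \<xi> powr \<sigma> + C * norm (\<xi> - \<zeta>) powr \<sigma>"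
        using C(1) pq(4) nd by (intro add_left_mono mult_left_mono powr_mono2) auto
      finally have "G * \<bar>norm \<zeta> powr \<sigma> - norm \<xi> powr \<sigma>\<bar> \<le> G * ((\<delta>' / G) * norm \<xi> powr \<sigma> + C * norm (\<xi> - \<zeta>) powr \<sigma>)"
        using G(1) by (intro mult_left_mono) auto
      also have "\<dots> = \<delta>' * norm \<xi> powr \<sigma> + (G * C) * norm (\<xi> - \<zeta>) powr \<sigma>" using G(1) by (simp add: distrib_left)
      finally show ?thesis
        using basic[OF that(1,3,5) d'(2)[OF that(1-4)], of "norm \<zeta>" "norm \<xi>"] by linarith
    qed
    then show ?thesis using C(1) G(1) by (intro exI[of _ "G * C"]) auto
  qed
  have f0: "f x t + 0 \<le> f x s" "g x t + 0 \<le> g x s" if "x \<in> K" "t + k \<le> s" for x s t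
    using monoD[OF fm[OF that(1)], of t s] monoD[OF gm[OF that(1)], of t s] that(2) k by auto
  have max2: "max 2 q \<le> p" using pq by simp
  show ?thesis
  proof (cases "\<sigma> \<le> 1 \<and> (\<forall>x\<in>K. strict_mono (f x))")
    case 1: True
    obtain \<delta> where d: "\<delta> > 0" "\<And>x s t. x \<in> K \<Longrightarrow> \<bar>s\<bar> \<le> m \<Longrightarrow> \<bar>t\<bar> \<le> m \<Longrightarrow> t + k \<le> s \<Longrightarrow> f x t + \<delta> \<le> f x s"
      using compact_strict_mono_gap[OF K f _ k] 1 by blast
    \<comment> \<open>After multiplication by \<open>G\<close> the constant is exactly the gap
      \<open>\<delta>\<close> of f.\<close>
    obtain C where C: "C > 0" "\<And>d. 0 \<le> d \<Longrightarrow> d powr \<sigma> \<le> \<delta> / G + C * d powr (p - 1)"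
      using powr_le_small_add[of \<sigma> "p - 1" "\<delta> / G"] d(1) G(1) pq 1 by auto
    have "f x t + g x t * norm \<zeta> powr \<sigma> - f x s - g x s * norm \<xi> powr \<sigma> \<le>
        (G * C) * (norm (\<xi> - \<zeta>) powr (p - 1) + norm (\<xi> - \<zeta>) powr p)"
      if "x \<in> K" "\<bar>s\<bar> \<le> m" "\<bar>t\<bar> \<le> m" "t + k \<le> s" for x s t and \<xi> \<zeta> :: "real^'n"
    proof -
      have "\<bar>norm \<zeta> powr \<sigma> - norm \<xi> powr \<sigma>\<bar> \<le> \<bar>norm \<zeta> - norm \<xi>\<bar> powr \<sigma>"
        using 1 pq by (intro powr_diff_le_concave) auto
      also have "\<dots> \<le> norm (\<xi> - \<zeta>) powr \<sigma>" using pq nd by (intro powr_mono2) auto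
      also have "\<dots> \<le> \<delta> / G + C * norm (\<xi> - \<zeta>) powr (p - 1)" by (rule C(2)) simp
      finally have "G * \<bar>norm \<zeta> powr \<sigma> - norm \<xi> powr \<sigma>\<bar> \<le> G * (\<delta> / G + C * norm (\<xi> - \<zeta>) powr (p - 1))"
        using G(1) by (intro mult_left_mono) auto
      also have "\<dots> = \<delta> + (G * C) * norm (\<xi> - \<zeta>) powr (p - 1)" using G(1) by (simp add: distrib_left)
      finally have "f x t + g x t * norm \<zeta> powr \<sigma> - f x s - g x s * norm \<xi> powr \<sigma> \<le> (G * C) * norm (\<xi> - \<zeta>) powr (p - 1)"
        using basic[OF that(1,3) d(2)[OF that(1-4)] f0(2)[OF that(1,4)], of "norm \<zeta>" "norm \<xi>"] by linarith
      also have "\<dots> \<le> (G * C) * (norm (\<xi> - \<zeta>) powr (p - 1) + norm (\<xi> - \<zeta>) powr p)"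
        using G(1) C(1) by (intro mult_left_mono) auto
      finally show ?thesis .
    qed
    then show ?thesis using max2 C(1) G(1) by (intro exI[of _ p] exI[of _ "G * C"]) auto
  next
    case False
    then have sg: "\<forall>x\<in>K. strict_mono (g x)" using cs by blast
    obtain C1 where C1: "C1 > 0" "\<And>x s t \<delta> \<xi> \<zeta>. x \<in> K \<Longrightarrow> \<bar>s\<bar> \<le> m \<Longrightarrow> \<bar>t\<bar> \<le> m \<Longrightarrow> t + k \<le> s \<Longrightarrow> f x t + \<delta> \<le> f x s \<Longrightarrow>
      f x t + g x t * norm \<zeta> powr \<sigma> - f x s - g x s * norm \<xi> powr \<sigma> \<le> - \<delta> + C1 * norm (\<xi> - \<zeta> :: real^'n) powr \<sigma>"
      using strictg[OF sg] by blast
    from False cs consider (2) "\<sigma> \<le> max q 2 - 1" "\<forall>x\<in>K. strict_mono (f x)"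
      | (3) "max q 2 - 1 \<le> \<sigma>" "\<sigma> \<le> p - 1" | (4) "p - 1 \<le> \<sigma>" by blast
    then show ?thesis
    proof cases
      case 2
      obtain \<delta> where d: "\<delta> > 0" "\<And>x s t. x \<in> K \<Longrightarrow> \<bar>s\<bar> \<le> m \<Longrightarrow> \<bar>t\<bar> \<le> m \<Longrightarrow> t + k \<le> s \<Longrightarrow> f x t + \<delta> \<le> f x s"
        using compact_strict_mono_gap[OF K f _ k] 2 by blast
      \<comment> \<open>The gap of g has already removed the powers of |\<open>\<xi>\<close>| at the
        price of \<open>C1\<close>; multiplied by \<open>C1\<close> the constant here equals the gap
        of f.\<close>
      obtain C where C: "C > 0" "\<And>d. 0 \<le> d \<Longrightarrow> d powr \<sigma> \<le> \<delta> / C1 + C * d powr (p - 1)"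
      proof -
        have "\<sigma> \<le> p - 1" "0 < \<delta> / C1" using 2(1) pq d(1) C1(1) by auto
        from powr_le_small_add[OF pq(4) this] show ?thesis using that by blast
      qed
      have "f x t + g x t * norm \<zeta> powr \<sigma> - f x s - g x s * norm \<xi> powr \<sigma> \<le>
          (C1 * C) * (norm (\<xi> - \<zeta>) powr (p - 1) + norm (\<xi> - \<zeta>) powr p)"
        if "x \<in> K" "\<bar>s\<bar> \<le> m" "\<bar>t\<bar> \<le> m" "t + k \<le> s" for x s t and \<xi> \<zeta> :: "real^'n"
      proof -
        have "C1 * norm (\<xi> - \<zeta>) powr \<sigma> \<le> C1 * (\<delta> / C1 + C * norm (\<xi> - \<zeta>) powr (p - 1))"
          using C1(1) C(2)[of "norm (\<xi> - \<zeta>)"] by (intro mult_left_mono) auto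
        also have "\<dots> = \<delta> + (C1 * C) * norm (\<xi> - \<zeta>) powr (p - 1)" using C1(1) by (simp add: distrib_left)
        finally have "f x t + g x t * norm \<zeta> powr \<sigma> - f x s - g x s * norm \<xi> powr \<sigma> \<le> (C1 * C) * norm (\<xi> - \<zeta>) powr (p - 1)"
          using C1(2)[OF that(1-4) d(2)[OF that(1-4)], of \<zeta> \<xi>] by linarith
        also have "\<dots> \<le> (C1 * C) * (norm (\<xi> - \<zeta>) powr (p - 1) + norm (\<xi> - \<zeta>) powr p)"
          using C1(1) C(1) by (intro mult_left_mono) auto
        finally show ?thesis .
      qed
      then show ?thesis using max2 C(1) C1(1) by (intro exI[of _ p] exI[of _ "C1 * C"]) auto
    next
      case 3
      have "f x t + g x t * norm \<zeta> powr \<sigma> - f x s - g x s * norm \<xi> powr \<sigma> \<le>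
          C1 * (norm (\<xi> - \<zeta>) powr ((\<sigma> + 1) - 1) + norm (\<xi> - \<zeta>) powr (\<sigma> + 1))"
        if "x \<in> K" "\<bar>s\<bar> \<le> m" "\<bar>t\<bar> \<le> m" "t + k \<le> s" for x s t and \<xi> \<zeta> :: "real^'n"
      proof -
        have "f x t + g x t * norm \<zeta> powr \<sigma> - f x s - g x s * norm \<xi> powr \<sigma> \<le> C1 * norm (\<xi> - \<zeta>) powr \<sigma>"
          using C1(2)[OF that(1-4) f0(1)[OF that(1,4)], of \<zeta> \<xi>] by simp
        also have "\<dots> \<le> C1 * (norm (\<xi> - \<zeta>) powr ((\<sigma> + 1) - 1) + norm (\<xi> - \<zeta>) powr (\<sigma> + 1))"
          using C1(1) by (intro mult_left_mono) auto
        finally show ?thesis .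
      qed
      \<comment> \<open>The exponent r = \<open>\<sigma>\<close> + 1 makes \<open>\<sigma>\<close>
        equal to r - 1, and the range of \<open>\<sigma>\<close> in this case puts r between max 2 q
        and p.\<close>
      then show ?thesis using 3 C1(1) by (intro exI[of _ "\<sigma> + 1"] exI[of _ C1]) (auto simp: max.commute)
    next
      case 4
      \<comment> \<open>For \<open>\<sigma>\<close> <= p the power lies between the exponents p - 1
        and p, and the constant 1 is enough; for larger \<open>\<sigma>\<close> the excess power
        \<open>\<sigma>\<close> - p is bounded by means of \<open>L\<close>.\<close>
      define C where "C = 1 + \<bar>L\<bar> powr (\<sigma> - p)"
      have C: "C \<ge> 1" by (simp add: C_def)
      have pw: "d powr \<sigma> \<le> C * (d powr (p - 1) + d powr p)" if d: "0 \<le> d" "p < \<sigma> \<longrightarrow> d \<le> L" for d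
      proof (cases "p < \<sigma>")
        case True
        have "d powr \<sigma> = d powr (\<sigma> - p) * d powr p" using d by (cases "d = 0") (auto simp flip: powr_add)
        also have "\<dots> \<le> C * d powr p"
        proof (rule mult_right_mono)
          have "d powr (\<sigma> - p) \<le> \<bar>L\<bar> powr (\<sigma> - p)" using True d by (intro powr_mono2) auto
          then show "d powr (\<sigma> - p) \<le> C" by (simp add: C_def)
        qed simp
        also have "\<dots> \<le> C * (d powr (p - 1) + d powr p)" using C by (intro mult_left_mono) auto
        finally show ?thesis .
      next
        case False
        have "d powr \<sigma> \<le> d powr (p - 1) + d powr p"
        proof (cases "d \<le> 1")
          case True
          then have "d powr \<sigma> \<le> d powr (p - 1)" using powr_mono'[of "p - 1" \<sigma> d] 4 d by auto
          then show ?thesis by (simp add: add_increasing2)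
        next
          case d1: False
          then have "d powr \<sigma> \<le> d powr p" using False by (intro powr_mono) auto
          then show ?thesis by (simp add: add_increasing)
        qed
        also have "\<dots> \<le> C * (d powr (p - 1) + d powr p)" using mult_right_mono[OF C, of "d powr (p - 1) + d powr p"] by simp
        finally show ?thesis .
      qed
      have "f x t + g x t * norm \<zeta> powr \<sigma> - f x s - g x s * norm \<xi> powr \<sigma> \<le>
          (C1 * C) * (norm (\<xi> - \<zeta>) powr (p - 1) + norm (\<xi> - \<zeta>) powr p)"
        if "x \<in> K" "\<bar>s\<bar> \<le> m" "\<bar>t\<bar> \<le> m" "t + k \<le> s" "p < \<sigma> \<longrightarrow> norm (\<xi> - \<zeta>) \<le> L" for x s t and \<xi> \<zeta> :: "real^'n"
      proof -
        have "f x t + g x t * norm \<zeta> powr \<sigma> - f x s - g x s * norm \<xi> powr \<sigma> \<le> C1 * norm (\<xi> - \<zeta>) powr \<sigma>"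
          using C1(2)[OF that(1-4) f0(1)[OF that(1,4)], of \<zeta> \<xi>] by simp
        also have "\<dots> \<le> C1 * (C * (norm (\<xi> - \<zeta>) powr (p - 1) + norm (\<xi> - \<zeta>) powr p))"
          using C1(1) pw[OF _ that(5)] by (intro mult_left_mono) auto
        finally show ?thesis by (simp add: mult.assoc)
      qed
      then show ?thesis using max2 C C1(1) by (intro exI[of _ p] exI[of _ "C1 * C"]) auto
    qed
  qed
qed

section \<open>The comparison principle\<close>

lemma locLp_le:
  fixes U V :: "real^'n \<Rightarrow> real"
  assumes V: "locLp \<Omega> p V" and U: "U \<in> borel_measurable (lebesgue_on \<Omega>)"
    and ae: "\<And>K. compact K \<Longrightarrow> K \<subseteq> \<Omega> \<Longrightarrow> AE x in lebesgue. x \<in> K \<longrightarrow> \<bar>U x\<bar> powr p \<le> c * \<bar>V x\<bar> powr p"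
  shows "locLp \<Omega> p U"
  unfolding locLp_def
proof (intro conjI U allI impI)
  fix K assume K: "compact K \<and> K \<subseteq> \<Omega>"
  have [measurable]: "U \<in> borel_measurable (lebesgue_on K)" using measurable_lebesgue_on_subset[OF U] K by auto
  show "integrable (lebesgue_on K) (\<lambda>x. \<bar>U x\<bar> powr p)"
  proof (rule Bochner_Integration.integrable_bound)
    show "integrable (lebesgue_on K) (\<lambda>x. c * \<bar>V x\<bar> powr p)" using V K by (auto simp: locLp_def)
    have "AE x in lebesgue_on K. \<bar>U x\<bar> powr p \<le> c * \<bar>V x\<bar> powr p"
      using ae[of K] K by (simp add: AE_restrict_space_iff)
    then show "AE x in lebesgue_on K. norm (\<bar>U x\<bar> powr p) \<le> norm (c * \<bar>V x\<bar> powr p)"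
      by eventually_elim (auto intro: order_trans)
  qed measurable
qed

lemma W1p_loc_weak_grad:
  fixes u :: "real^'n \<Rightarrow> real"
  assumes \<Omega>: "open \<Omega>" and W: "W1p_loc \<Omega> p u" and G: "weak_grad \<Omega> u G"
  shows "locLp \<Omega> p (\<lambda>x. norm (G x))"
proof -
  obtain G' where G': "weak_grad \<Omega> u G'" "locLp \<Omega> p (\<lambda>x. norm (G' x))" using W by (auto simp: W1p_loc_def)
  show ?thesis
  proof (rule locLp_le[OF G'(2), where c=1])
    show "(\<lambda>x. norm (G x)) \<in> borel_measurable (lebesgue_on \<Omega>)"
      using weak_grad_borel_measurable(2)[OF G] by measurable
    show "AE x in lebesgue. x \<in> K \<longrightarrow> \<bar>norm (G x)\<bar> powr p \<le> 1 * \<bar>norm (G' x)\<bar> powr p" if "compact K" "K \<subseteq> \<Omega>" for K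
      using weak_grad_unique[OF \<Omega> G G'(1) that] by eventually_elim auto
  qed
qed

lemma W1inf_loc_weak_grad:
  fixes u :: "real^'n \<Rightarrow> real"
  assumes \<Omega>: "open \<Omega>" and W: "W1inf_loc \<Omega> u" and G: "weak_grad \<Omega> u G"
  shows "locLinf \<Omega> (\<lambda>x. norm (G x))"
  unfolding locLinf_def
proof (intro conjI allI impI)
  show "(\<lambda>x. norm (G x)) \<in> borel_measurable (lebesgue_on \<Omega>)"
    using weak_grad_borel_measurable(2)[OF G] by measurable
  fix K assume K: "compact K \<and> K \<subseteq> \<Omega>"
  obtain G' where G': "weak_grad \<Omega> u G'" "locLinf \<Omega> (\<lambda>x. norm (G' x))" using W by (auto simp: W1inf_loc_def)
  obtain C where "AE x in lebesgue_on K. \<bar>norm (G' x)\<bar> \<le> C" using G'(2) K by (auto simp: locLinf_def)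
  then have "AE x in lebesgue. x \<in> K \<longrightarrow> norm (G' x) \<le> C" using K by (simp add: AE_restrict_space_iff)
  with weak_grad_unique[OF \<Omega> G G'(1), of K] K
  have "AE x in lebesgue. x \<in> K \<longrightarrow> \<bar>norm (G x)\<bar> \<le> C" by (auto elim: eventually_elim2)
  then show "\<exists>C. AE x in lebesgue_on K. \<bar>norm (G x)\<bar> \<le> C" using K by (auto simp: AE_restrict_space_iff)
qed

lemma powr_add_le_max:
  fixes s t p :: real
  assumes "0 \<le> s" "0 \<le> t" "0 \<le> p"
  shows "(s + t) powr p \<le> 2 powr p * (s powr p + t powr p)"
proof -
  have "(s + t) powr p \<le> (2 * max s t) powr p" using assms by (intro powr_mono2) auto
  also have "\<dots> = 2 powr p * max s t powr p" by (intro powr_mult)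
  also have "\<dots> \<le> 2 powr p * (s powr p + t powr p)" by (intro mult_left_mono) (auto simp: max_def)
  finally show ?thesis .
qed

lemma locLp_norm_diff:
  fixes F G :: "real^'n \<Rightarrow> real^'n"
  assumes "locLp \<Omega> p (\<lambda>x. norm (F x))" "locLp \<Omega> p (\<lambda>x. norm (G x))" "0 \<le> p"
    and m: "(\<lambda>x. norm (F x - G x)) \<in> borel_measurable (lebesgue_on \<Omega>)"
  shows "locLp \<Omega> p (\<lambda>x. norm (F x - G x))"
  unfolding locLp_def
proof (intro conjI m allI impI)
  fix K assume K: "compact K \<and> K \<subseteq> \<Omega>"
  have [measurable]: "(\<lambda>x. norm (F x - G x)) \<in> borel_measurable (lebesgue_on K)"
    using measurable_lebesgue_on_subset[OF m] K by auto
  have i: "integrable (lebesgue_on K) (\<lambda>x. norm (F x) powr p)" "integrable (lebesgue_on K) (\<lambda>x. norm (G x) powr p)"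
    using assms(1,2) K by (auto simp: locLp_def)
  show "integrable (lebesgue_on K) (\<lambda>x. \<bar>norm (F x - G x)\<bar> powr p)"
  proof (rule Bochner_Integration.integrable_bound)
    show "integrable (lebesgue_on K) (\<lambda>x. 2 powr p * (norm (F x) powr p + norm (G x) powr p))" using i by simp
    show "AE x in lebesgue_on K. norm (\<bar>norm (F x - G x)\<bar> powr p) \<le> norm (2 powr p * (norm (F x) powr p + norm (G x) powr p))"
    proof (rule AE_I2)
      fix x
      have "norm (F x - G x) powr p \<le> (norm (F x) + norm (G x)) powr p"
        using assms(3) by (intro powr_mono2 norm_triangle_ineq4) auto
      also have "\<dots> \<le> 2 powr p * (norm (F x) powr p + norm (G x) powr p)"
        using assms(3) by (intro powr_add_le_max) auto
      finally show "norm (\<bar>norm (F x - G x)\<bar> powr p) \<le> norm (2 powr p * (norm (F x) powr p + norm (G x) powr p))" by simp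
    qed
  qed measurable
qed

lemma locLinf_imp_locLp:
  fixes U :: "real^'n \<Rightarrow> real"
  assumes U: "locLinf \<Omega> U" and p: "0 \<le> p"
  shows "locLp \<Omega> p U"
  unfolding locLp_def
proof (intro conjI allI impI)
  show m: "U \<in> borel_measurable (lebesgue_on \<Omega>)" using U by (simp add: locLinf_def)
  fix K assume K: "compact K \<and> K \<subseteq> \<Omega>"
  have [measurable]: "U \<in> borel_measurable (lebesgue_on K)" using measurable_lebesgue_on_subset[OF m] K by auto
  interpret finite_measure "lebesgue_on K" using K finite_measure_lebesgue_on_compact by auto
  obtain C where C: "AE x in lebesgue_on K. \<bar>U x\<bar> \<le> C" using U K by (auto simp: locLinf_def)
  show "integrable (lebesgue_on K) (\<lambda>x. \<bar>U x\<bar> powr p)"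
  proof (rule integrable_const_bound)
    show "AE x in lebesgue_on K. norm (\<bar>U x\<bar> powr p) \<le> \<bar>C\<bar> powr p"
      using C by eventually_elim (use p in \<open>auto intro!: powr_mono2\<close>)
  qed measurable
qed

text \<open>For a simple function in the second argument the composition is glued from finitely many
  measurable pieces; continuity in that argument passes to the limit of simple functions.\<close>

lemma borel_measurable_caratheodory:
  fixes a :: "'a \<Rightarrow> 'b::{metric_space, second_countable_topology} \<Rightarrow> 'c::{metric_space}"
  assumes a: "\<And>\<xi>. (\<lambda>x. a x \<xi>) \<in> borel_measurable M" and c: "\<And>x. x \<in> space M \<Longrightarrow> continuous_on UNIV (a x)"
    and D: "D \<in> borel_measurable M"
  shows "(\<lambda>x. a x (D x)) \<in> borel_measurable M"
proof -
  obtain s where s: "\<And>i. simple_function M (s i)" "\<And>x. x \<in> space M \<Longrightarrow> (\<lambda>i. s i x) \<longlonglongrightarrow> D x"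
    using borel_measurable_implies_sequence_metric[OF D] by blast
  show ?thesis
  proof (rule borel_measurable_LIMSEQ_metric)
    fix i
    have fin: "finite (s i ` space M)" using s(1)[of i] by (rule simple_functionD)
    show "(\<lambda>x. a x (s i x)) \<in> borel_measurable M"
    proof (rule measurable_compose_countable'[where I="s i ` space M" and f="\<lambda>\<xi> x. a x \<xi>" and g="s i"])
      show "s i \<in> measurable M (count_space (s i ` space M))"
        using fin simple_functionD(2)[OF s(1)[of i]] by (auto simp: measurable_count_space_eq2)
    qed (use a fin in \<open>auto intro: countable_finite\<close>)
  next
    fix x assume x: "x \<in> space M"
    have "isCont (a x) (D x)" using c[OF x] by (simp add: continuous_on_eq_continuous_at)
    then show "(\<lambda>i. a x (s i x)) \<longlonglongrightarrow> a x (D x)" using s(2)[OF x] by (rule isCont_tendsto_compose)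
  qed
qed

lemma ball_measure_unbounded:
  "\<exists>\<rho>>0. B \<le> measure lborel (ball (0::'a::euclidean_space) \<rho>)"
proof -
  define V where "V = unit_ball_vol (real DIM('a))"
  have V: "V > 0" by (simp add: V_def)
  \<comment> \<open>A radius of at least 1 makes its power with the dimension as exponent at least
    the radius itself, so linear growth is enough.\<close>
  define \<rho> where "\<rho> = max 1 (B / V)"
  have \<rho>: "1 \<le> \<rho>" by (simp add: \<rho>_def)
  have "B \<le> V * \<rho>"
  proof -
    have "B / V \<le> \<rho>" by (simp add: \<rho>_def)
    then show ?thesis using V by (simp add: pos_divide_le_eq mult.commute)
  qed
  also have "\<dots> \<le> V * \<rho> ^ DIM('a)"
    using self_le_power[OF \<rho>, of "DIM('a)"] V by (intro mult_left_mono) auto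
  also have "\<dots> = measure lborel (ball (0::'a) \<rho>)" using \<rho> by (simp add: content_ball V_def)
  finally show ?thesis using \<rho> by (intro exI[of _ \<rho>]) auto
qed

text \<open>The abstract energy argument receives its two inputs from the same composition scheme:
  the exponent 2 yields the energy inequality, the exponent r + 1 the Faber-Krahn inequality. The
  condition c <= k0 keeps all truncations inside \<open>K\<close>.\<close>

lemma no_positive_essential_supremum:
  fixes w R :: "real^'n \<Rightarrow> real" and F G :: "real^'n \<Rightarrow> real^'n"
  assumes \<Omega>: "open \<Omega>" and wg: "weak_grad \<Omega> w G" and K: "compact K" "K \<subseteq> \<Omega>"
    and c: "AE x in lebesgue. x \<in> \<Omega> - K \<longrightarrow> w x \<le> c" "0 \<le> c"
    and S: "AE x in lebesgue. x \<in> \<Omega> \<longrightarrow> w x \<le> S" and k0: "c \<le> k0" "k0 < S"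
    and p: "locLp \<Omega> p (\<lambda>x. norm (G x))" and r: "1 < r" "r \<le> p"
    and F: "F \<in> borel_measurable (lebesgue_on \<Omega>)"
    and Q: "\<And>\<phi>. test_fun \<Omega> \<phi> \<Longrightarrow> (\<And>x. 0 \<le> \<phi> x) \<Longrightarrow>
      integrable (lebesgue_on \<Omega>) (\<lambda>x. R x * \<phi> x) \<and>
      (\<integral>x. F x \<bullet> grad \<phi> x \<partial>lebesgue_on \<Omega>) \<le> (\<integral>x. R x * \<phi> x \<partial>lebesgue_on \<Omega>)"
    and dom: "(\<exists>H. locLp \<Omega> 1 H \<and> (\<forall>x\<in>\<Omega>. \<forall>d\<ge>0. norm (F x) * d \<le> H x + 2 * d powr p)) \<or>
      (locLp \<Omega> 1 (\<lambda>x. norm (F x)) \<and> locLinf \<Omega> (\<lambda>x. norm (G x)))"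
    and \<gamma>: "0 < \<gamma>" and coer: "\<And>x. x \<in> \<Omega> \<Longrightarrow> \<gamma> * norm (G x) powr r \<le> F x \<bullet> G x"
    and C: "0 < C" and est: "AE x in lebesgue. x \<in> K \<and> k0 < w x \<longrightarrow> R x \<le> C * (norm (G x) powr (r - 1) + norm (G x) powr r)"
  shows "\<exists>k<S. k0 \<le> k \<and> (AE x in lebesgue. x \<in> \<Omega> \<longrightarrow> w x \<le> k)"
proof -
  let ?M = "lebesgue_on K"
  interpret finite_measure ?M using K finite_measure_lebesgue_on_compact by auto
  have Kl: "K \<in> sets lebesgue" using K by simp
  have AEM: "(AE x in ?M. P x) \<longleftrightarrow> (AE x in lebesgue. x \<in> K \<longrightarrow> P x)" for P
    by (rule AE_restrict_space_iff) (simp add: Kl)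
  have p1: "1 \<le> p" using r by simp
  have S0: "0 \<le> S" using c k0 by simp
  have wm[measurable]: "w \<in> borel_measurable ?M" and Gm[measurable]: "G \<in> borel_measurable ?M"
    using weak_grad_borel_measurable[OF wg] measurable_lebesgue_on_subset K(2) by blast+
  have SM: "AE x in ?M. w x \<le> S" unfolding AEM using S by eventually_elim (use K in auto)
  define d where "d x = norm (G x)" for x
  have [measurable]: "d \<in> borel_measurable ?M" unfolding d_def by measurable
  have dp: "integrable ?M (\<lambda>x. d x powr p)" using p K by (simp add: locLp_def d_def)
  have ds: "integrable ?M (\<lambda>x. d x powr s)" if "0 \<le> s" "s \<le> p" for s
  proof (rule Bochner_Integration.integrable_bound)
    show "integrable ?M (\<lambda>x. 1 + d x powr p)" using dp by simp
    show "AE x in ?M. norm (d x powr s) \<le> norm (1 + d x powr p)"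
      using powr_le_one_add_powr[of "d _" s p] that by (intro AE_I2) (auto simp: d_def intro: order_trans)
  qed measurable
  \<comment> \<open>The locale asks for one bound on the function and on its derivative, so the two
    maxima on values at most \<open>S\<close> are added.\<close>
  have comp: "weak_grad_composition \<Omega> K w G c S p (\<lambda>t. max 0 (t - k) powr b) (\<lambda>t. b * max 0 (t - k) powr (b - 1)) k
      ((S - k) powr b + b * (S - k) powr (b - 1))" if k: "k0 \<le> k" "k < S" and b: "1 < b" for k b
  proof
    fix t
    show "((\<lambda>t. max 0 (t - k) powr b) has_real_derivative b * max 0 (t - k) powr (b - 1)) (at t)"
      using b by (rule positive_part_powr_has_derivative)
    assume t: "t \<le> S"
    have "max 0 (t - k) powr b \<le> (S - k) powr b" using t k b by (intro powr_mono2) auto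
    then show "max 0 (t - k) powr b \<le> (S - k) powr b + b * (S - k) powr (b - 1)" using b by (simp add: add_increasing2)
    have "max 0 (t - k) powr (b - 1) \<le> (S - k) powr (b - 1)" using t k b by (intro powr_mono2) auto
    then show "b * max 0 (t - k) powr (b - 1) \<le> (S - k) powr b + b * (S - k) powr (b - 1)"
      using b by (simp add: add_increasing)
  next
    show "continuous_on UNIV (\<lambda>t. b * max 0 (t - k) powr (b - 1))"
      using b by (intro continuous_on_mult continuous_on_const continuous_on_positive_part_powr) auto
  qed (use \<Omega> wg K c S S0 p1 p k k0 b in auto)
  have "\<exists>k<S. k0 \<le> k \<and> (AE x in ?M. w x \<le> k)"
  proof -
    obtain \<rho>0 where \<rho>0: "0 < \<rho>0" "2 * measure ?M (space ?M) \<le> measure lborel (ball (0::real^'n) \<rho>0)"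
      using ball_measure_unbounded by blast
    show ?thesis
    proof (rule energy_faber_krahn_bound[where d=d and m="\<lambda>\<rho>. measure lborel (ball (0::real^'n) \<rho>)", OF _ _ _ SM r(1) \<gamma> C k0(2) _ _ _ _ \<rho>0])
      show "w \<in> borel_measurable ?M" "d \<in> borel_measurable ?M" "0 \<le> d x" for x by (auto simp: d_def)
      show "integrable ?M (\<lambda>x. d x powr r)" using ds[of r] r by simp
      show "0 < measure lborel (ball (0::real^'n) \<rho>)" if "0 < \<rho>" for \<rho> using content_ball_pos[OF that] by simp
    next
      fix k \<rho> :: real assume k: "k0 \<le> k" "k < S" and \<rho>: "0 \<le> \<rho>"
      have "measure lebesgue {x\<in>K. k < w x} = measure ?M {x\<in>space ?M. k < w x}"
        using Kl by (subst measure_restrict_space) auto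
      moreover have "measure lborel (ball (0::real^'n) \<rho>) * (\<integral>x. max 0 (w x - k) powr (r + 1) \<partial>?M) \<le>
        measure lebesgue {x\<in>K. k < w x} * (\<integral>x. max 0 (w x - k) powr (r + 1) \<partial>?M) +
        measure lborel (ball (0::real^'n) \<rho>) * (\<rho> * (\<integral>x. ((r + 1) * max 0 (w x - k) powr ((r + 1) - 1)) * norm (G x) \<partial>?M))"
      proof (rule weak_grad_composition.faber_krahn_weak_grad[OF _ \<rho>])
        show "weak_grad_composition \<Omega> K w G c S p (\<lambda>t. max 0 (t - k) powr (r + 1))
            (\<lambda>t. (r + 1) * max 0 (t - k) powr ((r + 1) - 1)) k ((S - k) powr (r + 1) + (r + 1) * (S - k) powr ((r + 1) - 1))"
          using r k by (intro comp) auto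
      qed
      ultimately show "measure lborel (ball (0::real^'n) \<rho>) * (\<integral>x. max 0 (w x - k) powr (r + 1) \<partial>?M) \<le>
        measure ?M {x\<in>space ?M. k < w x} * (\<integral>x. max 0 (w x - k) powr (r + 1) \<partial>?M) +
        measure lborel (ball (0::real^'n) \<rho>) * (\<rho> * (\<integral>x. (r + 1) * max 0 (w x - k) powr r * d x \<partial>?M))"
        by (simp add: d_def)
    next
      fix k :: real assume k: "k0 \<le> k" "k < S"
      have t: "integrable ?M (\<lambda>x. (F x \<bullet> G x) * (2 * max 0 (w x - k) powr (2 - 1)))"
        "integrable ?M (\<lambda>x. R x * max 0 (w x - k) powr 2)"
        "(\<integral>x. (F x \<bullet> G x) * (2 * max 0 (w x - k) powr (2 - 1)) \<partial>?M) \<le> (\<integral>x. R x * max 0 (w x - k) powr 2 \<partial>?M)"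
      proof -
        have "weak_grad_composition \<Omega> K w G c S p (\<lambda>t. max 0 (t - k) powr 2)
            (\<lambda>t. 2 * max 0 (t - k) powr (2 - 1)) k ((S - k) powr 2 + 2 * (S - k) powr (2 - 1))"
          using k by (intro comp) auto
        note T = weak_grad_composition.tested_inequality[OF this F Q dom]
        show "integrable ?M (\<lambda>x. (F x \<bullet> G x) * (2 * max 0 (w x - k) powr (2 - 1)))" by (rule T(1))
        show "integrable ?M (\<lambda>x. R x * max 0 (w x - k) powr 2)" by (rule T(2))
        show "(\<integral>x. (F x \<bullet> G x) * (2 * max 0 (w x - k) powr (2 - 1)) \<partial>?M) \<le> (\<integral>x. R x * max 0 (w x - k) powr 2 \<partial>?M)" by (rule T(3))
      qed
      have le1: "AE x in ?M. 2 * \<gamma> * (d x powr r * max 0 (w x - k)) \<le> (F x \<bullet> G x) * (2 * max 0 (w x - k) powr (2 - 1))"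
        unfolding AEM
      proof (rule AE_I2, rule impI)
        fix x assume "x \<in> K"
        then have "\<gamma> * d x powr r \<le> F x \<bullet> G x" using coer K by (auto simp: d_def)
        then have "(\<gamma> * d x powr r) * (2 * max 0 (w x - k)) \<le> (F x \<bullet> G x) * (2 * max 0 (w x - k))"
          by (intro mult_right_mono) auto
        then show "2 * \<gamma> * (d x powr r * max 0 (w x - k)) \<le> (F x \<bullet> G x) * (2 * max 0 (w x - k) powr (2 - 1))"
          by (simp add: mult_ac)
      qed
      \<comment> \<open>Coercivity itself gives integrability: the non-negative energy density lies
        below the integrable tested flux.\<close>
      have i1: "integrable ?M (\<lambda>x. 2 * \<gamma> * (d x powr r * max 0 (w x - k)))"
      proof (rule Bochner_Integration.integrable_bound[OF t(1)])
        show "AE x in ?M. norm (2 * \<gamma> * (d x powr r * max 0 (w x - k))) \<le> norm ((F x \<bullet> G x) * (2 * max 0 (w x - k) powr (2 - 1)))"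
          using le1
        proof eventually_elim
          case (elim x)
          have "0 \<le> 2 * \<gamma> * (d x powr r * max 0 (w x - k))" using \<gamma> by simp
          then show ?case using elim by (metis abs_of_nonneg order_trans real_norm_def)
        qed
      qed measurable
      have i2: "integrable ?M (\<lambda>x. C * ((d x powr (r - 1) + d x powr r) * max 0 (w x - k) powr 2))"
      proof (rule Bochner_Integration.integrable_bound)
        show "integrable ?M (\<lambda>x. C * ((d x powr (r - 1) + d x powr r) * (S - k) powr 2))"
          using ds[of "r - 1"] ds[of r] r by simp
        show "AE x in ?M. norm (C * ((d x powr (r - 1) + d x powr r) * max 0 (w x - k) powr 2)) \<le>
            norm (C * ((d x powr (r - 1) + d x powr r) * (S - k) powr 2))"
          using SM
        proof eventually_elim
          case (elim x)
          have "max 0 (w x - k) powr 2 \<le> (S - k) powr 2" using elim k by (intro powr_mono2) auto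
          then have "C * ((d x powr (r - 1) + d x powr r) * max 0 (w x - k) powr 2) \<le> C * ((d x powr (r - 1) + d x powr r) * (S - k) powr 2)"
            using C by (intro mult_left_mono) auto
          moreover have "0 \<le> C * ((d x powr (r - 1) + d x powr r) * max 0 (w x - k) powr 2)" using C by simp
          ultimately show ?case by (metis abs_of_nonneg order_trans real_norm_def)
        qed
      qed measurable
      have "2 * \<gamma> * (\<integral>x. d x powr r * max 0 (w x - k) \<partial>?M) = (\<integral>x. 2 * \<gamma> * (d x powr r * max 0 (w x - k)) \<partial>?M)" by simp
      also have "\<dots> \<le> (\<integral>x. (F x \<bullet> G x) * (2 * max 0 (w x - k) powr (2 - 1)) \<partial>?M)"
        by (rule integral_mono_AE[OF i1 t(1) le1])
      also have "\<dots> \<le> (\<integral>x. R x * max 0 (w x - k) powr 2 \<partial>?M)" by (rule t(3))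
      also have "\<dots> \<le> (\<integral>x. C * ((d x powr (r - 1) + d x powr r) * max 0 (w x - k) powr 2) \<partial>?M)"
      proof (rule integral_mono_AE[OF t(2) i2])
        show "AE x in ?M. R x * max 0 (w x - k) powr 2 \<le> C * ((d x powr (r - 1) + d x powr r) * max 0 (w x - k) powr 2)"
          unfolding AEM using est
        proof eventually_elim
          case (elim x)
          show ?case
          proof
            assume x: "x \<in> K"
            show "R x * max 0 (w x - k) powr 2 \<le> C * ((d x powr (r - 1) + d x powr r) * max 0 (w x - k) powr 2)"
            proof (cases "k < w x")
              case True
              then have "R x \<le> C * (d x powr (r - 1) + d x powr r)" using elim x k by (auto simp: d_def)
              then have "R x * max 0 (w x - k) powr 2 \<le> (C * (d x powr (r - 1) + d x powr r)) * max 0 (w x - k) powr 2"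
                by (intro mult_right_mono) auto
              then show ?thesis by (simp add: mult.assoc)
            qed simp
          qed
        qed
      qed
      also have "\<dots> = C * (\<integral>x. (d x powr (r - 1) + d x powr r) * max 0 (w x - k) powr 2 \<partial>?M)" by simp
      finally show "2 * \<gamma> * (\<integral>x. d x powr r * max 0 (w x - k) \<partial>?M) \<le> C * (\<integral>x. (d x powr (r - 1) + d x powr r) * max 0 (w x - k) powr 2 \<partial>?M)" .
    qed
  qed
  then obtain k where k: "k < S" "k0 \<le> k" "AE x in lebesgue. x \<in> K \<longrightarrow> w x \<le> k" unfolding AEM by blast
  \<comment> \<open>Off \<open>K\<close> the bound c <= k0 <= k is already known.\<close>
  have "AE x in lebesgue. x \<in> \<Omega> \<longrightarrow> w x \<le> k" using k(3) c(1) by eventually_elim (use k k0 in auto)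
  then show ?thesis using k by blast
qed

text \<open>The infimum of all essential upper bounds is again one, since countably many null sets
  suffice for the bounds \<open>Inf T + 1 / real (Suc n)\<close>. It is positive because 0 is not an
  essential upper bound.\<close>

lemma essential_supremum_exists:
  fixes w :: "'a \<Rightarrow> real"
  assumes b: "AE x in M. P x \<longrightarrow> w x \<le> b" and n: "\<not> (AE x in M. P x \<longrightarrow> w x \<le> 0)"
  obtains S where "0 < S" "AE x in M. P x \<longrightarrow> w x \<le> S" "\<And>k. k < S \<Longrightarrow> \<not> (AE x in M. P x \<longrightarrow> w x \<le> k)"
proof -
  define T where "T = {s. AE x in M. P x \<longrightarrow> w x \<le> s}"
  have up: "t \<in> T" if "s \<in> T" "s \<le> t" for s t
    using that unfolding T_def mem_Collect_eq by (auto elim!: eventually_mono)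
  have T0: "T \<noteq> {}" using b by (auto simp: T_def)
  have T1: "0 < s" if "s \<in> T" for s using n up[OF that, of 0] by (force simp: T_def)
  have bdd: "bdd_below T" using T1 by (intro bdd_belowI[of _ 0]) (auto intro: less_imp_le)
  have "Inf T + 1 / real (Suc n) \<in> T" for n
  proof -
    obtain s where "s \<in> T" "s < Inf T + 1 / real (Suc n)" using cInf_lessD[OF T0, of "Inf T + 1 / real (Suc n)"] by auto
    then show ?thesis using up by auto
  qed
  moreover have "AE x in M. P x \<longrightarrow> w x \<le> s" if "s \<in> T" for s using that by (simp add: T_def)
  ultimately have "AE x in M. \<forall>n. P x \<longrightarrow> w x \<le> Inf T + 1 / real (Suc n)"
    unfolding AE_all_countable by blast
  then have AE: "AE x in M. P x \<longrightarrow> w x \<le> Inf T"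
  proof eventually_elim
    case (elim x)
    have "(\<lambda>n. Inf T + inverse (real (Suc n))) \<longlonglongrightarrow> Inf T + 0"
      by (intro tendsto_intros LIMSEQ_inverse_real_of_nat)
    then show ?case using elim by (auto intro!: LIMSEQ_le_const simp: divide_inverse)
  qed
  show ?thesis
  proof (rule that[of "Inf T"])
    show "0 < Inf T" using AE T1 by (simp add: T_def)
    show "\<not> (AE x in M. P x \<longrightarrow> w x \<le> k)" if "k < Inf T" for k
      using cInf_lower[OF _ bdd, of k] that by (auto simp: T_def)
  qed (rule AE)
qed

theorem theorem1p3:
  fixes \<Omega> :: "(real^'n) set"
    and p q \<sigma> \<gamma> :: real
    and a :: "real^'n \<Rightarrow> real^'n \<Rightarrow> real^'n"
    and f g :: "real^'n \<Rightarrow> real \<Rightarrow> real"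
    and u v :: "real^'n \<Rightarrow> real"
    and Du Dv :: "real^'n \<Rightarrow> real^'n"
  assumes dom: "open \<Omega>" "connected \<Omega>" "bounded \<Omega>"
    and pq: "2 \<le> p" "1 < q" "q \<le> p" "0 < \<sigma>"
    and a_meas: "\<And>\<xi>. (\<lambda>x. a x \<xi>) \<in> borel_measurable (lebesgue_on \<Omega>)"
    and a_cont: "\<And>x. x \<in> \<Omega> \<Longrightarrow> continuous_on UNIV (a x)"
    and gamma: "0 < \<gamma>"
    and a_mon: "\<And>x \<xi> \<eta> r. x \<in> \<Omega> \<Longrightarrow> max 2 q \<le> r \<Longrightarrow> r \<le> p \<Longrightarrow>
                  (a x \<xi> - a x \<eta>) \<bullet> (\<xi> - \<eta>) \<ge> \<gamma> * norm (\<xi> - \<eta>) powr r"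
    and f_cont: "continuous_on (\<Omega> \<times> UNIV) (\<lambda>(x, t). f x t)"
    and g_cont: "continuous_on (\<Omega> \<times> UNIV) (\<lambda>(x, t). g x t)"
    and f_mono: "\<And>x. x \<in> \<Omega> \<Longrightarrow> mono (f x)"
    and g_mono: "\<And>x. x \<in> \<Omega> \<Longrightarrow> mono (g x)"
    and Du: "weak_grad \<Omega> u Du"
    and Dv: "weak_grad \<Omega> v Dv"
    and cases:
      "(W1p_loc \<Omega> p u \<and> locLinf \<Omega> u \<and> W1p_loc \<Omega> p v \<and> locLinf \<Omega> v \<and>
        locLp \<Omega> (p / (p - 1)) (\<lambda>x. norm (a x (Du x))) \<and>
        locLp \<Omega> (p / (p - 1)) (\<lambda>x. norm (a x (Dv x))) \<and>
        locLp \<Omega> (p / (p - 1)) (\<lambda>x. f x (u x)) \<and>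
        locLp \<Omega> (p / (p - 1)) (\<lambda>x. f x (v x)) \<and>
        ( (\<sigma> \<le> 1 \<and> (\<forall>x\<in>\<Omega>. strict_mono (f x)))
        \<or> (1 \<le> \<sigma> \<and> \<sigma> \<le> max q 2 - 1 \<and> (\<forall>x\<in>\<Omega>. strict_mono (f x)) \<and> (\<forall>x\<in>\<Omega>. strict_mono (g x)))
        \<or> (max q 2 - 1 \<le> \<sigma> \<and> \<sigma> \<le> p - 1 \<and> (\<forall>x\<in>\<Omega>. strict_mono (g x)))
        \<or> (p - 1 \<le> \<sigma> \<and> \<sigma> \<le> p \<and> (\<forall>x\<in>\<Omega>. strict_mono (g x)) \<and>
             (\<exists>C. AE x in lebesgue_on \<Omega>. u x - v x \<le> C))))
       \<or>
       (W1inf_loc \<Omega> u \<and> W1inf_loc \<Omega> v \<and>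
        locLp \<Omega> 1 (\<lambda>x. norm (a x (Du x))) \<and>
        locLp \<Omega> 1 (\<lambda>x. norm (a x (Dv x))) \<and>
        locLp \<Omega> 1 (\<lambda>x. f x (u x)) \<and>
        locLp \<Omega> 1 (\<lambda>x. f x (v x)) \<and>
        p \<le> \<sigma> \<and> (\<forall>x\<in>\<Omega>. strict_mono (g x)))"
    and Q: "Qstar_le \<Omega> a f g \<sigma> u Du v Dv"
    and bd: "bdry_le \<Omega> u v"
  shows "AE x in lebesgue_on \<Omega>. u x \<le> v x"
proof -
  let ?w = "\<lambda>x. u x - v x" and ?G = "\<lambda>x. Du x - Dv x"
  let ?F = "\<lambda>x. a x (Du x) - a x (Dv x)"
  let ?R = "\<lambda>x. f x (v x) + g x (v x) * norm (Dv x) powr \<sigma> - f x (u x) - g x (u x) * norm (Du x) powr \<sigma>"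
  note \<Omega> = dom(1)
  have \<Omega>l: "\<Omega> \<in> sets lebesgue" using \<Omega> by simp
  have wg: "weak_grad \<Omega> ?w ?G" by (rule weak_grad_diff[OF \<Omega> Du Dv])
  have am: "(\<lambda>x. a x (Du x)) \<in> borel_measurable (lebesgue_on \<Omega>)" "(\<lambda>x. a x (Dv x)) \<in> borel_measurable (lebesgue_on \<Omega>)"
    by (rule borel_measurable_caratheodory[OF a_meas _ weak_grad_borel_measurable(2)[OF Du]], simp add: a_cont)
       (rule borel_measurable_caratheodory[OF a_meas _ weak_grad_borel_measurable(2)[OF Dv]], simp add: a_cont)
  have Fm: "?F \<in> borel_measurable (lebesgue_on \<Omega>)" using am by measurable
  have Fnm: "(\<lambda>x. norm (?F x)) \<in> borel_measurable (lebesgue_on \<Omega>)" using Fm by measurable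
  have Gm: "(\<lambda>x. norm (?G x)) \<in> borel_measurable (lebesgue_on \<Omega>)"
    using weak_grad_borel_measurable(2)[OF wg] by measurable
  have Q': "integrable (lebesgue_on \<Omega>) (\<lambda>x. ?R x * \<phi> x) \<and>
      (\<integral>x. ?F x \<bullet> grad \<phi> x \<partial>lebesgue_on \<Omega>) \<le> (\<integral>x. ?R x * \<phi> x \<partial>lebesgue_on \<Omega>)"
    if "test_fun \<Omega> \<phi>" "\<And>x. 0 \<le> \<phi> x" for \<phi>
  proof -
    have "test_fun \<Omega> \<phi> \<and> (\<forall>x. 0 \<le> \<phi> x)" using that by blast
    from Q[unfolded Qstar_le_def Let_def, THEN spec, THEN mp, OF this] show ?thesis by (rule conjunct2)
  qed
  have linf: "locLinf \<Omega> u" "locLinf \<Omega> v" using cases by (auto simp: W1inf_loc_def)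
  have bounded: "\<exists>m. AE x in lebesgue. x \<in> K \<longrightarrow> \<bar>u x\<bar> \<le> m \<and> \<bar>v x\<bar> \<le> m" if K: "compact K" "K \<subseteq> \<Omega>" for K
  proof -
    obtain m1 m2 where "AE x in lebesgue_on K. \<bar>u x\<bar> \<le> m1" "AE x in lebesgue_on K. \<bar>v x\<bar> \<le> m2"
      using linf K unfolding locLinf_def by blast
    then have "AE x in lebesgue. x \<in> K \<longrightarrow> \<bar>u x\<bar> \<le> m1" "AE x in lebesgue. x \<in> K \<longrightarrow> \<bar>v x\<bar> \<le> m2"
      using K by (simp_all add: AE_restrict_space_iff)
    then have "AE x in lebesgue. x \<in> K \<longrightarrow> \<bar>u x\<bar> \<le> max m1 m2 \<and> \<bar>v x\<bar> \<le> max m1 m2"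
      by eventually_elim auto
    then show ?thesis by blast
  qed
  have bd': "\<exists>K. compact K \<and> K \<subseteq> \<Omega> \<and> (AE x in lebesgue. x \<in> \<Omega> - K \<longrightarrow> ?w x \<le> e)" if e: "0 < e" for e
  proof -
    obtain K where K: "compact K" "K \<subseteq> \<Omega>" "AE x in lebesgue_on (\<Omega> - K). u x - v x \<le> e"
      using bd[unfolded bdry_le_def, rule_format, OF e] by blast
    have "\<Omega> - K \<in> sets lebesgue" using \<Omega>l compact_lebesgue[OF K(1)] by (rule sets.Diff)
    then have "AE x in lebesgue. x \<in> \<Omega> - K \<longrightarrow> ?w x \<le> e" using K(3) by (simp add: AE_restrict_space_iff)
    with K(1,2) show ?thesis by blast
  qed
  \<comment> \<open>Two settings are merged here: gradients in L^p with fluxes in the conjugate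
    class, and bounded gradients with fluxes that are only locally integrable. The first setting has
    \<open>\<sigma>\<close> <= p, so p < \<open>\<sigma>\<close> forces bounded gradients.\<close>
  have Gp: "locLp \<Omega> p (\<lambda>x. norm (?G x))"
    and dom': "(\<exists>H. locLp \<Omega> 1 H \<and> (\<forall>x\<in>\<Omega>. \<forall>d\<ge>0. norm (?F x) * d \<le> H x + 2 * d powr p)) \<or>
      (locLp \<Omega> 1 (\<lambda>x. norm (?F x)) \<and> locLinf \<Omega> (\<lambda>x. norm (?G x)))"
    and Ginf: "p < \<sigma> \<Longrightarrow> locLinf \<Omega> (\<lambda>x. norm (?G x))"
  proof -
    have "locLp \<Omega> p (\<lambda>x. norm (?G x)) \<and>
      ((\<exists>H. locLp \<Omega> 1 H \<and> (\<forall>x\<in>\<Omega>. \<forall>d\<ge>0. norm (?F x) * d \<le> H x + 2 * d powr p)) \<or>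
      (locLp \<Omega> 1 (\<lambda>x. norm (?F x)) \<and> locLinf \<Omega> (\<lambda>x. norm (?G x)))) \<and>
      (p < \<sigma> \<longrightarrow> locLinf \<Omega> (\<lambda>x. norm (?G x)))"
    proof -
      have "(W1p_loc \<Omega> p u \<and> W1p_loc \<Omega> p v \<and> locLp \<Omega> (p / (p - 1)) (\<lambda>x. norm (a x (Du x))) \<and>
          locLp \<Omega> (p / (p - 1)) (\<lambda>x. norm (a x (Dv x))) \<and> \<sigma> \<le> p) \<or>
        (W1inf_loc \<Omega> u \<and> W1inf_loc \<Omega> v \<and> locLp \<Omega> 1 (\<lambda>x. norm (a x (Du x))) \<and> locLp \<Omega> 1 (\<lambda>x. norm (a x (Dv x))))"
        using cases pq by (elim disjE) auto
      then consider (A) "W1p_loc \<Omega> p u" "W1p_loc \<Omega> p v" "locLp \<Omega> (p / (p - 1)) (\<lambda>x. norm (a x (Du x)))"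
          "locLp \<Omega> (p / (p - 1)) (\<lambda>x. norm (a x (Dv x)))" "\<sigma> \<le> p"
        | (B) "W1inf_loc \<Omega> u" "W1inf_loc \<Omega> v" "locLp \<Omega> 1 (\<lambda>x. norm (a x (Du x)))" "locLp \<Omega> 1 (\<lambda>x. norm (a x (Dv x)))"
        by blast
      then show ?thesis
      proof cases
        case A
      have "locLp \<Omega> p (\<lambda>x. norm (?G x))"
        using A pq Gm by (intro locLp_norm_diff W1p_loc_weak_grad[OF \<Omega> _ Du] W1p_loc_weak_grad[OF \<Omega> _ Dv]) auto
      moreover have "\<exists>H. locLp \<Omega> 1 H \<and> (\<forall>x\<in>\<Omega>. \<forall>d\<ge>0. norm (?F x) * d \<le> H x + 2 * d powr p)"
      proof (intro exI conjI ballI allI impI)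
        \<comment> \<open>Young's inequality is applied once to each of the two fluxes, which is the
          origin of the factor 2 in front of \<open>d powr p\<close>.\<close>
        let ?H = "\<lambda>x. norm (a x (Du x)) powr (p / (p - 1)) + norm (a x (Dv x)) powr (p / (p - 1))"
        show "locLp \<Omega> 1 ?H"
          unfolding locLp_1_iff[OF \<Omega>] using A am by (auto simp: locLp_def)
        fix x d assume "x \<in> \<Omega>" and d: "(0::real) \<le> d"
        have "norm (?F x) * d \<le> (norm (a x (Du x)) + norm (a x (Dv x))) * d"
          using d by (intro mult_right_mono norm_triangle_ineq4)
        also have "\<dots> = norm (a x (Du x)) * d + norm (a x (Dv x)) * d" by (rule distrib_right)
        also have "\<dots> \<le> ?H x + 2 * d powr p"
          using young_powr[of p "norm (a x (Du x))" d] young_powr[of p "norm (a x (Dv x))" d] pq d by simp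
        finally show "norm (?F x) * d \<le> ?H x + 2 * d powr p" .
      qed
      ultimately show ?thesis using A(5) by auto
    next
      case A: B
      have 1: "locLinf \<Omega> (\<lambda>x. norm (?G x))"
        unfolding locLinf_def
      proof (intro conjI Gm allI impI)
        fix K assume K: "compact K \<and> K \<subseteq> \<Omega>"
        obtain C1 where C1: "AE x in lebesgue_on K. \<bar>norm (Du x)\<bar> \<le> C1"
          using W1inf_loc_weak_grad[OF \<Omega> _ Du] A K unfolding locLinf_def by blast
        obtain C2 where C2: "AE x in lebesgue_on K. \<bar>norm (Dv x)\<bar> \<le> C2"
          using W1inf_loc_weak_grad[OF \<Omega> _ Dv] A K unfolding locLinf_def by blast
        have "AE x in lebesgue_on K. \<bar>norm (?G x)\<bar> \<le> C1 + C2"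
          using C1 C2
        proof eventually_elim
          case (elim x)
          then show ?case using norm_triangle_ineq4[of "Du x" "Dv x"] by simp
        qed
        then show "\<exists>C. AE x in lebesgue_on K. \<bar>norm (?G x)\<bar> \<le> C" by blast
      qed
      have 2: "locLp \<Omega> p (\<lambda>x. norm (?G x))" using locLinf_imp_locLp[OF 1] pq by simp
      have 3: "locLp \<Omega> 1 (\<lambda>x. norm (?F x))" using A Fnm by (intro locLp_norm_diff) auto
      show ?thesis using 1 2 3 by auto
    qed
    qed
    then show "locLp \<Omega> p (\<lambda>x. norm (?G x))"
      "(\<exists>H. locLp \<Omega> 1 H \<and> (\<forall>x\<in>\<Omega>. \<forall>d\<ge>0. norm (?F x) * d \<le> H x + 2 * d powr p)) \<or>
      (locLp \<Omega> 1 (\<lambda>x. norm (?F x)) \<and> locLinf \<Omega> (\<lambda>x. norm (?G x)))"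
      "p < \<sigma> \<Longrightarrow> locLinf \<Omega> (\<lambda>x. norm (?G x))" by blast+
  qed
  have "AE x in lebesgue. x \<in> \<Omega> \<longrightarrow> ?w x \<le> 0"
  proof (rule ccontr)
    assume contra: "\<not> (AE x in lebesgue. x \<in> \<Omega> \<longrightarrow> ?w x \<le> 0)"
    obtain K1 where K1: "compact K1" "K1 \<subseteq> \<Omega>" "AE x in lebesgue. x \<in> \<Omega> - K1 \<longrightarrow> ?w x \<le> 1" using bd'[of 1] by auto
    obtain m1 where m1: "AE x in lebesgue. x \<in> K1 \<longrightarrow> \<bar>u x\<bar> \<le> m1 \<and> \<bar>v x\<bar> \<le> m1" using bounded[OF K1(1,2)] by blast
    \<comment> \<open>Finiteness of the supremum: off \<open>K1\<close> the boundary condition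
      bounds w by 1, on \<open>K1\<close> the local bounds on u and v give
      \<open>2 * m1\<close>.\<close>
    have "AE x in lebesgue. x \<in> \<Omega> \<longrightarrow> ?w x \<le> max 1 (2 * m1)"
      using K1(3) m1 by eventually_elim auto
    then obtain S where S: "0 < S" "AE x in lebesgue. x \<in> \<Omega> \<longrightarrow> ?w x \<le> S"
      "\<And>k. k < S \<Longrightarrow> \<not> (AE x in lebesgue. x \<in> \<Omega> \<longrightarrow> ?w x \<le> k)"
      using essential_supremum_exists[OF _ contra] by blast
    \<comment> \<open>The level S/2 serves twice: w exceeds it only inside \<open>K\<close> up to a
      null set, and where w exceeds it, u and v differ by a fixed positive amount, as the uniform
      gap requires.\<close>
    obtain K where K: "compact K" "K \<subseteq> \<Omega>" "AE x in lebesgue. x \<in> \<Omega> - K \<longrightarrow> ?w x \<le> S / 2" using bd'[of "S / 2"] S by auto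
    obtain m where m: "AE x in lebesgue. x \<in> K \<longrightarrow> \<bar>u x\<bar> \<le> m \<and> \<bar>v x\<bar> \<le> m" using bounded[OF K(1,2)] by blast
    have "\<exists>L. AE x in lebesgue. x \<in> K \<longrightarrow> (p < \<sigma> \<longrightarrow> norm (?G x) \<le> L)"
    proof (cases "p < \<sigma>")
      case True
      obtain L where "AE x in lebesgue_on K. \<bar>norm (?G x)\<bar> \<le> L"
        using Ginf[OF True] K unfolding locLinf_def by blast
      then show ?thesis using K by (auto simp: AE_restrict_space_iff)
    qed auto
    then obtain L where L: "AE x in lebesgue. x \<in> K \<longrightarrow> (p < \<sigma> \<longrightarrow> norm (?G x) \<le> L)" by blast
    have fc: "continuous_on (K \<times> UNIV) (\<lambda>(x, t). f x t)" "continuous_on (K \<times> UNIV) (\<lambda>(x, t). g x t)"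
      using f_cont g_cont K(2) by (auto elim!: continuous_on_subset)
    have cs: "(\<sigma> \<le> 1 \<and> (\<forall>x\<in>K. strict_mono (f x)))
        \<or> (1 \<le> \<sigma> \<and> \<sigma> \<le> max q 2 - 1 \<and> (\<forall>x\<in>K. strict_mono (f x)) \<and> (\<forall>x\<in>K. strict_mono (g x)))
        \<or> (max q 2 - 1 \<le> \<sigma> \<and> \<sigma> \<le> p - 1 \<and> (\<forall>x\<in>K. strict_mono (g x)))
        \<or> (p - 1 \<le> \<sigma> \<and> (\<forall>x\<in>K. strict_mono (g x)))"
    proof -
      \<comment> \<open>The case (A_4) is folded into the last alternative; for p <
        \<open>\<sigma>\<close> the bound \<open>L\<close> on the gradients replaces the upper limit
        on \<open>\<sigma>\<close>.\<close>
      have "p \<le> \<sigma> \<Longrightarrow> p - 1 \<le> \<sigma>" by simp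
      with cases subsetD[OF K(2)] show ?thesis by meson
    qed
    have fgm: "mono (f x)" "mono (g x)" if "x \<in> K" for x using that K(2) f_mono g_mono by auto
    have S2: "0 < S / 2" using S(1) by simp
    obtain r C where r: "max 2 q \<le> r" "r \<le> p" "0 < C"
      and RC: "\<And>x s t \<xi> \<zeta>. x \<in> K \<Longrightarrow> \<bar>s\<bar> \<le> m \<Longrightarrow> \<bar>t\<bar> \<le> m \<Longrightarrow> t + S / 2 \<le> s \<Longrightarrow> (p < \<sigma> \<longrightarrow> norm (\<xi> - \<zeta>) \<le> L) \<Longrightarrow>
        f x t + g x t * norm (\<zeta> :: real^'n) powr \<sigma> - f x s - g x s * norm \<xi> powr \<sigma> \<le>
        C * (norm (\<xi> - \<zeta>) powr (r - 1) + norm (\<xi> - \<zeta>) powr r)"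
      using lower_order_bound[OF K(1) fc fgm pq S2 cs, of m L] by blast
    have est: "AE x in lebesgue. x \<in> K \<and> S / 2 < ?w x \<longrightarrow> ?R x \<le> C * (norm (?G x) powr (r - 1) + norm (?G x) powr r)"
      using m L
    proof eventually_elim
      case (elim x)
      then show ?case using RC[of x "u x" "v x" "Du x" "Dv x"] by auto
    qed
    have coer: "\<gamma> * norm (?G x) powr r \<le> ?F x \<bullet> ?G x" if "x \<in> \<Omega>" for x
      using a_mon[OF that r(1,2)] by simp
    have "1 < r" "0 \<le> S / 2" "S / 2 < S" using r S(1) by auto
    then have "\<exists>k<S. S / 2 \<le> k \<and> (AE x in lebesgue. x \<in> \<Omega> \<longrightarrow> ?w x \<le> k)"
      using no_positive_essential_supremum[OF \<Omega> wg K(1,2,3) _ S(2) order_refl _ Gp _ r(2) Fm Q' dom' gamma coer r(3) est]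
      by blast
    then show False using S(3) by blast
  qed
  then show ?thesis using \<Omega>l by (simp add: AE_restrict_space_iff)
qed

end
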